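(* Let $K_1, K_2, \dots, K_N$ be fields with $\mathbb{Q} \subseteq K_n \subseteq \overline{\mathbb{Q}}$ for each $n = 1, 2, \dots, N$, such that for each pair of integers $n_1 \neq n_2$ in $\{1,\dots,N\}$, either $K_{n_1}/(K_{n_1} \cap K_{n_2})$ is a (possibly infinite) Galois extension, or $K_{n_2}/(K_{n_1} \cap K_{n_2})$ is a (possibly infinite) Galois extension. For each $n = 1, 2, \dots, N$, let $$\mathcal{F} = \mathcal{D}_{K_n} \oplus \mathcal{E}_{K_n}$$ be the direct sum decomposition determined by the surjective, continuous, linear projection $S_{K_n} : \mathcal{F} \to \mathcal{D}_{K_n}$, with $\mathcal{E}_{K_n} = \ker S_{K_n}$. Then for $0 \le M \le N$, the $\mathbb{Q}$-linear subspace $$\mathcal{D}_{K_1} + \mathcal{D}_{K_2} + \cdots + \mathcal{D}_{K_M} + \mathcal{E}_{K_{M+1}} + \mathcal{E}_{K_{M+2}} + \cdots + \mathcal{E}_{K_N}$$ is $\mathcal{F}$-closed.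
   Context: $\overline{\mathbb{Q}}$ is a fixed algebraic closure of $\mathbb{Q}$, and $\mathcal{G} = \overline{\mathbb{Q}}^{\times}/\mathrm{Tor}(\overline{\mathbb{Q}}^{\times})$, a $\mathbb{Q}$-vector space written multiplicatively with scalar multiplication $(r/s,\alpha) \mapsto \alpha^{r/s}$. Let $Y$ be the set of all places $y$ of $\overline{\mathbb{Q}}$. For a number field $k$ and a place $v$ of $k$, let $Y(k,v) = \{y \in Y : y | v\}$. For $k/\mathbb{Q}$ finite Galois, $Y(k,v)$ is the inverse limit, over finite Galois extensions $l/\mathbb{Q}$ with $l \supseteq k$, of the finite sets of places of $l$ over $v$; $Y$ is the disjoint union of the $Y(k,v)$ over places $v$ of $k$ and has the resulting totally disconnected, locally compact, Hausdorff topology, in which each $Y(k,v)$ is compact and open (the topology is independent of $k$). $\mathcal{B}$ is the Borel $\sigma$-algebra of $Y$, and $\lambda$ is the regular Borel measure on $Y$, invariant under $\mathrm{Aut}(\overline{\mathbb{Q}}/\mathbb{Q})$, with $\lambda(Y(k,v)) = [k_v:\mathbb{Q}_v]/[k:\mathbb{Q}]$ for every number field $k$ and place $v$ of $k$. For $y \in Y$, $\|\cdot\|_y$ is the absolute value in $y$ whose restriction to $\mathbb{Q}$ is the usual Archimedean or $p$-adic absolute value. $\mathrm{Aut}(\overline{\mathbb{Q}}/\mathbb{Q})$ acts on $Y$ with $\|\alpha\|_{\tau^{-1}y} = \|\tau\alpha\|_y$. For $\alpha \in \mathcal{G}$ let $f_\alpha(y) = \log\|\alpha\|_y$, a continuous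 compactly supported function on $Y$; let $\mathcal{F} = \{f_\alpha : \alpha \in \mathcal{G}\}$, a $\mathbb{Q}$-linear subspace of the real Banach space $\mathcal{X} = \{F \in L^1(Y,\mathcal{B},\lambda) : \int_Y F\,d\lambda = 0\}$, given the $L^1$-norm. A subset $\mathcal{S} \subseteq \mathcal{F}$ is called $\mathcal{F}$-closed if $\mathcal{S} = \mathcal{F} \cap \mathrm{closure}\,\mathcal{S}$, where the closure is taken in $\mathcal{X}$ in the $L^1$-norm. For an algebraic extension $K/\mathbb{Q}$ in $\overline{\mathbb{Q}}$, $\mathcal{D}_K$ is the $\mathbb{Q}$-linear span in $\mathcal{F}$ of $\{f_\alpha : \alpha \in \text{image of } K^{\times} \text{ in } \mathcal{G}\}$. Let $\nu_K$ be the Haar measure on the profinite group $\mathrm{Aut}(\overline{\mathbb{Q}}/K)$ with total mass $1$, and for $F \in \mathcal{X}$ put $U_K(F)(y) = \int_{\mathrm{Aut}(\overline{\mathbb{Q}}/K)} F(\tau^{-1}y)\,d\nu_K(\tau)$ for $\lambda$-almost all $y$. $S_K$ is the restriction of $U_K$ to $\mathcal{F}$; it is a continuous $\mathbb{Q}$-linear projection of $\mathcal{F}$ onto $\mathcal{D}_K$. *)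

theory Defs
  imports
    "HOL-Analysis.Analysis"
    "HOL-Algebra.Algebraic_Closure_Type"
    "HOL-Algebra.QuotRing"
    "HOL-Algebra.Embedded_Algebras"
    "HOL-Library.Function_Algebras"
    "HOL-Library.Set_Algebras"
begin

section \<open>Subfields of the algebraic closure of the rationals\<close>

type_synonym qbar = "rat alg_closure"

abbreviation qbar_ring :: "qbar ring"
  where "qbar_ring \<equiv> ring_of_type_algebra"

text \<open>Every subfield contains the set \<open>\<rat>\<close> of rationals, and every subfield is algebraic over
  each of its subfields.\<close>

abbreviation is_subfield :: "qbar set \<Rightarrow> bool"
  where "is_subfield K \<equiv> subfield K qbar_ring"

definition number_field :: "qbar set \<Rightarrow> bool"
  where "number_field k \<longleftrightarrow> is_subfield k \<and> ring.finite_dimension qbar_ring \<rat> k"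

definition field_auts :: "qbar set \<Rightarrow> qbar set \<Rightarrow> (qbar \<Rightarrow> qbar) set"
  where "field_auts L K = {\<sigma> \<in> extensional L. bij_betw \<sigma> L L \<and>
    (\<forall>x\<in>L. \<forall>y\<in>L. \<sigma> (x + y) = \<sigma> x + \<sigma> y \<and> \<sigma> (x * y) = \<sigma> x * \<sigma> y) \<and> (\<forall>x\<in>K. \<sigma> x = x)}"

text \<open>Possibly infinite Galois extensions \<open>L/K\<close>: algebraic (automatic here), and \<open>K\<close> is the
  fixed field of \<open>Aut(L/K)\<close>.\<close>

definition galois_extension :: "qbar set \<Rightarrow> qbar set \<Rightarrow> bool"
  where "galois_extension L K \<longleftrightarrow> is_subfield L \<and> is_subfield K \<and> K \<subseteq> L \<and>
    {x \<in> L. \<forall>\<sigma>\<in>field_auts L K. \<sigma> x = x} = K"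

abbreviation abs_galois :: "qbar set \<Rightarrow> (qbar \<Rightarrow> qbar) set"
  where "abs_galois K \<equiv> field_auts UNIV K"


section \<open>Places\<close>

text \<open>Nontrivial absolute values on a field \<open>k\<close>.  They are made extensional so that an absolute
  value is determined by its values on \<open>k\<close>.\<close>

definition absolute_values :: "qbar set \<Rightarrow> (qbar \<Rightarrow> real) set"
  where "absolute_values k = {\<phi> \<in> extensional k.
    (\<forall>x\<in>k. 0 \<le> \<phi> x \<and> (\<phi> x = 0 \<longleftrightarrow> x = 0)) \<and>
    (\<forall>x\<in>k. \<forall>y\<in>k. \<phi> (x * y) = \<phi> x * \<phi> y \<and> \<phi> (x + y) \<le> \<phi> x + \<phi> y) \<and>
    (\<exists>x\<in>k. x \<noteq> 0 \<and> \<phi> x \<noteq> 1)}"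

definition place_rel :: "qbar set \<Rightarrow> ((qbar \<Rightarrow> real) \<times> (qbar \<Rightarrow> real)) set"
  where "place_rel k = {(\<phi>, \<psi>) \<in> absolute_values k \<times> absolute_values k.
    \<exists>c>0. \<forall>x\<in>k. \<psi> x = \<phi> x powr c}"

type_synonym place = "(qbar \<Rightarrow> real) set"

definition places :: "qbar set \<Rightarrow> place set"
  where "places k = absolute_values k // place_rel k"

abbreviation \<Y> :: "place set"
  where "\<Y> \<equiv> places UNIV"

text \<open>The place of \<open>k\<close> lying below a place \<open>w\<close> of a larger field, that is, the class of the
  restrictions to \<open>k\<close> of the absolute values in \<open>w\<close>.\<close>

definition place_below :: "qbar set \<Rightarrow> place \<Rightarrow> place"
  where "place_below k w = place_rel k `` ((\<lambda>\<phi>. restrict \<phi> k) ` w)"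

definition places_above :: "qbar set \<Rightarrow> qbar set \<Rightarrow> place \<Rightarrow> place set"
  where "places_above l k v = {w \<in> places l. place_below k w = v}"

abbreviation Y_fibre :: "qbar set \<Rightarrow> place \<Rightarrow> place set"
  where "Y_fibre k v \<equiv> places_above UNIV k v"

definition padic_abs :: "nat \<Rightarrow> rat \<Rightarrow> real"
  where "padic_abs p r = (if r = 0 then 0 else
    real p powi (int (multiplicity (int p) (snd (quotient_of r)))
               - int (multiplicity (int p) (fst (quotient_of r)))))"

definition normalised :: "(qbar \<Rightarrow> real) \<Rightarrow> bool"
  where "normalised \<phi> \<longleftrightarrow> (\<forall>r::rat. \<phi> (of_rat r) = \<bar>of_rat r\<bar>) \<or>
    (\<exists>p::nat. Factorial_Ring.prime p \<and> (\<forall>r::rat. \<phi> (of_rat r) = padic_abs p r))"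

definition norm_at :: "place \<Rightarrow> qbar \<Rightarrow> real"
  where "norm_at v = (THE \<phi>. \<phi> \<in> v \<and> normalised \<phi>)"

text \<open>\<open>act \<tau> y\<close> is \<open>\<tau>y\<close>; thus the absolute values in \<open>\<tau>\<^sup>-\<^sup>1y\<close> are the \<open>\<phi> \<circ> \<tau>\<close> with \<open>\<phi> \<in> y\<close>.\<close>

definition act :: "(qbar \<Rightarrow> qbar) \<Rightarrow> place \<Rightarrow> place"
  where "act \<tau> y = (\<lambda>\<phi>. \<phi> \<circ> inv_into UNIV \<tau>) ` y"


section \<open>Global and local degrees\<close>

definition global_degree :: "qbar set \<Rightarrow> nat"
  where "global_degree k = ring.dim qbar_ring \<rat> k"

text \<open>The completion \<open>k\<^sub>v\<close> is the ring of Cauchy sequences in \<open>k\<close> modulo the null sequences.\<close>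

definition cauchy_ring :: "qbar set \<Rightarrow> place \<Rightarrow> (nat \<Rightarrow> qbar) ring"
  where "cauchy_ring k v =
    \<lparr>carrier = {s. range s \<subseteq> k \<and>
        (\<forall>e>0. \<exists>n0. \<forall>m\<ge>n0. \<forall>n\<ge>n0. norm_at v (s m - s n) < e)},
     monoid.mult = (\<lambda>s t n. s n * t n), one = (\<lambda>n. 1),
     zero = (\<lambda>n. 0), add = (\<lambda>s t n. s n + t n)\<rparr>"

definition null_sequences :: "qbar set \<Rightarrow> place \<Rightarrow> (nat \<Rightarrow> qbar) set"
  where "null_sequences k v =
    {s \<in> carrier (cauchy_ring k v). (\<lambda>n. norm_at v (s n)) \<longlonglongrightarrow> 0}"

definition completion :: "qbar set \<Rightarrow> place \<Rightarrow> (nat \<Rightarrow> qbar) set ring"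
  where "completion k v = cauchy_ring k v Quot null_sequences k v"

text \<open>The canonical copy of \<open>\<rat>\<^sub>v\<close> in \<open>k\<^sub>v\<close>: the classes of the rational Cauchy sequences.\<close>

definition rat_completion :: "qbar set \<Rightarrow> place \<Rightarrow> (nat \<Rightarrow> qbar) set set"
  where "rat_completion k v = (\<lambda>s. null_sequences k v +>\<^bsub>cauchy_ring k v\<^esub> s) `
    {s \<in> carrier (cauchy_ring k v). range s \<subseteq> \<rat>}"

definition local_degree :: "qbar set \<Rightarrow> place \<Rightarrow> nat"
  where "local_degree k v =
    ring.dim (completion k v) (rat_completion k v) (carrier (completion k v))"


section \<open>The topology and the measure on the set of places\<close>

definition finite_galois_above :: "qbar set \<Rightarrow> qbar set set"
  where "finite_galois_above k = {l. number_field l \<and> galois_extension l \<rat> \<and> k \<subseteq> l}"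

text \<open>The inverse limit topology on \<open>Y(k,v)\<close>: a place \<open>y\<close> is identified with the compatible family
  of the places below it, and the finite sets of places of the fields \<open>l\<close> are discrete.\<close>

definition fibre_topology :: "qbar set \<Rightarrow> place \<Rightarrow> place topology"
  where "fibre_topology k v =
    pullback_topology (Y_fibre k v) (\<lambda>y. \<lambda>l\<in>finite_galois_above k. place_below l y)
      (product_topology (\<lambda>l. discrete_topology (places_above l k v)) (finite_galois_above k))"

text \<open>The disjoint union topology for \<open>k = \<rat>\<close>; the choice of \<open>k\<close> does not matter.\<close>

definition Y_topology :: "place topology"
  where "Y_topology = topology (\<lambda>V. V \<subseteq> \<Y> \<and>
    (\<forall>v\<in>places \<rat>. openin (fibre_topology \<rat> v) (V \<inter> Y_fibre \<rat> v)))"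

lemma openin_Y_topology:
  "openin Y_topology V \<longleftrightarrow> V \<subseteq> \<Y> \<and>
    (\<forall>v\<in>places \<rat>. openin (fibre_topology \<rat> v) (V \<inter> Y_fibre \<rat> v))"
proof -
  have "istopology (\<lambda>V. V \<subseteq> \<Y> \<and>
    (\<forall>v\<in>places \<rat>. openin (fibre_topology \<rat> v) (V \<inter> Y_fibre \<rat> v)))"
    unfolding istopology_def
  proof (intro conjI allI impI ballI)
    fix S T v
    assume "S \<subseteq> \<Y> \<and> (\<forall>v\<in>places \<rat>. openin (fibre_topology \<rat> v) (S \<inter> Y_fibre \<rat> v))"
      and "T \<subseteq> \<Y> \<and> (\<forall>v\<in>places \<rat>. openin (fibre_topology \<rat> v) (T \<inter> Y_fibre \<rat> v))"
      and "v \<in> places \<rat>"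
    then have "openin (fibre_topology \<rat> v) ((S \<inter> Y_fibre \<rat> v) \<inter> (T \<inter> Y_fibre \<rat> v))"
      by blast
    then show "openin (fibre_topology \<rat> v) (S \<inter> T \<inter> Y_fibre \<rat> v)"
      by (simp add: Int_ac)
  next
    fix \<K> v
    assume *: "\<forall>S\<in>\<K>. S \<subseteq> \<Y> \<and> (\<forall>v\<in>places \<rat>. openin (fibre_topology \<rat> v) (S \<inter> Y_fibre \<rat> v))"
      and v: "v \<in> places \<rat>"
    have "openin (fibre_topology \<rat> v) (\<Union>((\<lambda>S. S \<inter> Y_fibre \<rat> v) ` \<K>))"
      using * v by blast
    then show "openin (fibre_topology \<rat> v) (\<Union>\<K> \<inter> Y_fibre \<rat> v)"
      by (simp add: Int_commute Int_Union)
  qed blast+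
  then show ?thesis
    by (simp add: Y_topology_def)
qed

definition regular_borel :: "'a topology \<Rightarrow> 'a measure \<Rightarrow> bool"
  where "regular_borel T M \<longleftrightarrow>
    sets M = sets (sigma (topspace T) {V. openin T V}) \<and>
    (\<forall>C. compactin T C \<longrightarrow> emeasure M C < \<infinity>) \<and>
    (\<forall>E\<in>sets M. emeasure M E = (INF V\<in>{V. openin T V \<and> E \<subseteq> V}. emeasure M V)) \<and>
    (\<forall>E\<in>sets M. emeasure M E = (SUP C\<in>{C. compactin T C \<and> C \<subseteq> E}. emeasure M C))"

text \<open>The properties that determine the measure \<open>\<lambda>\<close> on \<open>\<Y>\<close>.\<close>

definition weil_measure :: "place measure \<Rightarrow> bool"
  where "weil_measure lam \<longleftrightarrow> regular_borel Y_topology lam \<and>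
    (\<forall>\<tau>\<in>abs_galois \<rat>. \<forall>A\<in>sets lam. emeasure lam (act \<tau> ` A) = emeasure lam A) \<and>
    (\<forall>k v. number_field k \<longrightarrow> v \<in> places k \<longrightarrow>
      emeasure lam (Y_fibre k v) = ennreal (real (local_degree k v) / real (global_degree k)))"


section \<open>Haar measure on absolute Galois groups\<close>

text \<open>The topology of the profinite group \<open>Aut(\<rat>-bar/K)\<close> is generated by the cosets of the
  subgroups \<open>Aut(\<rat>-bar/L)\<close> with \<open>L/K\<close> finite Galois.\<close>

definition krull_topology :: "qbar set \<Rightarrow> (qbar \<Rightarrow> qbar) topology"
  where "krull_topology K = topology_generated_by
    {(\<lambda>\<tau>. \<sigma> \<circ> \<tau>) ` abs_galois L | \<sigma> L. \<sigma> \<in> abs_galois K \<and>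
      galois_extension L K \<and> ring.finite_dimension qbar_ring K L}"

definition haar_probability :: "qbar set \<Rightarrow> (qbar \<Rightarrow> qbar) measure \<Rightarrow> bool"
  where "haar_probability K nu \<longleftrightarrow> regular_borel (krull_topology K) nu \<and>
    (\<forall>\<sigma>\<in>abs_galois K. \<forall>A\<in>sets nu. emeasure nu ((\<lambda>\<tau>. \<sigma> \<circ> \<tau>) ` A) = emeasure nu A) \<and>
    emeasure nu (abs_galois K) = 1"


section \<open>The spaces of functions\<close>

definition torsion_rel :: "(qbar \<times> qbar) set"
  where "torsion_rel = {(a, b). a \<noteq> 0 \<and> b \<noteq> 0 \<and> (\<exists>n>0. (a / b) ^ n = 1)}"

definition \<G> :: "qbar set set"
  where "\<G> = (UNIV - {0}) // torsion_rel"

text \<open>The function \<open>f\<^sub>\<alpha>\<close>.  All representatives of \<open>\<alpha>\<close> give the same value.  Functions on \<open>\<Y>\<close> are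
  extended by \<open>0\<close>, so that the pointwise operations on the function type are those of \<open>\<F>\<close>.\<close>

definition log_norm :: "qbar set \<Rightarrow> place \<Rightarrow> real"
  where "log_norm \<alpha> = (\<lambda>y. if y \<in> \<Y> then the_elem ((\<lambda>a. ln (norm_at y a)) ` \<alpha>) else 0)"

definition \<F> :: "(place \<Rightarrow> real) set"
  where "\<F> = log_norm ` \<G>"

definition rat_scale :: "rat \<Rightarrow> (place \<Rightarrow> real) \<Rightarrow> place \<Rightarrow> real"
  where "rat_scale r F = (\<lambda>y. of_rat r * F y)"

lemma vector_space_rat_scale: "vector_space rat_scale"
  by unfold_locales (auto simp: rat_scale_def fun_eq_iff algebra_simps of_rat_add of_rat_mult)

definition \<D> :: "qbar set \<Rightarrow> (place \<Rightarrow> real) set"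
  where "\<D> K = module.span rat_scale (log_norm ` ((\<lambda>a. torsion_rel `` {a}) ` (K - {0})))"

text \<open>Elements of \<open>L\<^sup>1\<close> are represented by integrable functions, and equality in \<open>L\<^sup>1\<close> is equality
  almost everywhere.  As \<open>\<lambda>\<close> is positive on nonempty open sets and the elements of \<open>\<F>\<close> are
  continuous, different elements of \<open>\<F>\<close> represent different elements of \<open>L\<^sup>1\<close>.\<close>

definition \<X> :: "place measure \<Rightarrow> (place \<Rightarrow> real) set"
  where "\<X> lam = {F. integrable lam F \<and> (LINT y|lam. F y) = 0}"

definition L1_closure :: "place measure \<Rightarrow> (place \<Rightarrow> real) set \<Rightarrow> (place \<Rightarrow> real) set"
  where "L1_closure lam S = {F \<in> \<X> lam. \<forall>e>0. \<exists>H\<in>S. (LINT y|lam. \<bar>F y - H y\<bar>) < e}"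

definition \<F>_closed :: "place measure \<Rightarrow> (place \<Rightarrow> real) set \<Rightarrow> bool"
  where "\<F>_closed lam S \<longleftrightarrow> S \<subseteq> \<F> \<and> S = \<F> \<inter> L1_closure lam S"

text \<open>The operators \<open>U\<^sub>K\<close> and \<open>S\<^sub>K\<close>, given by a Haar measure \<open>nu\<close> on \<open>Aut(\<rat>-bar/K)\<close>.\<close>

definition U_op :: "(qbar \<Rightarrow> qbar) measure \<Rightarrow> (place \<Rightarrow> real) \<Rightarrow> place \<Rightarrow> real"
  where "U_op nu F = (\<lambda>y. if y \<in> \<Y> then LINT \<tau>|nu. F (act (inv_into UNIV \<tau>) y) else 0)"

definition S_op :: "(qbar \<Rightarrow> qbar) measure \<Rightarrow> (place \<Rightarrow> real) \<Rightarrow> place \<Rightarrow> real"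
  where "S_op nu = restrict (U_op nu) \<F>"

definition \<E> :: "place measure \<Rightarrow> (qbar \<Rightarrow> qbar) measure \<Rightarrow> (place \<Rightarrow> real) set"
  where "\<E> lam nu = {F \<in> \<F>. AE y in lam. S_op nu F y = 0}"

end

theory Submission
  imports Defs "HOL-Real_Asymp.Real_Asymp"
begin

text \<open>On \<open>f\<^sub>\<alpha>\<close> the operator \<open>S\<^sub>K\<close> is the average of the finitely many \<open>f\<^sub>\<beta>\<close> with \<open>\<beta>\<close> conjugate to \<open>\<alpha>\<close>
  over \<open>K\<close>, and since \<open>\<lambda>\<close> is Galois invariant, all these have the same \<open>L\<^sup>1\<close>-norm; so \<open>S\<^sub>K\<close> is a
  contractive projection onto \<open>\<D>\<^sub>K\<close>.  If \<open>K\<^sub>1\<close> is Galois over \<open>K\<^sub>1 \<inter> K\<^sub>2\<close>, then \<open>Aut(\<rat>-bar/K\<^sub>2)\<close>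
  normalises \<open>Aut(\<rat>-bar/K\<^sub>1)\<close>, and the two projections commute.  The sum of the ranges of commuting
  projections \<open>Q\<^sub>1, \<dots>, Q\<^sub>N\<close> is the kernel of \<open>(1 - Q\<^sub>1) \<cdots> (1 - Q\<^sub>N)\<close>, which is \<open>L\<^sup>1\<close>-continuous, hence
  closed.  It remains to see that \<open>\<F>\<close> embeds into \<open>\<X>\<close>.  The product formula follows by averaging over
  conjugates from the case of rational \<open>\<alpha>\<close>, where it holds because all the fibres over places of \<open>\<rat>\<close>
  have measure \<open>1\<close>.  If \<open>f\<^sub>\<alpha>\<close> vanishes almost everywhere, then over each place of \<open>\<rat>\<close> there is a place at
  which all conjugates of \<open>\<alpha>\<close> have absolute value \<open>1\<close>, and this already forces \<open>f\<^sub>\<alpha> = 0\<close>.\<close>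

text \<open>Both kinds of summands are ranges of projections on \<F>: \<open>\<D> K\<close> of the
  average S over Aut(\<rat>-bar/K), and the kernel \<E> of S is the range of 1 - S. As S is a
  contraction, 1 - S has L1-norm at most 2, so every factor 1 - Q of the product has norm at most 3.
  Idempotence, linearity and commutation are exact identities of functions, because S replaces
  f\<alpha> by a finite average. Analysis enters only with the closure: if F is a limit of elements
  of the kernel of the product R, continuity shows that R F has L1-norm 0, that is, R F vanishes
  almost everywhere, while closedness asks for R F = 0. This is where injectivity of \<F>
  \<rightarrow> L1 is required; the product formula is required because the closure is taken inside
  \<X>. Injectivity is obtained algebraically from the mass 1 of the fibres over \<rat>: the powers
  of an element with conjugates of absolute value 1 at one place satisfy monic rational equations of
  bounded degree, with coefficients bounded over the whole fibre. Bounded powers mean absolute value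
  at most 1, and the inverse is treated alike.\<close>

hide_const (open) up_ring.coeff ring.coeff Polynomials.degree Polynomials.lead_coeff

section \<open>Subfields of the algebraic closure and polynomials over them\<close>

lemma qbar_ring_simps [simp]:
  "carrier qbar_ring = UNIV" "x \<otimes>\<^bsub>qbar_ring\<^esub> y = x * y" "\<one>\<^bsub>qbar_ring\<^esub> = 1"
  "\<zero>\<^bsub>qbar_ring\<^esub> = 0" "x \<oplus>\<^bsub>qbar_ring\<^esub> y = x + y"
  by (simp_all add: ring_of_type_algebra_def)

lemma field_qbar_ring: "Ring.field qbar_ring"
  by (rule field_from_type_algebra)

interpretation QB: domain qbar_ring
  using field_qbar_ring by (rule field.axioms(1))

lemma qbar_a_inv [simp]: "\<ominus>\<^bsub>qbar_ring\<^esub> x = - x"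
  using QB.minus_equality[of "- x" x] by simp

lemma qbar_m_inv [simp]: "x \<noteq> 0 \<Longrightarrow> inv\<^bsub>qbar_ring\<^esub> x = inverse x"
  by (rule QB.comm_inv_char) (simp_all)

lemma subring_qbar_iff:
  "subring A qbar_ring \<longleftrightarrow> 1 \<in> A \<and> (\<forall>x\<in>A. - x \<in> A) \<and> (\<forall>x\<in>A. \<forall>y\<in>A. x * y \<in> A \<and> x + y \<in> A)"
proof
  assume "subring A qbar_ring"
  from subringE[OF this] show "1 \<in> A \<and> (\<forall>x\<in>A. - x \<in> A) \<and> (\<forall>x\<in>A. \<forall>y\<in>A. x * y \<in> A \<and> x + y \<in> A)"
    by simp
next
  assume "1 \<in> A \<and> (\<forall>x\<in>A. - x \<in> A) \<and> (\<forall>x\<in>A. \<forall>y\<in>A. x * y \<in> A \<and> x + y \<in> A)"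
  then show "subring A qbar_ring"
    by (intro QB.subringI) auto
qed

lemma is_subfieldI:
  assumes "1 \<in> A" "\<And>x. x \<in> A \<Longrightarrow> - x \<in> A" "\<And>x. x \<in> A \<Longrightarrow> x \<noteq> 0 \<Longrightarrow> inverse x \<in> A"
    "\<And>x y. x \<in> A \<Longrightarrow> y \<in> A \<Longrightarrow> x * y \<in> A" "\<And>x y. x \<in> A \<Longrightarrow> y \<in> A \<Longrightarrow> x + y \<in> A"
  shows "is_subfield A"
  by (rule field.subfieldI'[OF field_qbar_ring]) (use assms in \<open>auto simp: subring_qbar_iff\<close>)

context
  fixes A assumes A: "is_subfield A"
begin

lemma subfield_subring: "subring A qbar_ring"
  using subfieldE(1)[OF A] .

lemma subfield_1: "1 \<in> A"
  and subfield_uminus: "x \<in> A \<Longrightarrow> - x \<in> A"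
  and subfield_mult: "x \<in> A \<Longrightarrow> y \<in> A \<Longrightarrow> x * y \<in> A"
  and subfield_add: "x \<in> A \<Longrightarrow> y \<in> A \<Longrightarrow> x + y \<in> A"
  using subfield_subring unfolding subring_qbar_iff by auto

lemma subfield_0: "0 \<in> A"
  using subfield_add[OF subfield_1 subfield_uminus[OF subfield_1]] by simp

lemma subfield_diff: "x \<in> A \<Longrightarrow> y \<in> A \<Longrightarrow> x - y \<in> A"
  using subfield_add[OF _ subfield_uminus, of x y] by simp

lemma subfield_inverse: "x \<in> A \<Longrightarrow> inverse x \<in> A"
  using QB.subfield_m_inv(1)[OF A, of x] by (cases "x = 0") auto

lemma subfield_divide: "x \<in> A \<Longrightarrow> y \<in> A \<Longrightarrow> x / y \<in> A"
  by (simp add: divide_inverse subfield_mult subfield_inverse)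

lemma subfield_power: "x \<in> A \<Longrightarrow> x ^ n \<in> A"
  by (induction n) (auto simp: subfield_mult subfield_1)

lemma subfield_sum: "(\<And>i. i \<in> I \<Longrightarrow> f i \<in> A) \<Longrightarrow> sum f I \<in> A"
  by (induction I rule: infinite_finite_induct) (auto simp: subfield_add subfield_0)

lemma subfield_prod: "(\<And>i. i \<in> I \<Longrightarrow> f i \<in> A) \<Longrightarrow> prod f I \<in> A"
  by (induction I rule: infinite_finite_induct) (auto simp: subfield_mult subfield_1)

lemma subfield_of_nat: "of_nat n \<in> A"
  by (induction n) (auto simp: subfield_add subfield_0 subfield_1)

lemma subfield_of_int: "of_int n \<in> A"
  by (cases n rule: int_cases2) (auto intro: subfield_uminus subfield_of_nat)

lemma subfield_of_rat: "of_rat r \<in> A"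
  by (cases r) (auto simp: of_rat_rat intro!: subfield_divide subfield_of_int)

lemma Rats_subset_subfield: "\<rat> \<subseteq> A"
  using subfield_of_rat by (auto elim!: Rats_cases)

end

lemma is_subfield_UNIV: "is_subfield UNIV"
  by (rule is_subfieldI) auto

lemma is_subfield_Rats: "is_subfield \<rat>"
  by (rule is_subfieldI) auto

definition polys :: "qbar set \<Rightarrow> qbar poly set"
  where "polys A = {p. \<forall>i. coeff p i \<in> A}"

lemma qbar_algebraic: "\<exists>p\<in>polys \<rat>. p \<noteq> 0 \<and> poly p x = 0"
proof -
  obtain p :: "rat poly" where p: "p \<noteq> 0" "poly (map_poly to_ac p) x = 0"
    using alg_closure_algebraic by blast
  have "to_ac r \<in> \<rat>" for r :: rat
    by (cases r) (simp add: Fract_of_int_quotient)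
  moreover have "map_poly to_ac p \<noteq> 0"
    using p(1) by (auto simp: poly_eq_iff coeff_map_poly)
  ultimately show ?thesis
    using p(2) by (intro bexI[of _ "map_poly to_ac p"]) (auto simp: polys_def coeff_map_poly)
qed

lemma polys_mono: "A \<subseteq> B \<Longrightarrow> polys A \<subseteq> polys B"
  by (auto simp: polys_def)

lemma pCons_in_polys: "pCons a p \<in> polys A \<longleftrightarrow> a \<in> A \<and> p \<in> polys A"
  unfolding polys_def
  by (auto simp: coeff_pCons split: nat.splits)

lemma abs_galois_iff:
  "\<tau> \<in> abs_galois K \<longleftrightarrow> bij \<tau> \<and> (\<forall>x y. \<tau> (x + y) = \<tau> x + \<tau> y \<and> \<tau> (x * y) = \<tau> x * \<tau> y) \<and> (\<forall>x\<in>K. \<tau> x = x)"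
  by (simp add: field_auts_def)


section \<open>Automorphisms of the algebraic closure\<close>

text \<open>A ring homomorphism from a subring to the algebraic closure is represented by its graph \<open>R\<close>; an
  element of \<open>pair_polys R\<close> is a polynomial over the subring together with its image.\<close>

definition emb_graph :: "qbar set \<Rightarrow> (qbar \<times> qbar) set \<Rightarrow> bool"
  where "emb_graph K R \<longleftrightarrow> Id_on K \<subseteq> R \<and> (\<forall>x y x' y'. (x, y) \<in> R \<longrightarrow> (x', y') \<in> R \<longrightarrow>
    (x + x', y + y') \<in> R \<and> (x * x', y * y') \<in> R) \<and> (\<forall>y. (0, y) \<in> R \<longrightarrow> y = 0)"

definition pair_polys :: "(qbar \<times> qbar) set \<Rightarrow> (qbar poly \<times> qbar poly) set"
  where "pair_polys R = {(f, g). \<forall>i. (coeff f i, coeff g i) \<in> R}"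

text \<open>Take a rational polynomial of least degree killing \<open>x\<close>. Its constant term
  is nonzero, since otherwise a factor X could be cancelled; solving for this term exhibits the
  inverse. Thus every ring between \<rat> and the algebraic closure is a field.\<close>

lemma inverse_eq_rational_poly:
  assumes x: "x \<noteq> 0"
  shows "\<exists>h\<in>polys \<rat>. x * poly h x = 1"
proof -
  obtain p where p: "p \<in> polys \<rat>" "p \<noteq> 0" "poly p x = 0" and
    min: "\<And>q. q \<in> polys \<rat> \<Longrightarrow> q \<noteq> 0 \<Longrightarrow> poly q x = 0 \<Longrightarrow> degree p \<le> degree q"
    using ex_has_least_nat[of "\<lambda>p. p \<in> polys \<rat> \<and> p \<noteq> 0 \<and> poly p x = 0" _ degree] qbar_algebraic[of x]
    by blast
  obtain c q where pc: "p = pCons c q"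
    by (cases p)
  have c: "c \<in> \<rat>" and q: "q \<in> polys \<rat>"
    using p(1) by (simp_all add: pc pCons_in_polys)
  have "c \<noteq> 0"
  proof
    assume "c = 0"
    then have "q \<noteq> 0" "poly q x = 0"
      using p(2,3) x by (auto simp: pc)
    with min[OF q] show False
      by (simp add: pc)
  qed
  have "Polynomial.smult (- inverse c) q \<in> polys \<rat>"
    using c q by (auto simp: polys_def)
  moreover have "x * poly (Polynomial.smult (- inverse c) q) x = 1"
    using p(3) \<open>c \<noteq> 0\<close> by (simp add: pc field_simps add_eq_0_iff)
  ultimately show ?thesis by blast
qed

context
  fixes K R
  assumes K: "is_subfield K" and R: "emb_graph K R"
begin

lemma emb_graph_add: "(x, y) \<in> R \<Longrightarrow> (x', y') \<in> R \<Longrightarrow> (x + x', y + y') \<in> R"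
  and emb_graph_mult: "(x, y) \<in> R \<Longrightarrow> (x', y') \<in> R \<Longrightarrow> (x * x', y * y') \<in> R"
  and emb_graph_zero: "(0, y) \<in> R \<Longrightarrow> y = 0"
  and emb_graph_base: "x \<in> K \<Longrightarrow> (x, x) \<in> R"
  using R by (auto simp: emb_graph_def)

lemma emb_graph_uminus: "(x, y) \<in> R \<Longrightarrow> (- x, - y) \<in> R"
  using emb_graph_mult[OF emb_graph_base[of "-1"], of x y] subfield_uminus[OF K subfield_1[OF K]] by simp

lemma emb_graph_diff: "(x, y) \<in> R \<Longrightarrow> (x', y') \<in> R \<Longrightarrow> (x - x', y - y') \<in> R"
  using emb_graph_add[OF _ emb_graph_uminus, of x y x' y'] by simp

lemma emb_graph_00: "(0, 0) \<in> R"
  by (rule emb_graph_base) (rule subfield_0[OF K])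

lemma emb_graph_sum: "(\<And>i. i \<in> I \<Longrightarrow> (f i, g i) \<in> R) \<Longrightarrow> (sum f I, sum g I) \<in> R"
  by (induction I rule: infinite_finite_induct) (auto intro: emb_graph_add emb_graph_00)

lemma emb_graph_poly_base:
  assumes "p \<in> polys K" "(x, y) \<in> R"
  shows "(poly p x, poly p y) \<in> R"
  using assms by (induction p) (auto simp: pCons_in_polys intro: emb_graph_00 emb_graph_add emb_graph_mult emb_graph_base)

text \<open>The inverse of \<open>x\<close> is h(x) for a polynomial h over \<open>K\<close>, so the
  relation x h(x) = 1 is carried to y h(y) = 1. Hence the homomorphism with graph \<open>R\<close>
  is injective and its domain is a field, although only sums and products are demanded of
  \<open>emb_graph\<close>.\<close>

lemma emb_graph_inverse:
  assumes xy: "(x, y) \<in> R" and x: "x \<noteq> 0"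
  shows "y \<noteq> 0" "(inverse x, inverse y) \<in> R"
proof -
  obtain h where h: "h \<in> polys K" "x * poly h x = 1"
    using inverse_eq_rational_poly[OF x] polys_mono[OF Rats_subset_subfield[OF K]] by blast
  have hR: "(poly h x, poly h y) \<in> R"
    by (rule emb_graph_poly_base) fact+
  from emb_graph_mult[OF xy this] h have "(1, y * poly h y) \<in> R"
    by simp
  from emb_graph_diff[OF this emb_graph_base[OF subfield_1[OF K]]]
  have "y * poly h y = 1"
    using emb_graph_zero by fastforce
  then show "y \<noteq> 0" "(inverse x, inverse y) \<in> R"
    using hR h(2) by (auto simp: inverse_unique)
qed

lemma emb_graph_zero': "(x, 0) \<in> R \<Longrightarrow> x = 0"
  using emb_graph_inverse by blast

lemma emb_graph_zero_iff: "(x, y) \<in> R \<Longrightarrow> x = 0 \<longleftrightarrow> y = 0"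
  using emb_graph_zero emb_graph_zero' by blast

lemma emb_graph_unique: "(x, y) \<in> R \<Longrightarrow> (x, y') \<in> R \<Longrightarrow> y = y'"
  using emb_graph_diff emb_graph_zero by fastforce

lemma pair_polys_add: "(f, g) \<in> pair_polys R \<Longrightarrow> (f', g') \<in> pair_polys R \<Longrightarrow> (f + f', g + g') \<in> pair_polys R"
  by (auto simp: pair_polys_def intro: emb_graph_add)

lemma pair_polys_diff: "(f, g) \<in> pair_polys R \<Longrightarrow> (f', g') \<in> pair_polys R \<Longrightarrow> (f - f', g - g') \<in> pair_polys R"
  by (auto simp: pair_polys_def intro: emb_graph_diff)

lemma pair_polys_mult: "(f, g) \<in> pair_polys R \<Longrightarrow> (f', g') \<in> pair_polys R \<Longrightarrow> (f * f', g * g') \<in> pair_polys R"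
  by (auto simp: pair_polys_def coeff_mult intro: emb_graph_mult emb_graph_sum)

lemma pair_polys_pCons: "(a, b) \<in> R \<Longrightarrow> (f, g) \<in> pair_polys R \<Longrightarrow> (pCons a f, pCons b g) \<in> pair_polys R"
  by (auto simp: pair_polys_def coeff_pCons split: nat.splits)

lemma pair_polys_0: "(0, 0) \<in> pair_polys R"
  by (auto simp: pair_polys_def emb_graph_00)

lemma pair_polys_degree:
  assumes "(f, g) \<in> pair_polys R"
  shows "degree f = degree g"
proof -
  have "coeff f i = 0 \<longleftrightarrow> coeff g i = 0" for i
    using assms emb_graph_zero_iff by (auto simp: pair_polys_def)
  then show ?thesis
    by (simp add: degree_def)
qed

text \<open>The extension sends f(a) to g(b), where g is the image of f. It is well defined because
  \<open>p\<close> has least degree among the polynomials killing \<open>a\<close>: if f(a) = 0,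
  long division by \<open>p\<close> leaves no remainder, and the same division on the images by
  \<open>q\<close> gives g(b) = 0.\<close>

lemma emb_graph_extend:
  assumes pq: "(p, q) \<in> pair_polys R" "p \<noteq> 0"
    and min: "\<And>f g. (f, g) \<in> pair_polys R \<Longrightarrow> f \<noteq> 0 \<Longrightarrow> poly f a = 0 \<Longrightarrow> degree p \<le> degree f"
    and pa: "poly p a = 0" and qb: "poly q b = 0"
  shows "\<exists>R'. emb_graph K R' \<and> R \<subseteq> R' \<and> (a, b) \<in> R'"
proof -
  define R' where "R' = {(poly f a, poly g b) | f g. (f, g) \<in> pair_polys R}"
  have zero: "poly g b = 0" if "(f, g) \<in> pair_polys R" "poly f a = 0" for f g
    using that
  proof (induction "degree f" arbitrary: f g rule: less_induct)
    case less
    show ?case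
    proof (cases "f = 0")
      case True
      then have "g = 0"
        using less.prems(1) emb_graph_zero by (auto simp: pair_polys_def poly_eq_iff)
      then show ?thesis by simp
    next
      case f0: False
      then have deg: "degree p \<le> degree f"
        using min less.prems by blast
      define n m where "n = degree f" and "m = degree p"
      define c d where "c = coeff f n" and "d = coeff p m"
      define c' d' where "c' = coeff g n" and "d' = coeff q m"
      have cR: "(c, c') \<in> R" and dR: "(d, d') \<in> R"
        using less.prems(1) pq(1) by (auto simp: c_def c'_def d_def d'_def pair_polys_def)
      have d0: "d \<noteq> 0" using pq(2) by (simp add: d_def m_def)
      then have d'0: "d' \<noteq> 0"
        using emb_graph_zero_iff[OF dR] by simp
      define e e' where "e = c * inverse d" and "e' = c' * inverse d'"
      have eR: "(e, e') \<in> R"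
        using emb_graph_mult[OF cR emb_graph_inverse(2)[OF dR d0]] by (simp add: e_def e'_def)
      have mon: "(Polynomial.monom e (n - m), Polynomial.monom e' (n - m)) \<in> pair_polys R"
        using eR emb_graph_00 by (auto simp: pair_polys_def)
      \<comment> \<open>One step of long division, carried out on \<open>f\<close> and on its image
        alike: the leading term of \<open>f\<close> cancels, and the values at \<open>a\<close> and
        \<open>b\<close> do not change because \<open>p\<close> and \<open>q\<close> vanish
        there.\<close>
      define f1 g1 where "f1 = f - Polynomial.monom e (n - m) * p"
        and "g1 = g - Polynomial.monom e' (n - m) * q"
      have fg1: "(f1, g1) \<in> pair_polys R"
        unfolding f1_def g1_def by (intro pair_polys_diff pair_polys_mult mon pq less.prems)
      have f1a: "poly f1 a = 0"
        using pa less.prems by (simp add: f1_def)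
      have "poly g1 b = 0"
      proof (cases "f1 = 0")
        case True
        then have "g1 = 0"
          using fg1 emb_graph_zero by (auto simp: pair_polys_def poly_eq_iff)
        then show ?thesis by simp
      next
        case False
        have "coeff f1 n = 0"
          using deg d0 by (simp add: f1_def coeff_monom_mult n_def[symmetric] m_def[symmetric] c_def[symmetric] d_def[symmetric] e_def)
        moreover have "degree f1 \<le> n"
          unfolding f1_def
          by (rule degree_diff_le) (use deg in \<open>auto simp: n_def m_def intro!: order.trans[OF degree_mult_le] order.trans[OF add_right_mono[OF degree_monom_le]]\<close>)
        ultimately have "degree f1 < n"
          using False by (metis leading_coeff_0_iff le_neq_implies_less)
        then show ?thesis
          using less.hyps fg1 f1a by (simp add: n_def)
      qed
      then show ?thesis
        using qb by (simp add: g1_def)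
    qed
  qed
  have "emb_graph K R'"
    unfolding emb_graph_def
  proof (intro conjI allI impI)
    show "Id_on K \<subseteq> R'"
    proof
      fix z assume "z \<in> Id_on K"
      then obtain x where "z = (x, x)" "x \<in> K" by auto
      moreover then have "([:x:], [:x:]) \<in> pair_polys R"
        by (intro pair_polys_pCons pair_polys_0 emb_graph_base)
      ultimately show "z \<in> R'" by (force simp: R'_def)
    qed
  next
    fix x y x' y'
    assume "(x, y) \<in> R'" "(x', y') \<in> R'"
    then obtain f g f' g' where *: "(f, g) \<in> pair_polys R" "(f', g') \<in> pair_polys R"
      and "x = poly f a" "y = poly g b" "x' = poly f' a" "y' = poly g' b"
      unfolding R'_def by blast
    then show "(x + x', y + y') \<in> R'" "(x * x', y * y') \<in> R'"
      using pair_polys_add[OF *] pair_polys_mult[OF *]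
      unfolding R'_def by (force simp flip: poly_add poly_mult)+
  next
    fix y assume "(0, y) \<in> R'"
    then show "y = 0" using zero unfolding R'_def by auto
  qed
  moreover have "R \<subseteq> R'"
  proof
    fix z assume "z \<in> R"
    moreover obtain x y where z: "z = (x, y)" by (cases z)
    ultimately have "([:x:], [:y:]) \<in> pair_polys R"
      by (intro pair_polys_pCons pair_polys_0) simp
    then show "z \<in> R'" by (force simp: R'_def z)
  qed
  moreover have "([:0, 1:], [:0, 1:]) \<in> pair_polys R"
    by (intro pair_polys_pCons pair_polys_0 emb_graph_base subfield_0[OF K] subfield_1[OF K])
  then have "(a, b) \<in> R'" by (force simp: R'_def)
  ultimately show ?thesis by blast
qed

lemma pair_polys_minimal:
  obtains p q where "(p, q) \<in> pair_polys R" "p \<noteq> 0" "poly p a = 0"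
    "\<And>f g. (f, g) \<in> pair_polys R \<Longrightarrow> f \<noteq> 0 \<Longrightarrow> poly f a = 0 \<Longrightarrow> degree p \<le> degree f"
proof -
  obtain r where r: "r \<in> polys \<rat>" "r \<noteq> 0" "poly r a = 0"
    using qbar_algebraic by blast
  then have "(r, r) \<in> pair_polys R"
    using emb_graph_base Rats_subset_subfield[OF K] by (auto simp: pair_polys_def polys_def)
  then have "\<exists>z. (\<lambda>(p, q). (p, q) \<in> pair_polys R \<and> p \<noteq> 0 \<and> poly p a = 0) z"
    using r by blast
  then obtain z0 where "(\<lambda>(p, q). (p, q) \<in> pair_polys R \<and> p \<noteq> 0 \<and> poly p a = 0) z0" ..
  from ex_has_least_nat[of "\<lambda>(p, q). (p, q) \<in> pair_polys R \<and> p \<noteq> 0 \<and> poly p a = 0", OF this, of "\<lambda>(p, q). degree p"]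
  obtain z where "(\<lambda>(p, q). (p, q) \<in> pair_polys R \<and> p \<noteq> 0 \<and> poly p a = 0) z"
    "\<And>w. (\<lambda>(p, q). (p, q) \<in> pair_polys R \<and> p \<noteq> 0 \<and> poly p a = 0) w \<Longrightarrow>
       (\<lambda>(p, q). degree p) z \<le> (\<lambda>(p, q). degree p) w"
    by blast
  then show thesis
    by (cases z) (auto intro!: that)
qed

lemma emb_graph_extend_any: "\<exists>R' b. emb_graph K R' \<and> R \<subseteq> R' \<and> (a, b) \<in> R'"
proof -
  obtain p q where pq: "(p, q) \<in> pair_polys R" "p \<noteq> 0" "poly p a = 0"
    "\<And>f g. (f, g) \<in> pair_polys R \<Longrightarrow> f \<noteq> 0 \<Longrightarrow> poly f a = 0 \<Longrightarrow> degree p \<le> degree f"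
    using pair_polys_minimal[of a] by blast
  have "degree p > 0"
    using pq(2,3) by (intro gr0I) (auto elim: degree_eq_zeroE)
  then have "degree q > 0"
    using pair_polys_degree[OF pq(1)] by simp
  then obtain b where "poly q b = 0"
    using alg_closed_imp_poly_has_root by blast
  with emb_graph_extend[OF pq(1,2), of a b] pq(3,4) show ?thesis by blast
qed

end


text \<open>Zorn's lemma gives a maximal graph, which is defined everywhere because it could
  otherwise be extended by one more element. It is onto because an injective homomorphism fixing
  \<rat> permutes the finite root set of each rational polynomial.\<close>

lemma emb_graph_total:
  assumes K: "is_subfield K" and R: "emb_graph K R"
  shows "\<exists>\<tau>\<in>abs_galois K. \<forall>(x, y)\<in>R. \<tau> x = y"
proof -
  define \<A> where "\<A> = {R'. emb_graph K R' \<and> R \<subseteq> R'}"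
  have "\<exists>M\<in>\<A>. \<forall>S\<in>\<A>. M \<subseteq> S \<longrightarrow> S = M"
  proof (rule subset_Zorn_nonempty)
    show "\<A> \<noteq> {}" using R by (auto simp: \<A>_def)
  next
    fix C assume C: "C \<noteq> {}" "subset.chain \<A> C"
    have emb: "emb_graph K S" "R \<subseteq> S" if "S \<in> C" for S
      using that C(2) by (auto simp: subset_chain_def \<A>_def)
    have common: "\<exists>S\<in>C. z \<in> S \<and> z' \<in> S" if "z \<in> \<Union>C" "z' \<in> \<Union>C" for z z'
    proof -
      from that obtain S S' where "S \<in> C" "z \<in> S" "S' \<in> C" "z' \<in> S'" by blast
      moreover then have "S \<subseteq> S' \<or> S' \<subseteq> S"
        using C(2) by (auto simp: subset_chain_def)
      ultimately show ?thesis by blast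
    qed
    have "emb_graph K (\<Union>C)"
      unfolding emb_graph_def
    proof (intro conjI allI impI)
      obtain S where "S \<in> C" using C(1) by blast
      moreover from emb(1)[OF this] have "Id_on K \<subseteq> S" by (simp add: emb_graph_def)
      ultimately show "Id_on K \<subseteq> \<Union>C" by blast
    next
      fix x y x' y' assume *: "(x, y) \<in> \<Union>C" "(x', y') \<in> \<Union>C"
      obtain S where "S \<in> C" "(x, y) \<in> S" "(x', y') \<in> S" using common[OF *] by blast
      then show "(x + x', y + y') \<in> \<Union>C" "(x * x', y * y') \<in> \<Union>C"
        using emb_graph_add[OF K emb(1)] emb_graph_mult[OF K emb(1)] by blast+
    next
      fix y assume "(0, y) \<in> \<Union>C"
      then show "y = 0"
        using emb_graph_zero[OF K emb(1)] by blast
    qed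
    then show "\<Union>C \<in> \<A>"
      using C(1) emb(2) by (auto simp: \<A>_def)
  qed
  then obtain M where "M \<in> \<A>" and max0: "\<forall>S\<in>\<A>. M \<subseteq> S \<longrightarrow> S = M" ..
  then have M: "emb_graph K M" "R \<subseteq> M"
    by (simp_all add: \<A>_def)
  have max: "S = M" if "emb_graph K S" "M \<subseteq> S" for S
    using max0 that order.trans[OF M(2) that(2)] by (simp add: \<A>_def)
  have total: "\<exists>b. (a, b) \<in> M" for a
    using emb_graph_extend_any[OF K M(1), of a] max by blast
  define \<tau> where "\<tau> a = (THE b. (a, b) \<in> M)" for a
  have \<tau>: "(a, b) \<in> M \<longleftrightarrow> \<tau> a = b" for a b
    unfolding \<tau>_def using total[of a] emb_graph_unique[OF K M(1)] by (metis the_equality)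
  have add: "\<tau> (x + y) = \<tau> x + \<tau> y" and mult: "\<tau> (x * y) = \<tau> x * \<tau> y" for x y
    using emb_graph_add[OF K M(1)] emb_graph_mult[OF K M(1)] \<tau> by blast+
  have fixK: "\<tau> x = x" if "x \<in> K" for x
    using emb_graph_base[OF K M(1) that] \<tau> by simp
  have inj: "inj \<tau>"
  proof (rule injI)
    fix x y assume "\<tau> x = \<tau> y"
    then have "(x - y, 0) \<in> M"
      using emb_graph_diff[OF K M(1), of x "\<tau> x" y "\<tau> y"] \<tau> by simp
    then show "x = y"
      using emb_graph_zero'[OF K M(1), of "x - y"] by simp
  qed
  have "surj \<tau>"
  proof -
    have "\<exists>x. \<tau> x = y" for y
    proof -
      obtain p where p: "p \<in> polys \<rat>" "p \<noteq> 0" "poly p y = 0" using qbar_algebraic by blast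
      have "\<tau> ` {x. poly p x = 0} = {x. poly p x = 0}"
      proof (rule endo_inj_surj)
        show "finite {x. poly p x = 0}" using p(2) by (rule poly_roots_finite)
        show "\<tau> ` {x. poly p x = 0} \<subseteq> {x. poly p x = 0}"
        proof safe
          fix x assume "poly p x = 0"
          then have "(0, poly p (\<tau> x)) \<in> M"
            using emb_graph_poly_base[OF K M(1), of p x "\<tau> x"] p(1) polys_mono[OF Rats_subset_subfield[OF K]] \<tau>
            by auto
          then show "poly p (\<tau> x) = 0" using emb_graph_zero[OF K M(1)] by blast
        qed
        show "inj_on \<tau> {x. poly p x = 0}" using inj by (rule inj_on_subset) simp
      qed
      moreover have "y \<in> {x. poly p x = 0}" using p(3) by simp
      ultimately have "y \<in> \<tau> ` {x. poly p x = 0}" by simp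
      then show ?thesis by blast
    qed
    then show ?thesis by (metis surjI)
  qed
  then have "\<tau> \<in> abs_galois K"
    using add mult fixK inj by (simp add: abs_galois_iff bij_def)
  then show ?thesis
    using M(2) \<tau> by (intro bexI[of _ \<tau>]) auto
qed

text \<open>A polynomial of least degree over \<open>K\<close> killing \<open>x\<close> is not
  linear, so it has another root \<open>b\<close>, and x \<mapsto> b extends to an automorphism over
  \<open>K\<close>.\<close>

lemma abs_galois_moves:
  assumes K: "is_subfield K" and x: "x \<notin> K"
  shows "\<exists>\<tau>\<in>abs_galois K. \<tau> x \<noteq> x"
proof -
  have R: "emb_graph K (Id_on K)"
    using subfield_add[OF K] subfield_mult[OF K] by (auto simp: emb_graph_def)
  obtain p q where pq: "(p, q) \<in> pair_polys (Id_on K)" "p \<noteq> 0" "poly p x = 0"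
    "\<And>f g. (f, g) \<in> pair_polys (Id_on K) \<Longrightarrow> f \<noteq> 0 \<Longrightarrow> poly f x = 0 \<Longrightarrow> degree p \<le> degree f"
    using pair_polys_minimal[OF K R, of x] by blast
  have qp: "q = p" and pK: "\<And>i. coeff p i \<in> K"
    using pq(1) by (auto simp: pair_polys_def poly_eq_iff)
  obtain s where s: "p = [:- x, 1:] * s"
    using pq(3) by (auto simp: poly_eq_0_iff_dvd elim: dvdE)
  have s0: "s \<noteq> 0" using pq(2) s by auto
  have "degree s \<noteq> 0"
  proof
    assume "degree s = 0"
    then obtain c where c: "s = [:c:]" by (auto elim: degree_eq_zeroE)
    have "coeff p 0 = - (c * x)" "coeff p 1 = c"
      by (simp_all add: s c)
    then have "c * x \<in> K" "c \<in> K"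
      using pK[of 0] pK[of 1] subfield_uminus[OF K, of "- (c * x)"] by auto
    moreover have "c \<noteq> 0" using s0 c by simp
    ultimately have "x \<in> K"
      using subfield_divide[OF K, of "c * x" c] by simp
    with x show False ..
  qed
  then obtain b where b: "poly s b = 0"
    using alg_closed_imp_poly_has_root by blast
  \<comment> \<open>Separability in characteristic 0: at a double root the derivative vanishes too,
    and it is nonzero of smaller degree, against the minimality of \<open>p\<close>.\<close>
  have "b \<noteq> x"
  proof
    assume "b = x"
    then have "poly (pderiv p) x = 0"
      using b unfolding s pderiv_mult by (simp add: pderiv_pCons)
    moreover have "(pderiv p, pderiv p) \<in> pair_polys (Id_on K)"
      using pK by (auto simp: pair_polys_def coeff_pderiv intro: subfield_mult[OF K] subfield_add[OF K] subfield_1[OF K] subfield_of_nat[OF K])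
    moreover have "degree p \<noteq> 0"
      unfolding s using s0 by (subst degree_mult_eq) auto
    then have "pderiv p \<noteq> 0" "degree (pderiv p) < degree p"
      by (auto simp: pderiv_eq_0_iff degree_pderiv)
    ultimately show False using pq(4) by fastforce
  qed
  have "poly q b = 0" by (simp add: qp s b)
  then obtain R' where "emb_graph K R'" "(x, b) \<in> R'"
    using emb_graph_extend[OF K R pq(1,2), of x b] pq(3,4) by blast
  then show ?thesis
    using emb_graph_total[OF K, of R'] \<open>b \<noteq> x\<close> by fastforce
qed

lemma abs_galois_fixed_field:
  assumes "is_subfield K" "\<And>\<tau>. \<tau> \<in> abs_galois K \<Longrightarrow> \<tau> x = x"
  shows "x \<in> K"
  using abs_galois_moves assms by blast


section \<open>Orbits\<close>

text \<open>Two fields, because normality of a Galois extension L/k is derived from Aut(L/k) itself,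
  whereas the averages are taken over automorphisms of the whole algebraic closure.\<close>

definition orbit_in :: "qbar set \<Rightarrow> qbar set \<Rightarrow> qbar \<Rightarrow> qbar set"
  where "orbit_in L K a = (\<lambda>\<sigma>. \<sigma> a) ` field_auts L K"

abbreviation orb :: "qbar set \<Rightarrow> qbar \<Rightarrow> qbar set"
  where "orb \<equiv> orbit_in UNIV"

text \<open>For \<open>B\<close> the orbit of an element under the absolute Galois group of
  \<open>K\<close>, this is its minimal polynomial over \<open>K\<close>.\<close>

definition root_poly :: "qbar set \<Rightarrow> qbar poly"
  where "root_poly B = (\<Prod>b\<in>B. [:- b, 1:])"

lemma id_field_auts: "restrict id L \<in> field_auts L K" if "K \<subseteq> L" "is_subfield L"
  using that by (auto simp: field_auts_def bij_betw_def inj_on_def subfield_add subfield_mult)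

context
  fixes L K
  assumes L: "is_subfield L" and K: "is_subfield K" and KL: "K \<subseteq> L"
begin

context
  fixes \<sigma> assumes \<sigma>: "\<sigma> \<in> field_auts L K"
begin

lemma field_auts_add: "x \<in> L \<Longrightarrow> y \<in> L \<Longrightarrow> \<sigma> (x + y) = \<sigma> x + \<sigma> y"
  and field_auts_mult: "x \<in> L \<Longrightarrow> y \<in> L \<Longrightarrow> \<sigma> (x * y) = \<sigma> x * \<sigma> y"
  and field_auts_fix: "x \<in> K \<Longrightarrow> \<sigma> x = x"
  and field_auts_bij: "bij_betw \<sigma> L L"
  using \<sigma> by (auto simp: field_auts_def)

lemma field_auts_mem: "x \<in> L \<Longrightarrow> \<sigma> x \<in> L"
  using field_auts_bij by (auto simp: bij_betw_def)

lemma field_auts_0: "\<sigma> 0 = 0"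
  by (rule field_auts_fix) (rule subfield_0[OF K])

lemma field_auts_uminus: "x \<in> L \<Longrightarrow> \<sigma> (- x) = - \<sigma> x"
  using field_auts_add[of x "- x"] subfield_uminus[OF L, of x] field_auts_0 by (simp add: add_eq_0_iff2)

lemma field_auts_diff: "x \<in> L \<Longrightarrow> y \<in> L \<Longrightarrow> \<sigma> (x - y) = \<sigma> x - \<sigma> y"
  using field_auts_add[of x "- y"] subfield_uminus[OF L, of y] field_auts_uminus by simp

lemma field_auts_poly:
  assumes "p \<in> polys K" "x \<in> L"
  shows "\<sigma> (poly p x) = poly p (\<sigma> x)"
proof -
  have "poly p x \<in> L \<and> \<sigma> (poly p x) = poly p (\<sigma> x)"
    using assms(1)
  proof (induction p)
    case 0
    then show ?case by (simp add: field_auts_0 subfield_0[OF L])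
  next
    case (pCons a p)
    then show ?case
      using KL assms(2) by (auto simp: pCons_in_polys field_auts_add field_auts_mult field_auts_fix
        subfield_add[OF L] subfield_mult[OF L] subset_iff)
  qed
  then show ?thesis ..
qed

text \<open>Membership of the coefficients in \<open>L\<close> is carried through the induction,
  since \<sigma> is known to be additive and multiplicative on \<open>L\<close> only.\<close>

lemma root_poly_map:
  assumes "finite B" "B \<subseteq> L"
  shows "coeff (\<Prod>b\<in>B. [:- b, 1:]) i \<in> L \<and>
    \<sigma> (coeff (\<Prod>b\<in>B. [:- b, 1:]) i) = coeff (\<Prod>b\<in>B. [:- \<sigma> b, 1:]) i"
  using assms
proof (induction B arbitrary: i rule: finite_induct)
  case empty
  then show ?case
    using KL by (auto simp: subfield_0[OF L] subfield_1[OF L] field_auts_0 field_auts_fix subfield_1[OF K] coeff_pCons split: nat.splits)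
next
  case (insert b B)
  have c: "coeff ([:- c, 1:] * q) i = (if i = 0 then 0 else coeff q (i - 1)) - c * coeff q i"
    for c and q :: "qbar poly" and i
    by (simp add: coeff_pCons split: nat.splits)
  have IH: "coeff (\<Prod>b\<in>B. [:- b, 1:]) j \<in> L"
    "\<sigma> (coeff (\<Prod>b\<in>B. [:- b, 1:]) j) = coeff (\<Prod>b\<in>B. [:- \<sigma> b, 1:]) j" for j
    using insert.IH insert.prems by auto
  have bL: "b \<in> L" using insert.prems by simp
  show ?case
    unfolding prod.insert[OF insert.hyps] c
    using IH bL
    by (simp add: field_auts_diff field_auts_uminus field_auts_mult field_auts_0 subfield_diff[OF L] subfield_mult[OF L]
      subfield_0[OF L] subfield_uminus[OF L])
qed

end

lemma field_auts_comp:
  assumes \<sigma>: "\<sigma> \<in> field_auts L K" and \<tau>: "\<tau> \<in> field_auts L K"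
  shows "compose L \<sigma> \<tau> \<in> field_auts L K"
proof -
  have "bij_betw (compose L \<sigma> \<tau>) L L"
    using field_auts_bij[OF \<sigma>] field_auts_bij[OF \<tau>] by (rule bij_betw_compose[rotated])
  then show ?thesis
    using \<sigma> \<tau> KL subfield_add[OF L] subfield_mult[OF L] field_auts_mem[OF \<tau>]
    by (auto simp: field_auts_def compose_def subset_iff)
qed

lemma finite_orbit_in:
  assumes "a \<in> L"
  shows "finite (orbit_in L K a)"
proof -
  obtain p where p: "p \<in> polys K" "p \<noteq> 0" "poly p a = 0"
    using qbar_algebraic polys_mono[OF Rats_subset_subfield[OF K]] by blast
  have "orbit_in L K a \<subseteq> {x. poly p x = 0}"
    using field_auts_poly[OF _ p(1) assms] p(3) by (fastforce simp: orbit_in_def field_auts_0)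
  then show ?thesis
    using poly_roots_finite[OF p(2)] finite_subset by blast
qed

lemma orbit_in_subset: "a \<in> L \<Longrightarrow> orbit_in L K a \<subseteq> L"
  by (auto simp: orbit_in_def field_auts_mem)

lemma mem_orbit_in: "a \<in> L \<Longrightarrow> a \<in> orbit_in L K a"
  unfolding orbit_in_def using id_field_auts[OF KL L] by (intro image_eqI[of _ _ "restrict id L"]) auto

lemma image_orbit_in:
  assumes a: "a \<in> L" and \<sigma>: "\<sigma> \<in> field_auts L K"
  shows "\<sigma> ` orbit_in L K a = orbit_in L K a"
proof (rule endo_inj_surj)
  show "finite (orbit_in L K a)" using a by (rule finite_orbit_in)
  show "\<sigma> ` orbit_in L K a \<subseteq> orbit_in L K a"
    unfolding orbit_in_def using field_auts_comp[OF \<sigma>] a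
    by (auto simp: image_iff compose_def) (metis (mono_tags, lifting) compose_def restrict_apply')
  show "inj_on \<sigma> (orbit_in L K a)"
    using field_auts_bij[OF \<sigma>] orbit_in_subset[OF a] by (auto simp: bij_betw_def inj_on_subset)
qed

text \<open>\<sigma> merely permutes the linear factors of the polynomial.\<close>

lemma root_poly_orbit_fixed:
  assumes a: "a \<in> L" and \<sigma>: "\<sigma> \<in> field_auts L K"
  shows "\<sigma> (coeff (root_poly (orbit_in L K a)) i) = coeff (root_poly (orbit_in L K a)) i"
    and "coeff (root_poly (orbit_in L K a)) i \<in> L"
proof -
  let ?B = "orbit_in L K a"
  have inj: "inj_on \<sigma> ?B"
    using field_auts_bij[OF \<sigma>] orbit_in_subset[OF a] by (auto simp: bij_betw_def inj_on_subset)
  have "root_poly ?B = (\<Prod>b\<in>?B. [:- \<sigma> b, 1:])"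
    unfolding root_poly_def by (subst image_orbit_in[OF a \<sigma>, symmetric]) (simp add: prod.reindex[OF inj])
  then show "\<sigma> (coeff (root_poly ?B) i) = coeff (root_poly ?B) i"
    "coeff (root_poly ?B) i \<in> L"
    using root_poly_map[OF \<sigma> finite_orbit_in[OF a] orbit_in_subset[OF a], of i]
    by (auto simp: root_poly_def)
qed

end

section \<open>The absolute Galois group\<close>

lemma abs_galois_mono: "K \<subseteq> L \<Longrightarrow> abs_galois L \<subseteq> abs_galois K"
  by (auto simp: field_auts_def)

context
  fixes K and \<tau> assumes \<tau>: "\<tau> \<in> abs_galois K"
begin

lemma abs_galois_bij: "bij \<tau>"
  and abs_galois_add: "\<tau> (x + y) = \<tau> x + \<tau> y"
  and abs_galois_mult: "\<tau> (x * y) = \<tau> x * \<tau> y"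
  and abs_galois_fix: "x \<in> K \<Longrightarrow> \<tau> x = x"
  using \<tau> by (auto simp: abs_galois_iff)

lemma abs_galois_inj: "\<tau> x = \<tau> y \<longleftrightarrow> x = y"
  using abs_galois_bij by (auto simp: bij_def inj_def)

lemma abs_galois_0: "\<tau> 0 = 0"
  using abs_galois_add[of 0 0] by simp

lemma abs_galois_eq_0_iff: "\<tau> x = 0 \<longleftrightarrow> x = 0"
  using abs_galois_inj[of x 0] by (simp add: abs_galois_0)

lemma abs_galois_1: "\<tau> 1 = 1"
  using abs_galois_mult[of 1 1] abs_galois_eq_0_iff[of 1] by simp

lemma abs_galois_uminus: "\<tau> (- x) = - \<tau> x"
  using abs_galois_add[of x "- x"] by (simp add: abs_galois_0 add_eq_0_iff2)

lemma abs_galois_inverse: "\<tau> (inverse x) = inverse (\<tau> x)"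
proof (cases "x = 0")
  case False
  then have "\<tau> x * \<tau> (inverse x) = 1"
    by (simp flip: abs_galois_mult add: abs_galois_1)
  then show ?thesis by (rule inverse_unique[symmetric])
qed (simp add: abs_galois_0)

lemma abs_galois_prod: "\<tau> (prod f I) = (\<Prod>i\<in>I. \<tau> (f i))"
  by (induction I rule: infinite_finite_induct) (auto simp: abs_galois_mult abs_galois_1)

lemma inv_abs_galois_left: "inv_into UNIV \<tau> (\<tau> x) = x"
  using abs_galois_bij by (simp add: bij_def)

lemma inv_abs_galois_right: "\<tau> (inv_into UNIV \<tau> x) = x"
  using abs_galois_bij by (simp add: bij_def surj_f_inv_f)

lemma abs_galois_inv: "inv_into UNIV \<tau> \<in> abs_galois K"
proof -
  have "bij (inv_into UNIV \<tau>)" using abs_galois_bij by (rule bij_imp_bij_inv)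
  moreover have "inv_into UNIV \<tau> (x + y) = inv_into UNIV \<tau> x + inv_into UNIV \<tau> y"
    "inv_into UNIV \<tau> (x * y) = inv_into UNIV \<tau> x * inv_into UNIV \<tau> y" for x y
    by (simp_all flip: abs_galois_inj add: inv_abs_galois_right abs_galois_add abs_galois_mult)
  moreover have "inv_into UNIV \<tau> x = x" if "x \<in> K" for x
    using inv_abs_galois_left[of x] abs_galois_fix[OF that] by simp
  ultimately show ?thesis by (simp add: abs_galois_iff)
qed

lemma inv_inv_abs_galois: "inv_into UNIV (inv_into UNIV \<tau>) = \<tau>"
  using abs_galois_bij by (rule inv_inv_eq)

lemma abs_galois_comp: "\<sigma> \<in> abs_galois K \<Longrightarrow> \<tau> \<circ> \<sigma> \<in> abs_galois K"
  using \<tau> by (auto simp: abs_galois_iff bij_comp)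

end

lemma id_abs_galois: "id \<in> abs_galois K"
  by (simp add: abs_galois_iff)

context
  fixes K assumes K: "is_subfield K"
begin

lemmas finite_orb = finite_orbit_in[OF is_subfield_UNIV K subset_UNIV UNIV_I]
  and mem_orb = mem_orbit_in[OF is_subfield_UNIV K subset_UNIV UNIV_I]
  and image_orb = image_orbit_in[OF is_subfield_UNIV K subset_UNIV UNIV_I]

lemma orb_nonempty: "orb K a \<noteq> {}"
  using mem_orb by blast

lemma card_orb_pos: "card (orb K a) > 0"
  using finite_orb orb_nonempty by (simp add: card_gt_0_iff)

lemma root_poly_orb: "root_poly (orb K a) \<in> polys K"
  unfolding polys_def
  using abs_galois_fixed_field[OF K] root_poly_orbit_fixed(1)[OF is_subfield_UNIV K subset_UNIV UNIV_I]
  by blast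

lemma prod_orb_mem: "(\<Prod>b\<in>orb K a. b) \<in> K"
proof (rule abs_galois_fixed_field[OF K])
  fix \<tau> assume \<tau>: "\<tau> \<in> abs_galois K"
  have "(\<Prod>b\<in>orb K a. b) = (\<Prod>b\<in>\<tau> ` orb K a. b)"
    by (simp add: image_orb[OF \<tau>])
  also have "\<dots> = (\<Prod>b\<in>orb K a. \<tau> b)"
    by (rule prod.reindex_cong[OF _ refl refl]) (auto simp: inj_on_def abs_galois_inj[OF \<tau>])
  also have "\<dots> = \<tau> (\<Prod>b\<in>orb K a. b)"
    by (simp add: abs_galois_prod[OF \<tau>])
  finally show "\<tau> (\<Prod>b\<in>orb K a. b) = (\<Prod>b\<in>orb K a. b)"
    by (rule sym)
qed

end

lemma poly_root_poly_eq_0_iff: "finite B \<Longrightarrow> poly (root_poly B) x = 0 \<longleftrightarrow> x \<in> B"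
  by (auto simp: root_poly_def poly_prod)

text \<open>Normality. The polynomial with the Aut(L/k)-orbit of \<open>x\<close> as roots has
  coefficients in the fixed field \<open>k\<close>, so \<tau> sends its root \<open>x\<close> to
  another of its roots, and all of them lie in \<open>L\<close>.\<close>

lemma galois_extension_abs_galois_mem:
  assumes gal: "galois_extension L k" and \<tau>: "\<tau> \<in> abs_galois k" and x: "x \<in> L"
  shows "\<tau> x \<in> L"
proof -
  have L: "is_subfield L" and k: "is_subfield k" and kL: "k \<subseteq> L"
    and fixed: "\<And>x. x \<in> L \<Longrightarrow> (\<And>\<sigma>. \<sigma> \<in> field_auts L k \<Longrightarrow> \<sigma> x = x) \<Longrightarrow> x \<in> k"
    using gal by (auto simp: galois_extension_def)
  let ?B = "orbit_in L k x"
  have fin: "finite ?B" by (rule finite_orbit_in[OF L k kL x])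
  have p: "root_poly ?B \<in> polys k"
    unfolding polys_def
  proof (intro CollectI allI fixed)
    show "coeff (root_poly ?B) i \<in> L" for i
      using root_poly_orbit_fixed(2)[OF L k kL x id_field_auts[OF kL L]] .
    show "\<sigma> (coeff (root_poly ?B) i) = coeff (root_poly ?B) i" if "\<sigma> \<in> field_auts L k" for \<sigma> i
      using root_poly_orbit_fixed(1)[OF L k kL x that] .
  qed
  have "poly (root_poly ?B) (\<tau> x) = \<tau> (poly (root_poly ?B) x)"
    using field_auts_poly[OF is_subfield_UNIV k subset_UNIV \<tau> p] by simp
  also have "poly (root_poly ?B) x = 0"
    using poly_root_poly_eq_0_iff[OF fin, of x] mem_orbit_in[OF L k kL x] by simp
  finally have "\<tau> x \<in> ?B"
    by (simp add: poly_root_poly_eq_0_iff[OF fin] abs_galois_0[OF \<tau>])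
  then show ?thesis
    using orbit_in_subset[OF L k kL x] by blast
qed

lemma galois_extension_image:
  assumes gal: "galois_extension L k" and \<tau>: "\<tau> \<in> abs_galois k"
  shows "\<tau> ` L = L"
proof
  show "\<tau> ` L \<subseteq> L" using galois_extension_abs_galois_mem[OF gal \<tau>] by blast
  show "L \<subseteq> \<tau> ` L"
    using galois_extension_abs_galois_mem[OF gal abs_galois_inv[OF \<tau>]] inv_abs_galois_right[OF \<tau>]
    by (metis image_eqI subsetI)
qed

lemma conj_abs_galois:
  assumes \<tau>: "\<tau> \<in> abs_galois k" and img: "\<tau> ` L = L" and \<sigma>: "\<sigma> \<in> abs_galois L"
  shows "\<tau> \<circ> \<sigma> \<circ> inv_into UNIV \<tau> \<in> abs_galois L"
proof -
  have "(\<tau> \<circ> \<sigma> \<circ> inv_into UNIV \<tau>) x = x" if "x \<in> L" for x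
  proof -
    from img that obtain z where "z \<in> L" "x = \<tau> z" by blast
    then show ?thesis
      by (simp add: inv_abs_galois_left[OF \<tau>] abs_galois_fix[OF \<sigma>])
  qed
  moreover have "bij (\<tau> \<circ> \<sigma> \<circ> inv_into UNIV \<tau>)"
    by (intro bij_comp abs_galois_bij[OF \<tau>] abs_galois_bij[OF \<sigma>] abs_galois_bij[OF abs_galois_inv[OF \<tau>]])
  ultimately show ?thesis
    by (simp add: abs_galois_iff abs_galois_add[OF \<tau>] abs_galois_add[OF \<sigma>] abs_galois_add[OF abs_galois_inv[OF \<tau>]]
      abs_galois_mult[OF \<tau>] abs_galois_mult[OF \<sigma>] abs_galois_mult[OF abs_galois_inv[OF \<tau>]])
qed

text \<open>If \<tau> stabilises \<open>L\<close> as a set, conjugation by \<tau> maps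
  Aut(\<rat>-bar/L) to itself. This is the algebraic source of the commutation of the
  averages.\<close>

lemma orb_image_normaliser:
  assumes \<tau>: "\<tau> \<in> abs_galois k" and img: "\<tau> ` L = L"
  shows "orb L (\<tau> a) = \<tau> ` orb L a"
proof
  have "\<sigma> (\<tau> a) \<in> \<tau> ` orb L a" if \<sigma>: "\<sigma> \<in> abs_galois L" for \<sigma>
  proof -
    have img': "inv_into UNIV \<tau> ` L = L"
      using img inv_abs_galois_left[OF \<tau>] by (metis (no_types, lifting) image_cong image_image image_ident)
    have "inv_into UNIV \<tau> \<circ> \<sigma> \<circ> \<tau> \<in> abs_galois L"
      using conj_abs_galois[OF abs_galois_inv[OF \<tau>] img' \<sigma>] by (simp add: inv_inv_abs_galois[OF \<tau>])
    then have "(inv_into UNIV \<tau> \<circ> \<sigma> \<circ> \<tau>) a \<in> orb L a"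
      unfolding orbit_in_def by (rule imageI)
    then show ?thesis
      using inv_abs_galois_right[OF \<tau>] by (metis comp_apply image_eqI)
  qed
  then show "orb L (\<tau> a) \<subseteq> \<tau> ` orb L a" by (auto simp: orbit_in_def)
  have "\<tau> (\<sigma> a) \<in> orb L (\<tau> a)" if \<sigma>: "\<sigma> \<in> abs_galois L" for \<sigma>
    using conj_abs_galois[OF \<tau> img \<sigma>] inv_abs_galois_left[OF \<tau>]
    by (auto simp: orbit_in_def image_iff intro!: bexI[of _ "\<tau> \<circ> \<sigma> \<circ> inv_into UNIV \<tau>"])
  then show "\<tau> ` orb L a \<subseteq> orb L (\<tau> a)" by (auto simp: orbit_in_def)
qed


section \<open>Finite Galois closures\<close>

lemma algebraic_over_subfield:
  assumes K: "is_subfield K"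
  shows "(QB.algebraic over K) x"
proof -
  obtain p where p: "p \<in> polys K" "p \<noteq> 0" "poly p x = 0"
    using qbar_algebraic polys_mono[OF Rats_subset_subfield[OF K]] by blast
  \<comment> \<open>In the algebra library a polynomial is a coefficient list that begins with the
    leading coefficient; \<open>coeffs\<close> begins with the constant one.\<close>
  define q where "q = rev (coeffs p)"
  have "coeffs p \<noteq> []" using p(2) by simp
  have qK: "q \<in> carrier (K[X]\<^bsub>qbar_ring\<^esub>)"
    using p(1,2) by (auto simp: q_def univ_poly_carrier[symmetric] polynomial_def polys_def coeffs_def
      hd_rev last_coeffs_eq_coeff_degree)
  have ev: "ring.eval qbar_ring (rev cs) x = poly (Poly cs) x" for cs
    by (induction cs) (auto simp: QB.eval_append Poly_append)
  have "QB.eval q x = \<zero>\<^bsub>qbar_ring\<^esub>"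
    unfolding q_def using ev[of "coeffs p"] p(3) by simp
  with qK show ?thesis
    using QB.algebraicI[of q K x] p(2) by (simp add: q_def)
qed

text \<open>Adjoin the whole finite orbit of \<open>a\<close>. The result is the least subring
  containing \<open>K\<close> and the orbit, so every automorphism over \<open>K\<close> maps it to
  itself, and the restrictions of these automorphisms have fixed field \<open>K\<close>.\<close>

lemma finite_galois_closure:
  assumes K: "is_subfield K"
  obtains L where "a \<in> L" "galois_extension L K" "ring.finite_dimension qbar_ring K L"
proof -
  obtain bs where bs: "set bs = orb K a" using finite_list[OF finite_orb[OF K]] by blast
  define L where "L = QB.finite_extension K bs"
  have L: "is_subfield L" unfolding L_def
    by (rule QB.finite_extension_is_subfield[OF K]) (auto simp only: qbar_ring_simps intro: algebraic_over_subfield[OF K])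
  have min: "L = \<Inter> {K'. subring K' qbar_ring \<and> K \<subseteq> K' \<and> set bs \<subseteq> K'}"
    unfolding L_def by (rule QB.finite_extension_minimal) (auto intro: subfield_subring[OF K])
  have KL: "K \<subseteq> L" and bsL: "orb K a \<subseteq> L"
    using min bs by blast+
  have stab: "\<tau> ` L \<subseteq> L" if \<tau>: "\<tau> \<in> abs_galois K" for \<tau>
  proof -
    have "subring (\<tau> -` L) qbar_ring"
      by (auto simp: subring_qbar_iff abs_galois_1[OF \<tau>] abs_galois_add[OF \<tau>] abs_galois_mult[OF \<tau>] abs_galois_uminus[OF \<tau>]
         intro: subfield_1[OF L] subfield_add[OF L] subfield_mult[OF L] subfield_uminus[OF L])
    moreover have "K \<subseteq> \<tau> -` L" using KL by (auto simp: abs_galois_fix[OF \<tau>])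
    moreover have "set bs \<subseteq> \<tau> -` L"
      using image_orb[OF K \<tau>, of a] bsL by (auto simp: bs)
    ultimately have "L \<subseteq> \<tau> -` L" by (subst (1) min) blast
    then show ?thesis by blast
  qed
  have "x \<in> K" if x: "x \<in> L" "\<forall>\<sigma>\<in>field_auts L K. \<sigma> x = x" for x
  proof (rule abs_galois_fixed_field[OF K])
    fix \<tau> assume \<tau>: "\<tau> \<in> abs_galois K"
    have "\<tau> ` L = L"
      using stab[OF \<tau>] stab[OF abs_galois_inv[OF \<tau>]] inv_abs_galois_right[OF \<tau>]
      by (metis image_eqI image_subset_iff subsetI subset_antisym)
    then have "bij_betw (restrict \<tau> L) L L"
      by (simp add: bij_betw_def inj_on_def abs_galois_inj[OF \<tau>])
    then have "restrict \<tau> L \<in> field_auts L K"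
      using KL by (auto simp: field_auts_def abs_galois_add[OF \<tau>] abs_galois_mult[OF \<tau>] abs_galois_fix[OF \<tau>]
        subfield_add[OF L] subfield_mult[OF L])
    with x show "\<tau> x = x" by force
  qed
  then have gal: "galois_extension L K"
    unfolding galois_extension_def using L K KL by (auto simp: field_auts_def)
  have "ring.finite_dimension qbar_ring K L" unfolding L_def
    by (rule QB.finite_extension_finite_dimension[OF K]) (auto simp only: qbar_ring_simps intro: algebraic_over_subfield[OF K])
  with gal show thesis
    using bsL mem_orb[OF K, of a] by (intro that[of L]) auto
qed

section \<open>Absolute values\<close>

text \<open>Taking n-th roots removes the linear factor. The same device yields the ultrametric
  inequality, Ostrowski's bound, the triangle inequality after renormalising, and the bound for an
  element with bounded powers.\<close>

lemma power_growth_le: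
  fixes x y A B :: real
  assumes "0 \<le> y" and le: "\<And>n. x ^ n \<le> (A * real n + B) * y ^ n"
  shows "x \<le> y"
proof (rule ccontr)
  assume "\<not> x \<le> y"
  then have xy: "y < x" by simp
  show False
  proof (cases "y = 0")
    case True
    then show False using le[of 1] xy by simp
  next
    case False
    then have y: "y > 0" using assms(1) by simp
    define z where "z = x / y"
    have z: "z > 1" using xy y by (simp add: z_def)
    have "z ^ n \<le> A * real n + B" for n
      using le[of n] y by (simp add: z_def power_divide divide_le_eq)
    moreover have "eventually (\<lambda>n. A * real n + B < z ^ n) at_top"
      using z by real_asymp
    ultimately show False
      by (metis (mono_tags, lifting) eventually_at_top_linorder linorder_not_less order_refl)
  qed
qed

lemma rat_int_quotient:
  fixes r :: rat
  obtains a b where "r = of_int a / of_int b" "b \<noteq> 0"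
  by (cases r) (auto simp: Fract_of_int_quotient)

lemma powr_power_comm: "0 \<le> x \<Longrightarrow> (x ^ n) powr c = (x powr c) ^ n" for x c :: real
  by (induction n) (auto simp: powr_mult)

context
  fixes k \<phi>
  assumes k: "is_subfield k" and \<phi>: "\<phi> \<in> absolute_values k"
begin

lemma av_nonneg: "x \<in> k \<Longrightarrow> 0 \<le> \<phi> x"
  and av_eq_0_iff: "x \<in> k \<Longrightarrow> \<phi> x = 0 \<longleftrightarrow> x = 0"
  and av_mult: "x \<in> k \<Longrightarrow> y \<in> k \<Longrightarrow> \<phi> (x * y) = \<phi> x * \<phi> y"
  and av_add: "x \<in> k \<Longrightarrow> y \<in> k \<Longrightarrow> \<phi> (x + y) \<le> \<phi> x + \<phi> y"
  and av_extensional: "\<phi> \<in> extensional k"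
  and av_nontrivial: "\<exists>x\<in>k. x \<noteq> 0 \<and> \<phi> x \<noteq> 1"
  using \<phi> by (auto simp: absolute_values_def)

lemma av_0: "\<phi> 0 = 0"
  using av_eq_0_iff[OF subfield_0[OF k]] by simp

lemma av_pos: "x \<in> k \<Longrightarrow> x \<noteq> 0 \<Longrightarrow> 0 < \<phi> x"
  using av_nonneg[of x] av_eq_0_iff[of x] by linarith

lemma av_1: "\<phi> 1 = 1"
  using av_mult[OF subfield_1[OF k] subfield_1[OF k]] av_eq_0_iff[OF subfield_1[OF k]] by simp

lemma av_power: "x \<in> k \<Longrightarrow> \<phi> (x ^ n) = \<phi> x ^ n"
  by (induction n) (auto simp: av_1 av_mult subfield_power[OF k])

lemma av_uminus: "x \<in> k \<Longrightarrow> \<phi> (- x) = \<phi> x"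
proof -
  have m1: "- 1 \<in> k" using subfield_uminus[OF k subfield_1[OF k]] .
  have "\<phi> (- 1) * \<phi> (- 1) = 1"
    using av_mult[OF m1 m1] av_1 by simp
  then have "\<phi> (- 1) = 1"
    using av_nonneg[OF m1] by (metis abs_of_nonneg abs_square_eq_1 power2_eq_square)
  then show "x \<in> k \<Longrightarrow> \<phi> (- x) = \<phi> x"
    using av_mult[OF m1, of x] by simp
qed

lemma av_inverse: "x \<in> k \<Longrightarrow> \<phi> (inverse x) = inverse (\<phi> x)"
proof (cases "x = 0")
  case False
  assume x: "x \<in> k"
  have "\<phi> x * \<phi> (inverse x) = 1"
    using av_mult[OF x subfield_inverse[OF k x]] False av_1 by simp
  then show ?thesis by (rule inverse_unique[symmetric])
qed (simp add: av_0)

lemma av_divide: "x \<in> k \<Longrightarrow> y \<in> k \<Longrightarrow> \<phi> (x / y) = \<phi> x / \<phi> y"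
  by (simp add: divide_inverse av_mult av_inverse subfield_inverse[OF k])

lemma av_sum: "(\<And>i. i \<in> I \<Longrightarrow> f i \<in> k) \<Longrightarrow> \<phi> (sum f I) \<le> (\<Sum>i\<in>I. \<phi> (f i))"
proof (induction I rule: infinite_finite_induct)
  case (insert i I)
  then have "\<phi> (f i + sum f I) \<le> \<phi> (f i) + \<phi> (sum f I)"
    by (intro av_add subfield_sum[OF k]) auto
  with insert show ?case by auto
qed (auto simp: av_0)

lemma av_of_nat_le: "\<phi> (of_nat n) \<le> real n"
proof (induction n)
  case (Suc n)
  then show ?case
    using av_add[OF subfield_1[OF k] subfield_of_nat[OF k, of n]] by (simp add: av_1)
qed (simp add: av_0)

lemma av_of_int: "\<phi> (of_int m) = \<phi> (of_nat (nat \<bar>m\<bar>))"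
  by (cases m rule: int_cases2) (auto simp: av_uminus subfield_of_nat[OF k])

lemma av_binomial:
  assumes x: "x \<in> k" and y: "y \<in> k"
  shows "\<phi> (x + y) ^ n \<le> (\<Sum>i\<le>n. \<phi> (of_nat (n choose i)) * \<phi> x ^ i * \<phi> y ^ (n - i))"
proof -
  have "\<phi> (x + y) ^ n = \<phi> (\<Sum>i\<le>n. of_nat (n choose i) * x ^ i * y ^ (n - i))"
    by (simp flip: binomial_ring add: av_power subfield_add[OF k x y])
  also have "\<dots> \<le> (\<Sum>i\<le>n. \<phi> (of_nat (n choose i) * x ^ i * y ^ (n - i)))"
    by (rule av_sum) (simp add: x y subfield_mult[OF k] subfield_power[OF k] subfield_of_nat[OF k])
  also have "\<dots> = (\<Sum>i\<le>n. \<phi> (of_nat (n choose i)) * \<phi> x ^ i * \<phi> y ^ (n - i))"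
    by (simp add: x y subfield_mult[OF k] subfield_power[OF k] subfield_of_nat[OF k] av_mult av_power)
  finally show ?thesis .
qed

text \<open>Cauchy's bound: if \<phi> x > 1, solve the equation for the top power x^d. Each of the d
  lower terms is at most C times the (d - 1)-th power of \<phi> x, and this power cancels.\<close>

lemma av_root_bound:
  assumes p: "p \<in> polys k" "lead_coeff p = 1" "poly p x = 0" and x: "x \<in> k"
    and C: "\<And>i. \<phi> (coeff p i) \<le> C"
  shows "\<phi> x \<le> max 1 (real (degree p) * C)"
proof (cases "\<phi> x \<le> 1")
  case False
  define d where "d = degree p"
  have c: "coeff p i \<in> k" for i using p(1) by (simp add: polys_def)
  have "d \<noteq> 0"
  proof
    assume "d = 0"
    then obtain c where "p = [:c:]" by (auto simp: d_def elim: degree_eq_zeroE)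
    with p(2,3) show False by simp
  qed
  have "poly p x = (\<Sum>i<d. coeff p i * x ^ i) + x ^ d"
    using p(2) by (simp add: poly_altdef d_def lessThan_Suc_atMost[symmetric])
  then have "x ^ d = - (\<Sum>i<d. coeff p i * x ^ i)"
    using p(3) by (simp add: add_eq_0_iff)
  then have "\<phi> x ^ d = \<phi> (\<Sum>i<d. coeff p i * x ^ i)"
    using x c by (simp flip: av_power add: av_uminus subfield_sum[OF k] subfield_mult[OF k] subfield_power[OF k])
  also have "\<dots> \<le> (\<Sum>i<d. \<phi> (coeff p i * x ^ i))"
    by (rule av_sum) (simp add: c x subfield_mult[OF k] subfield_power[OF k])
  also have "\<dots> \<le> (\<Sum>i<d. C * \<phi> x ^ (d - 1))"
  proof (rule sum_mono)
    fix i assume "i \<in> {..<d}"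
    then have "\<phi> x ^ i \<le> \<phi> x ^ (d - 1)"
      using False by (intro power_increasing) auto
    moreover have "0 \<le> C"
      using C[of 0] av_nonneg[OF c[of 0]] by linarith
    ultimately show "\<phi> (coeff p i * x ^ i) \<le> C * \<phi> x ^ (d - 1)"
      using C[of i] av_nonneg[OF x] by (auto simp: av_mult c x subfield_power[OF k] av_power intro!: mult_mono)
  qed
  also have "\<dots> = real d * C * \<phi> x ^ (d - 1)" by simp
  finally have "\<phi> x * \<phi> x ^ (d - 1) \<le> real d * C * \<phi> x ^ (d - 1)"
    using \<open>d \<noteq> 0\<close> by (simp flip: power_Suc)
  then have "\<phi> x \<le> real d * C"
    using False by simp
  then show ?thesis by (simp add: d_def)
qed simp

section \<open>Non-archimedean absolute values\<close>

context
  assumes nonarch: "\<And>n::nat. \<phi> (of_nat n) \<le> 1"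
begin

text \<open>In the expansion of (x + y)^n the binomial coefficients have absolute value at most 1,
  so n + 1 terms of size at most the n-th power of the maximum remain.\<close>

lemma av_ultrametric:
  assumes x: "x \<in> k" and y: "y \<in> k"
  shows "\<phi> (x + y) \<le> max (\<phi> x) (\<phi> y)"
proof (rule power_growth_le[where A = 1 and B = 1])
  let ?M = "max (\<phi> x) (\<phi> y)"
  show M: "0 \<le> ?M" using av_nonneg[OF x] by simp
  fix n
  have "\<phi> (x + y) ^ n \<le> (\<Sum>i\<le>n. \<phi> (of_nat (n choose i)) * \<phi> x ^ i * \<phi> y ^ (n - i))"
    by (rule av_binomial) fact+
  also have "\<dots> \<le> (\<Sum>i\<le>n. 1 * ?M ^ i * ?M ^ (n - i))"
    using nonarch av_nonneg[OF x] av_nonneg[OF y] M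
    by (intro sum_mono mult_mono power_mono mult_nonneg_nonneg) (auto simp: av_nonneg subfield_of_nat[OF k])
  also have "\<dots> = (1 * real n + 1) * ?M ^ n"
    by (simp flip: power_add)
  finally show "\<phi> (x + y) ^ n \<le> (1 * real n + 1) * ?M ^ n" .
qed

lemma av_ultrametric_sum:
  assumes "0 \<le> B" "\<And>i. i \<in> I \<Longrightarrow> f i \<in> k" "\<And>i. i \<in> I \<Longrightarrow> \<phi> (f i) \<le> B"
  shows "\<phi> (sum f I) \<le> B"
  using assms(2,3)
proof (induction I rule: infinite_finite_induct)
  case (insert i I)
  then have "\<phi> (f i + sum f I) \<le> max (\<phi> (f i)) (\<phi> (sum f I))"
    by (intro av_ultrametric subfield_sum[OF k]) auto
  moreover have "\<phi> (sum f I) \<le> B" "\<phi> (f i) \<le> B" using insert by auto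
  ultimately show ?case using insert.hyps by simp
qed (auto simp: av_0 assms(1))

text \<open>If \<phi> x > 1, the leading term exceeds all the others and cannot be cancelled. The
  leading coefficient is only asked to be a unit at \<phi>, so that rational polynomials can be used
  without making them monic.\<close>

lemma av_root_le_1:
  assumes p: "p \<in> polys k" "p \<noteq> 0" "poly p x = 0" and x: "x \<in> k"
    and lc: "\<phi> (lead_coeff p) = 1" and C: "\<And>i. \<phi> (coeff p i) \<le> 1"
  shows "\<phi> x \<le> 1"
proof (rule ccontr)
  assume gt: "\<not> \<phi> x \<le> 1"
  define d where "d = degree p"
  have c: "coeff p i \<in> k" for i using p(1) by (simp add: polys_def)
  have "d \<noteq> 0"
  proof
    assume "d = 0"
    then obtain c where "p = [:c:]" by (auto simp: d_def elim: degree_eq_zeroE)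
    with p(2,3) show False by simp
  qed
  have "poly p x = (\<Sum>i<d. coeff p i * x ^ i) + lead_coeff p * x ^ d"
    by (simp add: poly_altdef d_def lessThan_Suc_atMost[symmetric])
  then have "lead_coeff p * x ^ d = - (\<Sum>i<d. coeff p i * x ^ i)"
    using p(3) by (simp add: add_eq_0_iff)
  then have "\<phi> (lead_coeff p * x ^ d) = \<phi> (\<Sum>i<d. coeff p i * x ^ i)"
    using x c by (simp add: av_uminus subfield_sum[OF k] subfield_mult[OF k] subfield_power[OF k])
  also have "\<dots> \<le> \<phi> x ^ (d - 1)"
  proof (rule av_ultrametric_sum)
    show "0 \<le> \<phi> x ^ (d - 1)" using av_nonneg[OF x] by simp
    fix i assume i: "i \<in> {..<d}"
    then have "\<phi> x ^ i \<le> \<phi> x ^ (d - 1)"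
      using gt by (intro power_increasing) auto
    then have "\<phi> (coeff p i) * \<phi> x ^ i \<le> 1 * \<phi> x ^ (d - 1)"
      using C[of i] av_nonneg[OF x] av_nonneg[OF c] by (intro mult_mono) auto
    then show "\<phi> (coeff p i * x ^ i) \<le> \<phi> x ^ (d - 1)"
      by (auto simp: av_mult c x subfield_power[OF k] av_power)
  qed (simp add: c x subfield_mult[OF k] subfield_power[OF k])
  finally have "\<phi> x * \<phi> x ^ (d - 1) \<le> 1 * \<phi> x ^ (d - 1)"
    using \<open>d \<noteq> 0\<close> lc c x by (simp flip: power_Suc add: av_mult subfield_power[OF k] av_power)
  then show False
    using gt by simp
qed

end

text \<open>If \<phi> were trivial on the positive integers, it would be trivial on \<rat>, so every
  nonzero rational coefficient would be a unit. Each x, being algebraic, would then have \<phi> x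
  \<le> 1, and likewise its inverse.\<close>

lemma av_nontrivial_nat: "\<exists>n>0. \<phi> (of_nat n) \<noteq> 1"
proof (rule ccontr)
  assume neg: "\<not> (\<exists>n>0. \<phi> (of_nat n) \<noteq> 1)"
  have "\<phi> (of_nat n) = 1" if "n > 0" for n
    using neg that by blast
  then have *: "\<phi> (of_nat n) = (if n = 0 then 0 else 1)" for n
    by (cases "n = 0") (simp_all add: av_0)
  have rat: "\<phi> (of_rat r) = (if r = 0 then 0 else 1)" for r
  proof -
    obtain a b where r: "r = of_int a / of_int b" "b \<noteq> 0" by (rule rat_int_quotient)
    have "\<phi> (of_rat r) = \<phi> (of_int a) / \<phi> (of_int b)"
      using r by (simp add: of_rat_divide av_divide subfield_of_int[OF k])
    moreover have "r = 0 \<longleftrightarrow> a = 0" using r by simp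
    moreover have "\<phi> (of_int m) = (if m = 0 then 0 else 1)" for m
      unfolding av_of_int * by simp
    ultimately show ?thesis using r(2) by simp
  qed
  have le: "\<phi> x \<le> 1" if x: "x \<in> k" for x
  proof -
    obtain p where p: "p \<in> polys \<rat>" "p \<noteq> 0" "poly p x = 0" using qbar_algebraic by blast
    have "\<exists>r. coeff p i = of_rat r" for i
      using p(1) by (auto simp: polys_def Rats_def)
    then obtain r where r: "coeff p i = of_rat (r i)" for i
      by metis
    show ?thesis
    proof (rule av_root_le_1[of p])
      show "p \<in> polys k" using p(1) polys_mono[OF Rats_subset_subfield[OF k]] by blast
      show "\<phi> (lead_coeff p) = 1"
        using p(2) r[of "degree p"] rat by (metis leading_coeff_0_iff of_rat_0)
      show "\<phi> (coeff p i) \<le> 1" for i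
        unfolding r rat by simp
      show "\<phi> (of_nat n) \<le> 1" for n
        unfolding * by simp
    qed (use p x in auto)
  qed
  have "\<phi> x = 1" if "x \<in> k" "x \<noteq> 0" for x
    using le[OF that(1)] le[OF subfield_inverse[OF k that(1)]] av_pos[OF that] av_inverse[OF that(1)]
    by (simp add: inverse_le_1_iff)
  then show False using av_nontrivial by blast
qed

end


section \<open>Ostrowski's theorem\<close>

context
  fixes g :: "nat \<Rightarrow> real"
  assumes g_mult: "\<And>m n. g (m * n) = g m * g n" and g_add: "\<And>m n. g (m + n) \<le> g m + g n"
    and g_0: "g 0 = 0" and g_1: "g 1 = 1" and g_pos: "\<And>n. n > 0 \<Longrightarrow> g n > 0"
    and g_le: "\<And>n. g n \<le> real n"
begin

text \<open>Write \<open>b\<close> in base \<open>a\<close>: there are at most \<open>k\<close>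
  digits, each of \<open>g\<close>-value at most \<open>a\<close>, and the powers of
  \<open>a\<close> that occur have \<open>g\<close>-value at most (max 1 (g a))^k.\<close>

lemma digits_bound:
  assumes a: "2 \<le> a"
  shows "b < a ^ k \<Longrightarrow> g b \<le> real k * real a * (max 1 (g a)) ^ k"
proof (induction k arbitrary: b)
  case 0
  then show ?case by (simp add: g_0)
next
  case (Suc k)
  let ?M = "max 1 (g a)"
  have "g b = g (a * (b div a) + b mod a)" by simp
  also have "\<dots> \<le> g a * g (b div a) + g (b mod a)"
    using g_add g_mult by metis
  also have "\<dots> \<le> ?M * (real k * real a * ?M ^ k) + real a"
  proof (intro add_mono mult_mono)
    have "b div a < a ^ k"
      using Suc.prems a by (simp add: less_mult_imp_div_less mult.commute)
    then show "g (b div a) \<le> real k * real a * ?M ^ k" by (rule Suc.IH)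
    show "0 \<le> g (b div a)" using g_pos[of "b div a"] g_0 by (cases "b div a = 0") auto
    have "b mod a \<le> a" using a by (simp add: less_imp_le)
    then show "g (b mod a) \<le> real a"
      using g_le[of "b mod a"] by linarith
  qed auto
  also have "\<dots> \<le> ?M * (real k * real a * ?M ^ k) + real a * ?M ^ Suc k"
  proof -
    have "1 \<le> ?M ^ Suc k" by (rule one_le_power) simp
    then have "real a * 1 \<le> real a * ?M ^ Suc k" by (rule mult_left_mono) simp
    then show ?thesis by simp
  qed
  also have "\<dots> = real (Suc k) * real a * ?M ^ Suc k" by (simp add: algebra_simps)
  finally show ?case .
qed

lemma g_power: "g (n ^ m) = g n ^ m"
  using g_1 by (induction m) (auto simp: g_mult)

text \<open>Apply the digit bound to b^n, whose number of digits grows linearly in n, and take n-th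
  roots.\<close>

lemma g_log_bound:
  assumes a: "2 \<le> a" and b: "1 \<le> b"
  shows "g b \<le> (max 1 (g a)) powr log (real a) (real b)"
proof -
  let ?M = "max 1 (g a)" and ?L = "log (real a) (real b)"
  have L: "0 \<le> ?L" using a b by (simp add: zero_le_log_cancel_iff)
  show ?thesis
  proof (rule power_growth_le[where A = "?L * real a * ?M" and B = "real a * ?M"])
    fix n
    \<comment> \<open>A number of base-\<open>a\<close> digits that suffices for b^n, because n
      log_a b < m.\<close>
    define m where "m = nat \<lfloor>real n * ?L\<rfloor> + 1"
    have m: "real n * ?L < real m" "real m \<le> real n * ?L + 1"
      using L by (simp_all add: m_def) linarith
    have "real b = real a powr ?L"
      using a b by simp
    then have "real b ^ n = (real a powr ?L) ^ n" by simp
    also have "\<dots> = real a powr (real n * ?L)"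
      using a by (intro powr_power) simp
    finally have "real b ^ n = real a powr (real n * ?L)" .
    also have "\<dots> < real a powr real m"
      using a m by (intro powr_less_mono) auto
    also have "\<dots> = real (a ^ m)" using a by (simp add: powr_realpow)
    finally have "b ^ n < a ^ m" by (metis of_nat_less_iff of_nat_power)
    then have "g b ^ n \<le> real m * real a * ?M ^ m"
      using digits_bound[OF a] by (simp flip: g_power)
    also have "\<dots> = real m * real a * ?M powr real m"
      by (subst powr_realpow) auto
    also have "\<dots> \<le> (real n * ?L + 1) * real a * ?M powr (real n * ?L + 1)"
      using m L by (intro mult_mono powr_mono) auto
    also have "\<dots> = (?L * real a * ?M * real n + real a * ?M) * (?M powr ?L) ^ n"
    proof -
      have "(?M powr ?L) ^ n = ?M powr (real n * ?L)" by (intro powr_power) simp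
      then show ?thesis by (simp add: powr_add algebra_simps)
    qed
    finally show "g b ^ n \<le> (?L * real a * ?M * real n + real a * ?M) * (?M powr ?L) ^ n" .
  qed simp
qed

text \<open>A single value above 1 forces all values at a \<ge> 2 above 1, by the logarithmic bound.
  The bound used in both directions then makes ln (g b) / ln b independent of b \<ge> 2, and this
  quotient is the exponent.\<close>

lemma ostrowski_archimedean:
  assumes "g n0 > 1"
  shows "\<exists>c>0. \<forall>n. g n = real n powr c"
proof -
  have "n0 \<ge> 1" using assms g_0 by (cases n0) auto
  have gt: "g a > 1" if "a \<ge> 2" for a
  proof (rule ccontr)
    assume "\<not> g a > 1"
    then have "g n0 \<le> 1"
      using g_log_bound[OF that \<open>n0 \<ge> 1\<close>] by (simp add: max_def split: if_splits)
    with assms show False by simp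
  qed
  have le: "ln (g b) / ln (real b) \<le> ln (g a) / ln (real a)" if "a \<ge> 2" "b \<ge> 2" for a b
  proof -
    have "g b \<le> g a powr (ln (real b) / ln (real a))"
      using g_log_bound[of a b] gt[of a] that by (simp add: log_def)
    then have "ln (g b) \<le> ln (g a powr (ln (real b) / ln (real a)))"
      using gt[OF that(1)] gt[OF that(2)] by (subst ln_le_cancel_iff) auto
    also have "\<dots> = ln (real b) / ln (real a) * ln (g a)"
      using gt[OF that(1)] by (simp add: ln_powr)
    finally show ?thesis
      using that by (simp add: field_simps)
  qed
  define c where "c = ln (g 2) / ln 2"
  have "g n = real n powr c" for n
  proof -
    consider "n = 0" | "n = 1" | "n \<ge> 2" by linarith
    then show ?thesis
    proof cases
      case 3
      then have "ln (g n) / ln (real n) = c"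
        using le[of 2 n] le[of n 2] by (simp add: c_def)
      then have "ln (g n) = c * ln (real n)" using 3 by (simp add: field_simps)
      then have "exp (ln (g n)) = exp (c * ln (real n))" by simp
      then show ?thesis using 3 gt[OF 3] by (simp add: powr_def)
    qed (use g_0 g_1 in auto)
  qed
  moreover have "c > 0" using gt[of 2] by (simp add: c_def)
  ultimately show ?thesis by blast
qed

end

text \<open>\<open>padic_abs\<close> is defined through lowest terms; cross-multiplication shows
  that any other fraction has the same difference of multiplicities.\<close>

lemma padic_abs_of_int_quotient:
  assumes p: "Factorial_Ring.prime p" and a: "a \<noteq> 0" and b: "b \<noteq> 0"
  shows "padic_abs p (of_int a / of_int b) =
    real p powi (int (multiplicity (int p) b) - int (multiplicity (int p) a))"
proof -
  define r where "r = (of_int a / of_int b :: rat)"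
  obtain c d where q: "quotient_of r = (c, d)" by (cases "quotient_of r")
  have r0: "r \<noteq> 0" using a b by (simp add: r_def)
  have d: "d > 0" and r: "r = of_int c / of_int d"
    using quotient_of_denom_pos[OF q] quotient_of_div[OF q] by auto
  have c: "c \<noteq> 0" using r r0 by auto
  have "(of_int (a * d) :: rat) = of_int (b * c)"
    using r b d unfolding r_def by (simp add: field_simps)
  then have eq: "a * d = b * c" by (simp only: of_int_eq_iff)
  have "multiplicity (int p) (a * d) = multiplicity (int p) a + multiplicity (int p) d"
    "multiplicity (int p) (b * c) = multiplicity (int p) b + multiplicity (int p) c"
    using a b c d p by (auto intro!: prime_elem_multiplicity_mult_distrib)
  with eq have "multiplicity (int p) a + multiplicity (int p) d = multiplicity (int p) b + multiplicity (int p) c"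
    by simp
  then have "int (multiplicity (int p) d) - int (multiplicity (int p) c)
    = int (multiplicity (int p) b) - int (multiplicity (int p) a)" by linarith
  then show ?thesis
    using r0 q by (simp add: padic_abs_def r_def[symmetric])
qed

section \<open>The p-adic absolute value on the rationals\<close>

context
  fixes p :: nat assumes p: "Factorial_Ring.prime p"
begin

lemma padic_abs_0: "padic_abs p 0 = 0"
  by (simp add: padic_abs_def)

lemma padic_abs_nonneg: "padic_abs p r \<ge> 0"
  by (simp add: padic_abs_def)

lemma padic_abs_eq_0_iff: "padic_abs p r = 0 \<longleftrightarrow> r = 0"
  using prime_gt_0_nat[OF p] by (simp add: padic_abs_def)

lemma padic_abs_of_int: "a \<noteq> 0 \<Longrightarrow> padic_abs p (of_int a) = (1 / real p) ^ multiplicity (int p) a"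
  using padic_abs_of_int_quotient[OF p, of a 1] prime_gt_0_nat[OF p]
  by (simp add: power_int_minus power_one_over inverse_eq_divide)

lemma padic_abs_of_int_le_1: "padic_abs p (of_int a) \<le> 1"
  using padic_abs_of_int[of a] prime_gt_0_nat[OF p]
  by (cases "a = 0") (auto simp: padic_abs_0 intro!: power_le_one)

lemma padic_abs_of_int_eq_1_iff: "padic_abs p (of_int a) = 1 \<longleftrightarrow> \<not> int p dvd a"
proof (cases "a = 0")
  case False
  have "1 / real p < 1" using prime_gt_1_nat[OF p] by simp
  then have "(1 / real p) ^ n = 1 \<longleftrightarrow> n = 0" for n
    using prime_gt_0_nat[OF p] power_Suc_less_one[of "1 / real p" "n - 1"] by (cases n) auto
  then show ?thesis
    using False p by (simp add: padic_abs_of_int multiplicity_eq_zero_iff prime_elem_not_unit)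
      (metis multiplicity_eq_zero_iff not_dvd_imp_multiplicity_0 prime_multiplicity_gt_zero_iff
        prime_nat_int_transfer prime_imp_prime_elem prime_elem_multiplicity_eq_zero_iff)
qed (simp add: padic_abs_0)

lemma padic_abs_self: "padic_abs p (of_nat p) = 1 / real p"
  using padic_abs_of_int[of "int p"] prime_gt_0_nat[OF p] p
  by (simp add: multiplicity_self prime_gt_1_nat)

lemma padic_abs_mult: "padic_abs p (r * s) = padic_abs p r * padic_abs p s"
proof (cases "r = 0 \<or> s = 0")
  case False
  obtain a b c d where q: "r = of_int a / of_int b" "b \<noteq> 0" "s = of_int c / of_int d" "d \<noteq> 0"
    using rat_int_quotient by metis
  then have ac: "a \<noteq> 0" "c \<noteq> 0" using False by auto
  have rs: "r * s = of_int (a * c) / of_int (b * d)" using q by simp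
  have pe: "prime_elem (int p)" using p by simp
  have p0: "real p \<noteq> 0" using prime_gt_0_nat[OF p] by simp
  show ?thesis
    unfolding rs unfolding q(1,3)
    using q ac p0
    by (subst (1 2 3) padic_abs_of_int_quotient[OF p])
      (simp_all add: prime_elem_multiplicity_mult_distrib[OF pe] power_int_add[symmetric] algebra_simps)
qed (auto simp: padic_abs_0)

text \<open>For integers, a power of \<open>p\<close> dividing both summands divides the sum.
  Multiplication by a common denominator \<open>t\<close> reduces rationals to integers.\<close>

lemma padic_abs_add: "padic_abs p (r + s) \<le> max (padic_abs p r) (padic_abs p s)"
proof -
  have pe: "prime_elem (int p)" using p by simp
  have int: "padic_abs p (of_int (a + b)) \<le> max (padic_abs p (of_int a)) (padic_abs p (of_int b))" for a b
  proof (cases "a = 0 \<or> b = 0 \<or> a + b = 0")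
    case True
    then show ?thesis
      using padic_abs_nonneg[of "of_int a"] by (auto simp: padic_abs_0 simp del: of_int_add)
  next
    case False
    define m where "m = min (multiplicity (int p) a) (multiplicity (int p) b)"
    have "int p ^ m dvd a" "int p ^ m dvd b"
      by (auto simp: m_def intro: multiplicity_dvd')
    then have "int p ^ m dvd a + b" by simp
    then have "m \<le> multiplicity (int p) (a + b)"
      using False pe by (intro multiplicity_geI) auto
    then have "(1 / real p) ^ multiplicity (int p) (a + b) \<le> (1 / real p) ^ m"
      using prime_gt_0_nat[OF p] by (intro power_decreasing) auto
    then show ?thesis
      using False by (auto simp: padic_abs_of_int m_def min_def max_def simp del: of_int_add split: if_splits)
  qed
  obtain a b c d where q: "r = of_int a / of_int b" "b \<noteq> 0" "s = of_int c / of_int d" "d \<noteq> 0"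
    using rat_int_quotient by metis
  define t where "t = (of_int (b * d) :: rat)"
  have t: "t * (r + s) = of_int (a * d + c * b)" "t * r = of_int (a * d)" "t * s = of_int (c * b)"
    using q by (auto simp: t_def field_simps)
  have "padic_abs p t * padic_abs p (r + s) \<le> max (padic_abs p t * padic_abs p r) (padic_abs p t * padic_abs p s)"
    unfolding padic_abs_mult[symmetric] t by (rule int)
  also have "\<dots> = padic_abs p t * max (padic_abs p r) (padic_abs p s)"
    using padic_abs_nonneg[of t] by (simp add: max_mult_distrib_left)
  finally show ?thesis
    using padic_abs_nonneg[of t] padic_abs_eq_0_iff[of t] q by (simp add: t_def)
qed

end

section \<open>Ostrowski's theorem for absolute values on a subfield\<close>

context
  fixes k \<phi>
  assumes k: "is_subfield k" and \<phi>: "\<phi> \<in> absolute_values k"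
begin

text \<open>Let \<open>p\<close> be the least positive integer of value below 1; minimality makes it
  prime. Integers not divisible by \<open>p\<close> have value 1, so the value of an integer depends
  only on its multiplicity at \<open>p\<close>.\<close>

lemma ostrowski_nonarchimedean:
  assumes na: "\<And>n::nat. \<phi> (of_nat n) \<le> 1"
  shows "\<exists>p c. Factorial_Ring.prime p \<and> c > 0 \<and> (\<forall>r. \<phi> (of_rat r) = padic_abs p r powr c)"
proof -
  define P where "P n \<longleftrightarrow> n > 0 \<and> \<phi> (of_nat n) < 1" for n :: nat
  have "\<exists>n. P n"
    using av_nontrivial_nat[OF k \<phi>] na unfolding P_def by (metis order_le_less)
  define p where "p = (LEAST n. P n)"
  have Pp: "P p" and min: "\<And>n. n < p \<Longrightarrow> \<not> P n"
    using \<open>\<exists>n. P n\<close> by (auto simp: p_def intro: LeastI_ex dest: not_less_Least)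
  have small: "\<phi> (of_nat n) = 1" if "0 < n" "n < p" for n
    using min[OF that(2)] that(1) na[of n] by (auto simp: P_def)
  have p0: "p > 0" and gp: "\<phi> (of_nat p) < 1" using Pp by (auto simp: P_def)
  have gp0: "\<phi> (of_nat p) > 0"
    using p0 by (intro av_pos[OF k \<phi>] subfield_of_nat[OF k]) simp
  have p1: "p > 1"
    using p0 gp av_1[OF k \<phi>] by (cases "p = 1") auto
  have pr: "Factorial_Ring.prime p"
  proof (rule ccontr)
    assume "\<not> Factorial_Ring.prime p"
    then obtain a where a: "a dvd p" "a \<noteq> 1" "a \<noteq> p" using p1 by (auto simp: prime_nat_iff)
    then obtain b where b: "p = a * b" by blast
    have "0 < a" "a < p" "0 < b" "b < p" using a b p0 by (auto intro!: Nat.gr0I)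
    then have "\<phi> (of_nat a * of_nat b) = 1"
      using small[of a] small[of b] by (subst av_mult[OF k \<phi>]) (auto simp: subfield_of_nat[OF k])
    with gp b show False by simp
  qed
  have unit: "\<phi> (of_int m) = 1" if m: "\<not> int p dvd m" for m
  proof (rule ccontr)
    assume neq: "\<phi> (of_int m) \<noteq> 1"
    have le: "\<phi> (of_int j) \<le> 1" for j unfolding av_of_int[OF k \<phi>] by (rule na)
    with neq have lt: "\<phi> (of_int m) < 1" by (simp add: less_le)
    \<comment> \<open>The remainder lies strictly between 0 and \<open>p\<close>, so it has value 1
      by the choice of \<open>p\<close>; but as \<open>m\<close> minus a multiple of
      \<open>p\<close> it would have value below 1.\<close>
    define r where "r = m mod int p"
    have r: "0 < r" "r < int p"
    proof -
      have "r \<noteq> 0" using m unfolding r_def by (rule contrapos_nn) (rule mod_0_imp_dvd)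
      moreover have "0 \<le> r" unfolding r_def using p0 by (intro pos_mod_sign) simp
      ultimately show "0 < r" by simp
      show "r < int p" unfolding r_def using p0 by (intro pos_mod_bound) simp
    qed
    have "r = m + - (int p * (m div int p))" by (simp add: r_def minus_mult_div_eq_mod)
    then have "\<phi> (of_int r) = \<phi> (of_int m + - (of_nat p * of_int (m div int p)))"
      by (metis of_int_add of_int_minus of_int_mult of_int_of_nat_eq)
    also have "\<dots> \<le> max (\<phi> (of_int m)) (\<phi> (- (of_nat p * of_int (m div int p))))"
      by (rule av_ultrametric[OF k \<phi> na]) (auto intro!: subfield_of_int[OF k] subfield_uminus[OF k] subfield_mult[OF k] subfield_of_nat[OF k])
    finally have "\<phi> (of_int r) \<le> max (\<phi> (of_int m)) (\<phi> (- (of_nat p * of_int (m div int p))))" .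
    moreover have "\<phi> (- (of_nat p * of_int (m div int p))) = \<phi> (of_nat p) * \<phi> (of_int (m div int p))"
      by (simp add: av_uminus[OF k \<phi>] av_mult[OF k \<phi>] subfield_of_int[OF k] subfield_mult[OF k] subfield_of_nat[OF k])
    moreover have "\<dots> \<le> \<phi> (of_nat p) * 1"
      using le gp0 by (intro mult_left_mono) auto
    ultimately have "\<phi> (of_int r) < 1" using lt gp by (auto simp: max_def split: if_splits)
    moreover have "\<phi> (of_int r) = 1"
      unfolding av_of_int[OF k \<phi>] by (rule small) (use r in auto)
    ultimately show False by simp
  qed
  \<comment> \<open>Chosen such that \<phi> p = (1/p)^c.\<close>
  define c where "c = - ln (\<phi> (of_nat p)) / ln (real p)"
  have c: "c > 0" using gp gp0 p1 by (simp add: c_def divide_neg_pos)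
  have gpc: "\<phi> (of_nat p) = (1 / real p) powr c"
    using gp0 p1 by (simp add: powr_def c_def ln_div)
  have int: "\<phi> (of_int a) = padic_abs p (of_int a) powr c" for a
  proof (cases "a = 0")
    case False
    have "\<not> is_unit (int p)" using p1 by (simp add: zdvd1_eq)
    from multiplicity_decompose'[OF False this]
    obtain m where m: "a = int p ^ multiplicity (int p) a * m" "\<not> int p dvd m" by blast
    have "\<phi> (of_int a) = \<phi> (of_nat p ^ multiplicity (int p) a * of_int m)"
      by (subst m(1)) simp
    also have "\<dots> = \<phi> (of_nat p) ^ multiplicity (int p) a"
      using unit[OF m(2)]
      by (simp add: av_mult[OF k \<phi>] av_power[OF k \<phi>] subfield_of_int[OF k] subfield_power[OF k] subfield_of_nat[OF k])
    also have "\<dots> = padic_abs p (of_int a) powr c"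
      by (simp add: padic_abs_of_int[OF pr False] gpc powr_power_comm)
    finally show ?thesis .
  qed (simp add: av_0[OF k \<phi>] padic_abs_0[OF pr])
  have "\<phi> (of_rat r) = padic_abs p r powr c" for r
  proof -
    obtain a b where q: "r = of_int a / of_int b" "b \<noteq> 0"
      using rat_int_quotient by metis
    then have "of_int b * r = of_int a" by simp
    from arg_cong[OF this, of "padic_abs p"] have "padic_abs p (of_int b) * padic_abs p r = padic_abs p (of_int a)"
      by (simp add: padic_abs_mult[OF pr])
    then have pr': "padic_abs p r = padic_abs p (of_int a) / padic_abs p (of_int b)"
      using q(2) padic_abs_eq_0_iff[OF pr, of "of_int b"] by (simp add: nonzero_eq_divide_eq mult.commute)
    have "\<phi> (of_rat r) = \<phi> (of_int a) / \<phi> (of_int b)"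
      using q by (simp add: of_rat_divide av_divide[OF k \<phi>] subfield_of_int[OF k])
    then show ?thesis
      by (simp add: int pr' powr_divide padic_abs_nonneg)
  qed
  then show ?thesis using pr c by blast
qed

text \<open>The second case keeps the bound on the natural numbers, from which the ultrametric
  inequality on all of \<open>k\<close> follows.\<close>

lemma ostrowski:
  "(\<exists>c>0. \<forall>r. \<phi> (of_rat r) = \<bar>of_rat r\<bar> powr c) \<or>
   (\<exists>p c. Factorial_Ring.prime p \<and> c > 0 \<and> (\<forall>n::nat. \<phi> (of_nat n) \<le> 1) \<and> (\<forall>r. \<phi> (of_rat r) = padic_abs p r powr c))"
proof (cases "\<forall>n::nat. \<phi> (of_nat n) \<le> 1")
  case True
  then show ?thesis using ostrowski_nonarchimedean by blast
next
  case False
  then obtain n0 :: nat where n0: "\<phi> (of_nat n0) > 1" by (auto simp: not_le)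
  have "\<exists>c>0. \<forall>n. \<phi> (of_nat n) = real n powr c"
  proof (rule ostrowski_archimedean[where g = "\<lambda>n. \<phi> (of_nat n)"])
    show "\<phi> (of_nat (m * n)) = \<phi> (of_nat m) * \<phi> (of_nat n)"
      "\<phi> (of_nat (m + n)) \<le> \<phi> (of_nat m) + \<phi> (of_nat n)" for m n
      by (simp_all add: av_mult[OF k \<phi>] av_add[OF k \<phi>] subfield_of_nat[OF k])
    show "\<phi> (of_nat n) > 0" if "n > 0" for n
      using that by (intro av_pos[OF k \<phi>] subfield_of_nat[OF k]) simp
  qed (use n0 av_of_nat_le[OF k \<phi>] in \<open>auto simp: av_0[OF k \<phi>] av_1[OF k \<phi>]\<close>)
  then obtain c where c: "c > 0" "\<And>n. \<phi> (of_nat n) = real n powr c" by blast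
  have "\<phi> (of_rat r) = \<bar>of_rat r\<bar> powr c" for r
  proof -
    obtain a b where q: "r = of_int a / of_int b" "b \<noteq> 0"
      using rat_int_quotient by metis
    have "\<phi> (of_rat r) = \<phi> (of_int a) / \<phi> (of_int b)"
      using q by (simp add: of_rat_divide av_divide[OF k \<phi>] subfield_of_int[OF k])
    also have "\<dots> = \<bar>real_of_int a\<bar> powr c / \<bar>real_of_int b\<bar> powr c"
      unfolding av_of_int[OF k \<phi>] c(2) by simp
    also have "\<dots> = \<bar>of_rat r\<bar> powr c"
      unfolding q(1) by (simp add: of_rat_divide powr_divide)
    finally show ?thesis .
  qed
  with c(1) show ?thesis by blast
qed

end


section \<open>Normalised absolute values and places\<close>

lemma normalised_cases:
  assumes "normalised \<phi>"
  obtains (archimedean) "\<And>r. \<phi> (of_rat r) = \<bar>of_rat r\<bar>"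
    | (padic) p where "Factorial_Ring.prime p" "\<And>r. \<phi> (of_rat r) = padic_abs p r"
  using assms unfolding normalised_def by blast

definition normalised_avs :: "qbar set \<Rightarrow> (qbar \<Rightarrow> real) set"
  where "normalised_avs k = {\<phi> \<in> absolute_values k. normalised \<phi>}"

context
  fixes k assumes k: "is_subfield k"
begin

text \<open>The triangle inequality is the one property that a power of \<phi> may lose; hence it
  appears as a hypothesis.\<close>

lemma absolute_value_powr:
  assumes \<phi>: "\<phi> \<in> absolute_values k" and c: "c > 0"
    and tri: "\<And>x y. x \<in> k \<Longrightarrow> y \<in> k \<Longrightarrow> \<phi> (x + y) powr c \<le> \<phi> x powr c + \<phi> y powr c"
  shows "(\<lambda>x\<in>k. \<phi> x powr c) \<in> absolute_values k" "(\<phi>, \<lambda>x\<in>k. \<phi> x powr c) \<in> place_rel k"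
proof -
  obtain x where x: "x \<in> k" "x \<noteq> 0" "\<phi> x \<noteq> 1" using av_nontrivial[OF k \<phi>] by blast
  have "\<phi> x powr c \<noteq> 1"
    using av_pos[OF k \<phi> x(1,2)] x(3) c by (auto simp: powr_def)
  then show *: "(\<lambda>x\<in>k. \<phi> x powr c) \<in> absolute_values k"
    using x(1,2) tri av_nonneg[OF k \<phi>] av_eq_0_iff[OF k \<phi>]
    by (auto simp: absolute_values_def av_mult[OF k \<phi>] powr_mult subfield_mult[OF k] subfield_add[OF k] intro!: bexI[of _ x])
  show "(\<phi>, \<lambda>x\<in>k. \<phi> x powr c) \<in> place_rel k"
    using * \<phi> c by (auto simp: place_rel_def)
qed

text \<open>Take the c-th root, with c from Ostrowski's theorem. In the p-adic case the ultrametric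
  inequality survives every power; in the archimedean case the triangle inequality has to be
  regained from the values at binomial coefficients.\<close>

lemma normalise:
  assumes \<phi>: "\<phi> \<in> absolute_values k"
  shows "\<exists>\<psi>\<in>normalised_avs k. (\<phi>, \<psi>) \<in> place_rel k"
  using ostrowski[OF k \<phi>]
proof (elim disjE exE conjE)
  fix c :: real assume c: "c > 0" and arch: "\<forall>r. \<phi> (of_rat r) = \<bar>of_rat r\<bar> powr c"
  have nat: "\<phi> (of_nat n) = real n powr c" for n
    using spec[OF arch, of "of_nat n"] by simp
  let ?\<psi> = "\<lambda>x\<in>k. \<phi> x powr (1 / c)"
  have "\<phi> (x + y) powr (1 / c) \<le> \<phi> x powr (1 / c) + \<phi> y powr (1 / c)" if x: "x \<in> k" and y: "y \<in> k" for x y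
  proof -
    \<comment> \<open>The claim becomes \<phi> (x + y) \<le> (u + w)^c. As \<phi> n = n^c for
      natural n, each term of the binomial bound for \<phi> is the c-th power of a term of the
      expansion of (u + w)^n.\<close>
    define u w where "u = \<phi> x powr (1 / c)" and "w = \<phi> y powr (1 / c)"
    have uw: "u \<ge> 0" "w \<ge> 0" by (simp_all add: u_def w_def)
    have xu: "\<phi> x = u powr c" "\<phi> y = w powr c"
      using c av_nonneg[OF k \<phi> x] av_nonneg[OF k \<phi> y] by (simp_all add: u_def w_def powr_powr)
    have "\<phi> (x + y) \<le> (u + w) powr c"
    proof (rule power_growth_le[where A = 1 and B = 1])
      fix n
      have "\<phi> (x + y) ^ n \<le> (\<Sum>i\<le>n. \<phi> (of_nat (n choose i)) * \<phi> x ^ i * \<phi> y ^ (n - i))"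
        by (rule av_binomial[OF k \<phi> x y])
      also have "\<dots> \<le> (\<Sum>i\<le>n. ((u + w) ^ n) powr c)"
      proof (rule sum_mono)
        fix i assume i: "i \<in> {..n}"
        have "\<phi> (of_nat (n choose i)) * \<phi> x ^ i * \<phi> y ^ (n - i) = (real (n choose i) * u ^ i * w ^ (n - i)) powr c"
          using uw by (simp add: nat xu powr_mult powr_power_comm)
        also have "\<dots> \<le> ((u + w) ^ n) powr c"
        proof (rule powr_mono2)
          have "real (n choose i) * u ^ i * w ^ (n - i) \<le> (\<Sum>i\<le>n. real (n choose i) * u ^ i * w ^ (n - i))"
            using uw i by (intro member_le_sum) auto
          then show "real (n choose i) * u ^ i * w ^ (n - i) \<le> (u + w) ^ n"
            by (simp add: binomial_ring)
        qed (use c uw in auto)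
        finally show "\<phi> (of_nat (n choose i)) * \<phi> x ^ i * \<phi> y ^ (n - i) \<le> ((u + w) ^ n) powr c" .
      qed
      also have "\<dots> = (1 * real n + 1) * ((u + w) powr c) ^ n"
        using uw by (simp add: powr_power_comm)
      finally show "\<phi> (x + y) ^ n \<le> (1 * real n + 1) * ((u + w) powr c) ^ n" .
    qed simp
    then have "\<phi> (x + y) powr (1 / c) \<le> ((u + w) powr c) powr (1 / c)"
      using c av_nonneg[OF k \<phi> subfield_add[OF k x y]] by (intro powr_mono2) auto
    then show ?thesis using c uw by (simp add: powr_powr u_def w_def)
  qed
  from absolute_value_powr[OF \<phi> _ this] c have "?\<psi> \<in> absolute_values k" "(\<phi>, ?\<psi>) \<in> place_rel k"
    by auto
  moreover have "normalised ?\<psi>"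
    unfolding normalised_def using c by (auto simp: subfield_of_rat[OF k] arch powr_powr)
  ultimately show ?thesis by (auto simp: normalised_avs_def)
next
  fix p c assume p: "Factorial_Ring.prime p" and c: "c > 0" and na: "\<forall>n::nat. \<phi> (of_nat n) \<le> 1"
    and rat: "\<forall>r. \<phi> (of_rat r) = padic_abs p r powr c"
  let ?\<psi> = "\<lambda>x\<in>k. \<phi> x powr (1 / c)"
  have "\<phi> (x + y) powr (1 / c) \<le> \<phi> x powr (1 / c) + \<phi> y powr (1 / c)" if x: "x \<in> k" and y: "y \<in> k" for x y
  proof -
    have "\<phi> (x + y) \<le> max (\<phi> x) (\<phi> y)"
      using na by (intro av_ultrametric[OF k \<phi> _ x y]) auto
    then have "\<phi> (x + y) powr (1 / c) \<le> max (\<phi> x) (\<phi> y) powr (1 / c)"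
      using c av_nonneg[OF k \<phi> subfield_add[OF k x y]] by (intro powr_mono2) auto
    also have "\<dots> \<le> \<phi> x powr (1 / c) + \<phi> y powr (1 / c)"
      by (simp add: max_def)
    finally show ?thesis .
  qed
  from absolute_value_powr[OF \<phi> _ this] c have "?\<psi> \<in> absolute_values k" "(\<phi>, ?\<psi>) \<in> place_rel k"
    by auto
  moreover have "normalised ?\<psi>"
    unfolding normalised_def using c p by (auto simp: subfield_of_rat[OF k] rat powr_powr padic_abs_nonneg intro!: exI[of _ p])
  ultimately show ?thesis by (auto simp: normalised_avs_def)
qed

text \<open>The exponent between the two is read off at the number 2 if \<phi> is archimedean, and
  at \<open>p\<close> if it is p-adic. The size of the value there also tells of which type \<psi>
  is.\<close>

lemma normalised_unique:
  assumes \<phi>: "\<phi> \<in> normalised_avs k" and \<psi>: "\<psi> \<in> normalised_avs k" and rel: "(\<phi>, \<psi>) \<in> place_rel k"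
  shows "\<phi> = \<psi>"
proof -
  have av: "\<phi> \<in> absolute_values k" "\<psi> \<in> absolute_values k" and n: "normalised \<phi>" "normalised \<psi>"
    using \<phi> \<psi> by (auto simp: normalised_avs_def)
  obtain c where c: "c > 0" "\<And>x. x \<in> k \<Longrightarrow> \<psi> x = \<phi> x powr c"
    using rel by (auto simp: place_rel_def)
  have rat: "\<psi> (of_rat r) = \<phi> (of_rat r) powr c" for r
    using c(2) subfield_of_rat[OF k] by blast
  have "c = 1"
    using n(1)
  proof (cases rule: normalised_cases)
    case archimedean
    have two: "\<psi> (of_rat 2) = 2 powr c" using rat[of 2] archimedean[of 2] by simp
    show ?thesis
      using n(2)
    proof (cases rule: normalised_cases)
      case archimedean
      then have "2 powr c = (2::real) powr 1" using two archimedean[of 2] by simp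
      then show ?thesis by (subst (asm) powr_inj) auto
    next
      case (padic p)
      have "\<psi> (of_rat 2) \<le> 1"
        using padic_abs_of_int_le_1[OF padic(1), of 2] padic(2)[of 2] by simp
      moreover have "(2::real) powr c > 1" using c(1) by simp
      ultimately show ?thesis using two by simp
    qed
  next
    case (padic p)
    have p1: "real p > 1" using prime_gt_1_nat[OF padic(1)] by simp
    have \<psi>p: "\<psi> (of_rat (of_nat p)) = (1 / real p) powr c"
      using rat[of "of_nat p"] padic(2)[of "of_nat p"] padic_abs_self[OF padic(1)] by simp
    have "(1 / real p) powr c < 1"
      using c(1) p1 by (simp add: powr_divide)
    show ?thesis
      using n(2)
    proof (cases rule: normalised_cases)
      case archimedean
      then have "\<psi> (of_rat (of_nat p)) = real p" using archimedean[of "of_nat p"] by simp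
      then show ?thesis using \<psi>p \<open>(1 / real p) powr c < 1\<close> p1 by simp
    next
      case (padic q)
      then have "padic_abs q (of_int (int p)) \<noteq> 1"
        using \<psi>p \<open>(1 / real p) powr c < 1\<close> padic(2)[of "of_nat p"] by simp
      then have "q dvd p"
        using padic_abs_of_int_eq_1_iff[OF padic(1), of "int p"] by simp
      then have "q = p"
        using \<open>Factorial_Ring.prime p\<close> padic(1) by (simp add: primes_dvd_imp_eq)
      then have "(1 / real p) powr c = (1 / real p) powr 1"
        using \<psi>p padic(2)[of "of_nat p"] padic_abs_self[OF padic(1)] p1 by simp
      then show ?thesis using p1 by (subst (asm) powr_inj) auto
    qed
  qed
  then have "\<psi> x = \<phi> x" if "x \<in> k" for x
    using c(2)[OF that] av_nonneg[OF k av(1) that] by simp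
  then show ?thesis
    using av_extensional[OF k av(1)] av_extensional[OF k av(2)] by (metis extensionalityI)
qed

lemma equiv_place_rel: "equiv (absolute_values k) (place_rel k)"
proof (rule equivI)
  show "place_rel k \<subseteq> absolute_values k \<times> absolute_values k" by (auto simp: place_rel_def)
  show "refl_on (absolute_values k) (place_rel k)"
    by (auto simp: refl_on_def place_rel_def av_nonneg[OF k] intro!: exI[of _ 1])
  show "sym (place_rel k)"
  proof (rule symI)
    fix \<phi> \<psi> assume "(\<phi>, \<psi>) \<in> place_rel k"
    then obtain c where c: "c > 0" "\<And>x. x \<in> k \<Longrightarrow> \<psi> x = \<phi> x powr c"
      and av: "\<phi> \<in> absolute_values k" "\<psi> \<in> absolute_values k" by (auto simp: place_rel_def)
    then have "\<forall>x\<in>k. \<phi> x = \<psi> x powr (1 / c)" "1 / c > 0"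
      by (auto simp: powr_powr av_nonneg[OF k])
    then show "(\<psi>, \<phi>) \<in> place_rel k" using av unfolding place_rel_def by blast
  qed
  show "trans (place_rel k)"
  proof (rule transI)
    fix \<phi> \<psi> \<rho> assume "(\<phi>, \<psi>) \<in> place_rel k" "(\<psi>, \<rho>) \<in> place_rel k"
    then obtain c d where "c > 0" "\<And>x. x \<in> k \<Longrightarrow> \<psi> x = \<phi> x powr c" "d > 0" "\<And>x. x \<in> k \<Longrightarrow> \<rho> x = \<psi> x powr d"
      and av: "\<phi> \<in> absolute_values k" "\<rho> \<in> absolute_values k" by (auto simp: place_rel_def)
    then have "\<forall>x\<in>k. \<rho> x = \<phi> x powr (c * d)" "c * d > 0"
      by (auto simp: powr_powr)
    then show "(\<phi>, \<rho>) \<in> place_rel k" using av unfolding place_rel_def by blast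
  qed
qed

text \<open>Uniqueness makes the description in \<open>norm_at\<close> definite. From here on a
  place is handled through its normalised absolute value.\<close>

lemma norm_at_eqI:
  assumes \<phi>: "\<phi> \<in> normalised_avs k"
  shows "norm_at (place_rel k `` {\<phi>}) = \<phi>"
  unfolding norm_at_def
proof (rule the_equality)
  have "\<phi> \<in> absolute_values k" using \<phi> by (simp add: normalised_avs_def)
  then show "\<phi> \<in> place_rel k `` {\<phi>} \<and> normalised \<phi>"
    using \<phi> equiv_class_self[OF equiv_place_rel] by (simp add: normalised_avs_def)
next
  fix \<psi> assume "\<psi> \<in> place_rel k `` {\<phi>} \<and> normalised \<psi>"
  then have "(\<phi>, \<psi>) \<in> place_rel k" "\<psi> \<in> normalised_avs k"
    by (auto simp: normalised_avs_def place_rel_def)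
  then show "\<psi> = \<phi>" using normalised_unique[OF \<phi>] by blast
qed

lemma place_of_norm_at:
  assumes "v \<in> places k"
  shows "norm_at v \<in> normalised_avs k" "place_rel k `` {norm_at v} = v"
proof -
  obtain \<phi> where \<phi>: "\<phi> \<in> absolute_values k" "v = place_rel k `` {\<phi>}"
    using assms by (auto simp: places_def elim: quotientE)
  obtain \<psi> where \<psi>: "\<psi> \<in> normalised_avs k" "(\<phi>, \<psi>) \<in> place_rel k"
    using normalise[OF \<phi>(1)] by blast
  then have "v = place_rel k `` {\<psi>}"
    using \<phi>(2) equiv_class_eq[OF equiv_place_rel] by blast
  then show "norm_at v \<in> normalised_avs k" "place_rel k `` {norm_at v} = v"
    using norm_at_eqI[OF \<psi>(1)] \<psi>(1) by auto
qed

lemma norm_at_absolute_value: "v \<in> places k \<Longrightarrow> norm_at v \<in> absolute_values k"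
  using place_of_norm_at(1) by (simp add: normalised_avs_def)

lemma place_of_normalised: "\<phi> \<in> normalised_avs k \<Longrightarrow> place_rel k `` {\<phi>} \<in> places k"
  unfolding places_def by (rule quotientI) (simp add: normalised_avs_def)

lemma norm_at_inj: "v \<in> places k \<Longrightarrow> w \<in> places k \<Longrightarrow> norm_at v = norm_at w \<Longrightarrow> v = w"
  using place_of_norm_at(2) by metis

end

text \<open>The point is nontriviality, which restriction could destroy: a normalised absolute value
  is nontrivial already at the rational number 2 or \<open>p\<close>.\<close>

lemma normalised_avs_restrict:
  assumes k: "is_subfield k" and l: "is_subfield l" and kl: "k \<subseteq> l" and \<phi>: "\<phi> \<in> normalised_avs l"
  shows "restrict \<phi> k \<in> normalised_avs k"
proof -
  have av: "\<phi> \<in> absolute_values l" and n: "normalised \<phi>" using \<phi> by (auto simp: normalised_avs_def)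
  have n': "normalised (restrict \<phi> k)"
    using n by (simp add: normalised_def subfield_of_rat[OF k])
  obtain r where r: "r \<noteq> 0" "\<phi> (of_rat r) \<noteq> 1"
    using n
  proof (cases rule: normalised_cases)
    case archimedean
    then show ?thesis using that[of 2] archimedean[of 2] by simp
  next
    case (padic p)
    then show ?thesis
      using that[of "of_nat p"] padic(2)[of "of_nat p"] padic_abs_self[OF padic(1)] prime_gt_1_nat[OF padic(1)] by simp
  qed
  then have "\<exists>x\<in>k. x \<noteq> 0 \<and> restrict \<phi> k x \<noteq> 1"
    by (intro bexI[of _ "of_rat r"]) (auto simp: subfield_of_rat[OF k])
  then have "restrict \<phi> k \<in> absolute_values k"
    using av_nonneg[OF l av] av_eq_0_iff[OF l av] av_mult[OF l av] av_add[OF l av] kl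
    by (auto simp: absolute_values_def subfield_mult[OF k] subfield_add[OF k] subset_iff)
  with n' show ?thesis by (simp add: normalised_avs_def)
qed

text \<open>By definition the left side is a union of classes, one for each member of
  \<open>y\<close>. Equivalent members have equivalent nontrivial restrictions, so the union
  consists of a single class.\<close>

lemma place_below_eq:
  assumes k: "is_subfield k" and l: "is_subfield l" and kl: "k \<subseteq> l" and y: "y \<in> places l"
  shows "place_below k y = place_rel k `` {restrict (norm_at y) k}"
proof -
  define \<phi> where "\<phi> = norm_at y"
  have \<phi>: "\<phi> \<in> normalised_avs l" and y': "y = place_rel l `` {\<phi>}"
    using place_of_norm_at[OF l y] by (auto simp: \<phi>_def)
  have \<phi>k: "restrict \<phi> k \<in> absolute_values k"
    using normalised_avs_restrict[OF k l kl \<phi>] by (simp add: normalised_avs_def)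
  have "(restrict \<phi> k, restrict \<psi> k) \<in> place_rel k" if "(\<phi>, \<psi>) \<in> place_rel l" for \<psi>
  proof -
    from that obtain c where c: "c > 0" "\<And>x. x \<in> l \<Longrightarrow> \<psi> x = \<phi> x powr c" and av: "\<psi> \<in> absolute_values l"
      by (auto simp: place_rel_def)
    obtain x where x: "x \<in> k" "x \<noteq> 0" "restrict \<phi> k x \<noteq> 1" using av_nontrivial[OF k \<phi>k] by blast
    have "restrict \<psi> k x \<noteq> 1"
      using x c(2)[of x] av_pos[OF k \<phi>k x(1,2)] c(1) kl by (auto simp: powr_def)
    then have "restrict \<psi> k \<in> absolute_values k"
      using x(1,2) av_nonneg[OF l av] av_eq_0_iff[OF l av] av_mult[OF l av] av_add[OF l av] kl
      by (auto simp: absolute_values_def subfield_mult[OF k] subfield_add[OF k] subset_iff)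
    then show ?thesis
      using \<phi>k c kl by (auto simp: place_rel_def)
  qed
  then have cls: "place_rel k `` {restrict \<psi> k} = place_rel k `` {restrict \<phi> k}" if "\<psi> \<in> y" for \<psi>
    using equiv_class_eq[OF equiv_place_rel[OF k]] that y' by blast
  have "\<phi> \<in> y"
    using equiv_class_self[OF equiv_place_rel[OF l]] \<phi> by (simp add: y' normalised_avs_def)
  have "place_below k y = (\<Union>\<psi>\<in>y. place_rel k `` {restrict \<psi> k})"
    by (auto simp: place_below_def)
  also have "\<dots> = place_rel k `` {restrict \<phi> k}"
    using cls \<open>\<phi> \<in> y\<close> by blast
  finally show ?thesis by (simp add: \<phi>_def)
qed

lemma place_below:
  assumes k: "is_subfield k" and l: "is_subfield l" and kl: "k \<subseteq> l" and y: "y \<in> places l"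
  shows "place_below k y \<in> places k" "norm_at (place_below k y) = restrict (norm_at y) k"
proof -
  have "restrict (norm_at y) k \<in> normalised_avs k"
    using normalised_avs_restrict[OF k l kl] place_of_norm_at(1)[OF l y] by blast
  then show "place_below k y \<in> places k" "norm_at (place_below k y) = restrict (norm_at y) k"
    unfolding place_below_eq[OF assms] by (simp_all add: place_of_normalised[OF k] norm_at_eqI[OF k])
qed

lemma place_below_trans:
  assumes "is_subfield k" "is_subfield l" "is_subfield m" "k \<subseteq> l" "l \<subseteq> m" "y \<in> places m"
  shows "place_below k (place_below l y) = place_below k y"
proof (rule norm_at_inj[OF assms(1)])
  have km: "k \<subseteq> m" using assms by blast
  note pb = place_below[OF assms(2,3,5,6)] place_below[OF assms(1,3) km assms(6)]
  note pb' = place_below[OF assms(1,2,4) pb(1)]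
  show "place_below k (place_below l y) \<in> places k" "place_below k y \<in> places k"
    using pb pb' by auto
  show "norm_at (place_below k (place_below l y)) = norm_at (place_below k y)"
    using pb pb' assms(4) by (auto simp: restrict_def fun_eq_iff)
qed

section \<open>The Galois action on places\<close>

lemma absolute_values_comp:
  assumes \<phi>: "\<phi> \<in> absolute_values UNIV" and \<sigma>: "\<sigma> \<in> abs_galois \<rat>"
  shows "\<phi> \<circ> \<sigma> \<in> absolute_values UNIV"
proof -
  obtain x where x: "x \<noteq> 0" "\<phi> x \<noteq> 1" using av_nontrivial[OF is_subfield_UNIV \<phi>] by blast
  have "inv_into UNIV \<sigma> x \<noteq> 0" "\<phi> (\<sigma> (inv_into UNIV \<sigma> x)) \<noteq> 1"
    using x by (auto simp: inv_abs_galois_right[OF \<sigma>] abs_galois_eq_0_iff[OF abs_galois_inv[OF \<sigma>]])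
  then show ?thesis
    using \<phi> by (auto simp: absolute_values_def abs_galois_add[OF \<sigma>] abs_galois_mult[OF \<sigma>] abs_galois_eq_0_iff[OF \<sigma>])
qed

lemma act_place:
  assumes \<tau>: "\<tau> \<in> abs_galois \<rat>" and y: "y \<in> \<Y>"
  shows "act \<tau> y \<in> \<Y>" "norm_at (act \<tau> y) = norm_at y \<circ> inv_into UNIV \<tau>"
proof -
  define \<phi> \<sigma> where "\<phi> = norm_at y" and "\<sigma> = inv_into UNIV \<tau>"
  have \<sigma>: "\<sigma> \<in> abs_galois \<rat>" unfolding \<sigma>_def by (rule abs_galois_inv[OF \<tau>])
  have \<phi>: "\<phi> \<in> normalised_avs UNIV" and y': "y = place_rel UNIV `` {\<phi>}"
    using place_of_norm_at[OF is_subfield_UNIV y] by (auto simp: \<phi>_def)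
  have av: "\<phi> \<in> absolute_values UNIV" using \<phi> by (simp add: normalised_avs_def)
  have \<phi>\<sigma>: "\<phi> \<circ> \<sigma> \<in> normalised_avs UNIV"
    using \<phi> absolute_values_comp[OF av \<sigma>] by (simp add: normalised_avs_def normalised_def abs_galois_fix[OF \<sigma>])
  have "act \<tau> y = place_rel UNIV `` {\<phi> \<circ> \<sigma>}"
  proof
    show "act \<tau> y \<subseteq> place_rel UNIV `` {\<phi> \<circ> \<sigma>}"
      using absolute_values_comp[OF _ \<sigma>] by (auto simp: act_def y' place_rel_def \<sigma>_def)
    show "place_rel UNIV `` {\<phi> \<circ> \<sigma>} \<subseteq> act \<tau> y"
    proof
      fix \<psi> assume "\<psi> \<in> place_rel UNIV `` {\<phi> \<circ> \<sigma>}"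
      then obtain c where c: "c > 0" "\<And>x. \<psi> x = \<phi> (\<sigma> x) powr c" and \<psi>: "\<psi> \<in> absolute_values UNIV"
        by (auto simp: place_rel_def)
      have "\<psi> \<circ> \<tau> \<in> place_rel UNIV `` {\<phi>}"
        using c absolute_values_comp[OF \<psi> \<tau>] av by (auto simp: place_rel_def \<sigma>_def inv_abs_galois_left[OF \<tau>])
      moreover have "\<psi> = (\<psi> \<circ> \<tau>) \<circ> inv_into UNIV \<tau>"
        by (simp add: fun_eq_iff inv_abs_galois_right[OF \<tau>])
      ultimately show "\<psi> \<in> act \<tau> y" unfolding act_def y' by (intro image_eqI)
    qed
  qed
  then show "act \<tau> y \<in> \<Y>" "norm_at (act \<tau> y) = norm_at y \<circ> inv_into UNIV \<tau>"
    using \<phi>\<sigma> by (simp_all add: place_of_normalised[OF is_subfield_UNIV] norm_at_eqI[OF is_subfield_UNIV]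
      flip: \<phi>_def \<sigma>_def)
qed

lemma act_inv_place:
  assumes \<tau>: "\<tau> \<in> abs_galois \<rat>" and y: "y \<in> \<Y>"
  shows "act (inv_into UNIV \<tau>) y \<in> \<Y>" "norm_at (act (inv_into UNIV \<tau>) y) = norm_at y \<circ> \<tau>"
    "act \<tau> (act (inv_into UNIV \<tau>) y) = y"
proof -
  note 1 = act_place[OF abs_galois_inv[OF \<tau>] y]
  show *: "act (inv_into UNIV \<tau>) y \<in> \<Y>" "norm_at (act (inv_into UNIV \<tau>) y) = norm_at y \<circ> \<tau>"
    using 1 by (simp_all add: inv_inv_abs_galois[OF \<tau>])
  note 2 = act_place[OF \<tau> *(1)]
  show "act \<tau> (act (inv_into UNIV \<tau>) y) = y"
    by (rule norm_at_inj[OF is_subfield_UNIV 2(1) y]) (simp add: 2(2) *(2) fun_eq_iff inv_abs_galois_right[OF \<tau>])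
qed


section \<open>The functions \<open>f\<^sub>\<alpha>\<close>\<close>

text \<open>The function of the class of \<open>a\<close>, indexed by the representative itself, so
  that calculations take place in the multiplicative group of the algebraic closure.\<close>

definition lognorm :: "qbar \<Rightarrow> place \<Rightarrow> real"
  where "lognorm a = (\<lambda>y. if y \<in> \<Y> then ln (norm_at y a) else 0)"

lemmas norm_at_UNIV = norm_at_absolute_value[OF is_subfield_UNIV]
  and norm_at_pos = av_pos[OF is_subfield_UNIV norm_at_absolute_value[OF is_subfield_UNIV] UNIV_I]
  and norm_at_inverse = av_inverse[OF is_subfield_UNIV norm_at_absolute_value[OF is_subfield_UNIV] UNIV_I]
  and norm_at_power = av_power[OF is_subfield_UNIV norm_at_absolute_value[OF is_subfield_UNIV] UNIV_I]

text \<open>Representatives of one class differ by a root of unity, which has absolute value 1 at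
  every place; so the image in \<open>log_norm\<close> is a singleton.\<close>

lemma log_norm_class:
  assumes a: "a \<noteq> 0"
  shows "log_norm (torsion_rel `` {a}) = lognorm a"
proof
  fix y
  show "log_norm (torsion_rel `` {a}) y = lognorm a y"
  proof (cases "y \<in> \<Y>")
    case True
    note av = norm_at_UNIV[OF True]
    have eq: "norm_at y b = norm_at y a" if "(a, b) \<in> torsion_rel" for b
    proof -
      from that obtain n where n: "n > 0" "(a / b) ^ n = 1" "b \<noteq> 0" by (auto simp: torsion_rel_def)
      have "norm_at y (a / b) ^ n = 1"
        unfolding av_power[OF is_subfield_UNIV av UNIV_I, symmetric] n(2) by (rule av_1[OF is_subfield_UNIV av])
      then have "norm_at y (a / b) = 1"
        using n(1) av_nonneg[OF is_subfield_UNIV av UNIV_I] power_eq_imp_eq_base[of "norm_at y (a / b)" n 1] by simp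
      then show ?thesis
        using n(3) av_pos[OF is_subfield_UNIV av, of b] by (simp add: av_divide[OF is_subfield_UNIV av])
    qed
    have "(a, a) \<in> torsion_rel" using a by (auto simp: torsion_rel_def intro: exI[of _ 1])
    then have "torsion_rel `` {a} \<noteq> {}" by blast
    have "(\<lambda>a. ln (norm_at y a)) ` (torsion_rel `` {a}) = (\<lambda>b. ln (norm_at y a)) ` (torsion_rel `` {a})"
      by (rule image_cong) (simp_all add: eq)
    also have "\<dots> = {ln (norm_at y a)}"
      using \<open>torsion_rel `` {a} \<noteq> {}\<close> by (simp only: image_constant_conv if_False)
    finally have "(\<lambda>a. ln (norm_at y a)) ` (torsion_rel `` {a}) = {ln (norm_at y a)}" .
    then show ?thesis using True by (simp add: log_norm_def lognorm_def)
  qed (simp add: log_norm_def lognorm_def)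
qed

lemma \<F>_eq: "\<F> = lognorm ` (UNIV - {0})"
proof -
  have *: "\<G> = (\<lambda>a. torsion_rel `` {a}) ` (UNIV - {0})"
    by (auto simp: \<G>_def quotient_def)
  show ?thesis
    unfolding \<F>_def * image_image by (rule image_cong) (simp_all add: log_norm_class)
qed

lemma \<F>_cases:
  assumes "F \<in> \<F>"
  obtains a where "a \<noteq> 0" "F = lognorm a"
  using assms by (auto simp: \<F>_eq)

lemma lognorm_in_\<F>: "a \<noteq> 0 \<Longrightarrow> lognorm a \<in> \<F>"
  by (simp add: \<F>_eq)

lemma lognorm_mult: "a \<noteq> 0 \<Longrightarrow> b \<noteq> 0 \<Longrightarrow> lognorm (a * b) = lognorm a + lognorm b"
proof
  fix y assume "a \<noteq> 0" "b \<noteq> 0"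
  then have "0 < norm_at y a" "0 < norm_at y b" if "y \<in> \<Y>"
    using av_pos[OF is_subfield_UNIV norm_at_UNIV[OF that]] by auto
  then show "lognorm (a * b) y = (lognorm a + lognorm b) y"
    by (auto simp: lognorm_def av_mult[OF is_subfield_UNIV norm_at_UNIV] ln_mult_pos)
qed

lemma lognorm_1: "lognorm 1 = 0"
  by (auto simp: lognorm_def fun_eq_iff av_1[OF is_subfield_UNIV norm_at_UNIV])

lemma lognorm_inverse: "a \<noteq> 0 \<Longrightarrow> lognorm (inverse a) = - lognorm a"
  using lognorm_mult[of a "inverse a"] by (simp add: lognorm_1 eq_neg_iff_add_eq_0 add.commute)

lemma lognorm_prod: "(\<And>i. i \<in> I \<Longrightarrow> f i \<noteq> 0) \<Longrightarrow> lognorm (prod f I) = (\<Sum>i\<in>I. lognorm (f i))"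
  by (induction I rule: infinite_finite_induct) (auto simp: lognorm_1 lognorm_mult)

lemma lognorm_power: "a \<noteq> 0 \<Longrightarrow> lognorm (a ^ n) = (\<lambda>y. real n * lognorm a y)"
  by (induction n) (auto simp: lognorm_1 lognorm_mult fun_eq_iff algebra_simps)

text \<open>The algebraic closure contains n-th roots, which makes \<F> divisible and thus a
  rational vector space.\<close>

lemma lognorm_root:
  assumes a: "a \<noteq> 0" and n: "n > 0"
  shows "\<exists>b. b \<noteq> 0 \<and> lognorm b = (\<lambda>y. lognorm a y / real n)"
proof -
  obtain b where b: "b ^ n = a" using nth_root_exists[OF n] by blast
  then have "b \<noteq> 0" using a n by auto
  moreover from this have "lognorm b = (\<lambda>y. lognorm a y / real n)"
    using lognorm_power[of b n] n unfolding b by (simp add: fun_eq_iff)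
  ultimately show ?thesis by blast
qed

lemma \<F>_0: "0 \<in> \<F>"
  using lognorm_in_\<F>[of 1] by (simp add: lognorm_1)

lemma \<F>_add: "F \<in> \<F> \<Longrightarrow> H \<in> \<F> \<Longrightarrow> F + H \<in> \<F>"
  by (elim \<F>_cases) (simp add: lognorm_mult[symmetric] lognorm_in_\<F>)

lemma \<F>_uminus: "F \<in> \<F> \<Longrightarrow> - F \<in> \<F>"
  by (elim \<F>_cases) (simp add: lognorm_inverse[symmetric] lognorm_in_\<F>)

lemma \<F>_diff: "F \<in> \<F> \<Longrightarrow> H \<in> \<F> \<Longrightarrow> F - H \<in> \<F>"
  using \<F>_add[OF _ \<F>_uminus, of F H] by simp

lemma \<F>_divide:
  assumes "F \<in> \<F>" and n: "n > 0"
  shows "(\<lambda>y. F y / real n) \<in> \<F>"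
proof -
  obtain a where "a \<noteq> 0" "F = lognorm a" using assms(1) by (auto simp: \<F>_eq)
  then show ?thesis using lognorm_root[OF _ n, of a] lognorm_in_\<F> by metis
qed

lemma \<F>_scale_nat: "F \<in> \<F> \<Longrightarrow> (\<lambda>y. real n * F y) \<in> \<F>"
proof -
  assume "F \<in> \<F>"
  then obtain a where "a \<noteq> 0" "F = lognorm a" by (auto simp: \<F>_eq)
  then show ?thesis using lognorm_power[of a n] lognorm_in_\<F>[of "a ^ n"] by simp
qed

lemma rat_scale_\<F>:
  assumes F: "F \<in> \<F>"
  shows "rat_scale r F \<in> \<F>"
proof -
  obtain a b where r: "r = of_int a / of_int b" "b \<noteq> 0" by (rule rat_int_quotient)
  define c n where "c = a * sgn b" and "n = nat \<bar>b\<bar>"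
  have n: "n > 0" using r by (simp add: n_def)
  have "(of_rat r :: real) = of_int a / of_int b"
    unfolding r(1) by (simp add: of_rat_divide)
  then have r': "(of_rat r :: real) = of_int c / real n"
    using r(2) by (simp add: c_def n_def sgn_if)
  have *: "(\<lambda>y. real m * F y / real n) \<in> \<F>" for m
    using \<F>_divide[OF \<F>_scale_nat[OF F] n] .
  show ?thesis
  proof (cases c rule: int_cases2)
    case (nonneg m)
    then show ?thesis using *[of m] by (simp add: rat_scale_def r')
  next
    case (nonpos m)
    then show ?thesis using \<F>_uminus[OF *[of m]] by (simp add: rat_scale_def r' fun_Compl_def)
  qed
qed

lemma lognorm_act:
  assumes "\<tau> \<in> abs_galois \<rat>" "y \<in> \<Y>"
  shows "lognorm a (act (inv_into UNIV \<tau>) y) = lognorm (\<tau> a) y"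
  using act_inv_place[OF assms] assms(2) by (simp add: lognorm_def)

lemma \<D>_eq: "is_subfield K \<Longrightarrow> \<D> K = module.span rat_scale (lognorm ` (K - {0}))"
  unfolding \<D>_def by (auto simp: image_image log_norm_class intro!: arg_cong[where f = "module.span rat_scale"] image_cong)

section \<open>Averaging over an absolute Galois group\<close>

lemma sum_funs_apply: "(\<Sum>i\<in>I. F i) y = (\<Sum>i\<in>I. F i y)"
  by (induction I rule: infinite_finite_induct) auto

lemma galois_extension_refl: "is_subfield K \<Longrightarrow> galois_extension K K"
  by (auto simp: galois_extension_def field_auts_fix)

lemma finite_dimension_refl: "is_subfield K \<Longrightarrow> ring.finite_dimension qbar_ring K K"
  using QB.finite_dimensionI[OF QB.dimension_one] by blast

lemma topspace_krull_topology:
  assumes K: "is_subfield K"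
  shows "topspace (krull_topology K) = abs_galois K"
proof -
  let ?S = "{(\<lambda>\<tau>. \<sigma> \<circ> \<tau>) ` abs_galois L | \<sigma> L. \<sigma> \<in> abs_galois K \<and>
      galois_extension L K \<and> ring.finite_dimension qbar_ring K L}"
  have "topspace (krull_topology K) = \<Union>?S"
    by (simp add: krull_topology_def)
  also have "\<dots> = abs_galois K"
  proof
    show "\<Union>?S \<subseteq> abs_galois K"
    proof clarify
      fix \<sigma> L \<tau> assume "\<sigma> \<in> abs_galois K" "galois_extension L K" "\<tau> \<in> abs_galois L"
      then show "\<sigma> \<circ> \<tau> \<in> abs_galois K"
        using abs_galois_comp[of \<sigma> K \<tau>] abs_galois_mono[of K L] by (auto simp: galois_extension_def)
    qed
    have "(\<lambda>\<tau>. id \<circ> \<tau>) ` abs_galois K \<in> ?S"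
      using id_abs_galois[of K] galois_extension_refl[OF K] finite_dimension_refl[OF K] by blast
    then show "abs_galois K \<subseteq> \<Union>?S"
      by (auto simp: image_def)
  qed
  finally show ?thesis .
qed

text \<open>When nonempty, this is a coset of the stabiliser of \<open>a\<close>; functions of
  \<tau> that depend only on \<open>\<tau> a\<close> are constant on it.\<close>

definition transporter :: "qbar set \<Rightarrow> qbar \<Rightarrow> qbar \<Rightarrow> (qbar \<Rightarrow> qbar) set"
  where "transporter K a b = {\<tau> \<in> abs_galois K. \<tau> a = b}"

text \<open>With \<open>L\<close> a finite Galois extension of \<open>K\<close> containing
  \<open>a\<close>, the set is a union of cosets of Aut(\<rat>-bar/L), since elements of that
  subgroup fix \<open>a\<close>.\<close>

lemma openin_transporter:
  assumes K: "is_subfield K"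
  shows "openin (krull_topology K) (transporter K a b)"
proof -
  obtain L where L: "a \<in> L" "galois_extension L K" "ring.finite_dimension qbar_ring K L"
    using finite_galois_closure[OF K] by blast
  have KL: "K \<subseteq> L" using L(2) by (simp add: galois_extension_def)
  have "openin (krull_topology K) ((\<lambda>\<tau>. \<sigma> \<circ> \<tau>) ` abs_galois L)" if "\<sigma> \<in> abs_galois K" for \<sigma>
    unfolding krull_topology_def openin_topology_generated_by_iff
    by (rule generate_topology_on.Basis) (use L that in blast)
  then have "openin (krull_topology K) (\<Union>\<sigma>\<in>transporter K a b. (\<lambda>\<tau>. \<sigma> \<circ> \<tau>) ` abs_galois L)"
    by (intro openin_Union) (auto simp: transporter_def)
  moreover have "(\<Union>\<sigma>\<in>transporter K a b. (\<lambda>\<tau>. \<sigma> \<circ> \<tau>) ` abs_galois L) = transporter K a b"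
  proof
    show "(\<Union>\<sigma>\<in>transporter K a b. (\<lambda>\<tau>. \<sigma> \<circ> \<tau>) ` abs_galois L) \<subseteq> transporter K a b"
    proof clarify
      fix \<sigma> \<tau> assume \<sigma>: "\<sigma> \<in> transporter K a b" and \<tau>: "\<tau> \<in> abs_galois L"
      have "\<sigma> \<circ> \<tau> \<in> abs_galois K"
        using abs_galois_comp[of \<sigma> K \<tau>] abs_galois_mono[OF KL] \<sigma> \<tau> by (auto simp: transporter_def)
      then show "\<sigma> \<circ> \<tau> \<in> transporter K a b"
        using \<sigma> abs_galois_fix[OF \<tau> L(1)] by (simp add: transporter_def)
    qed
    show "transporter K a b \<subseteq> (\<Union>\<sigma>\<in>transporter K a b. (\<lambda>\<tau>. \<sigma> \<circ> \<tau>) ` abs_galois L)"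
    proof
      fix \<sigma> assume "\<sigma> \<in> transporter K a b"
      moreover have "\<sigma> \<in> (\<lambda>\<tau>. \<sigma> \<circ> \<tau>) ` abs_galois L"
        by (rule image_eqI[OF _ id_abs_galois]) simp
      ultimately show "\<sigma> \<in> (\<Union>\<sigma>\<in>transporter K a b. (\<lambda>\<tau>. \<sigma> \<circ> \<tau>) ` abs_galois L)" by blast
    qed
  qed
  ultimately show ?thesis by simp
qed

lemma transporter_translate:
  assumes \<sigma>: "\<sigma> \<in> abs_galois K"
  shows "(\<lambda>\<tau>. \<sigma> \<circ> \<tau>) ` transporter K a b = transporter K a (\<sigma> b)"
proof
  show "(\<lambda>\<tau>. \<sigma> \<circ> \<tau>) ` transporter K a b \<subseteq> transporter K a (\<sigma> b)"
    using abs_galois_comp[OF \<sigma>] by (auto simp: transporter_def)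
  show "transporter K a (\<sigma> b) \<subseteq> (\<lambda>\<tau>. \<sigma> \<circ> \<tau>) ` transporter K a b"
  proof
    fix \<rho> assume \<rho>: "\<rho> \<in> transporter K a (\<sigma> b)"
    then have "inv_into UNIV \<sigma> \<circ> \<rho> \<in> transporter K a b"
      using abs_galois_comp[OF abs_galois_inv[OF \<sigma>]] by (simp add: transporter_def inv_abs_galois_left[OF \<sigma>])
    moreover have "\<rho> = \<sigma> \<circ> (inv_into UNIV \<sigma> \<circ> \<rho>)"
      by (simp add: fun_eq_iff inv_abs_galois_right[OF \<sigma>])
    ultimately show "\<rho> \<in> (\<lambda>\<tau>. \<sigma> \<circ> \<tau>) ` transporter K a b" by (intro image_eqI)
  qed
qed

context
  fixes K and nu :: "(qbar \<Rightarrow> qbar) measure"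
  assumes K: "is_subfield K" and haar: "haar_probability K nu"
begin

lemma sets_haar: "sets nu = sets (sigma (abs_galois K) {V. openin (krull_topology K) V})"
  using haar by (simp add: haar_probability_def regular_borel_def topspace_krull_topology[OF K])

lemma space_haar: "space nu = abs_galois K"
  using sets_eq_imp_space_eq[OF sets_haar] openin_subset[of "krull_topology K"]
  by (simp add: space_measure_of_conv)

lemma transporter_sets: "transporter K a b \<in> sets nu"
proof -
  have "{V. openin (krull_topology K) V} \<subseteq> Pow (abs_galois K)"
    using openin_subset[of "krull_topology K"] by (auto simp: topspace_krull_topology[OF K])
  then show ?thesis
    unfolding sets_haar using openin_transporter[OF K] by (simp add: sigma_sets.Basic)
qed

lemma finite_measure_haar: "finite_measure nu"
  by (rule finite_measureI) (use haar in \<open>simp add: space_haar haar_probability_def\<close>)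

lemma measure_space_haar: "measure nu (space nu) = 1"
  using haar by (simp add: space_haar haar_probability_def measure_def)

text \<open>The transporters to the points of the orbit are translates of one another, hence of
  equal measure, and they partition a group of total mass 1.\<close>

lemma measure_transporter:
  assumes b: "b \<in> orb K a"
  shows "measure nu (transporter K a b) = 1 / card (orb K a)"
proof -
  interpret finite_measure nu by (rule finite_measure_haar)
  have inv: "measure nu (transporter K a (\<sigma> c)) = measure nu (transporter K a c)" if \<sigma>: "\<sigma> \<in> abs_galois K" for \<sigma> c
    unfolding measure_def transporter_translate[OF \<sigma>, symmetric]
    using haar \<sigma> transporter_sets by (simp add: haar_probability_def)
  have same: "measure nu (transporter K a c) = measure nu (transporter K a a)" if "c \<in> orb K a" for c
    using that inv by (auto simp: orbit_in_def)
  have "(\<Union>c\<in>orb K a. transporter K a c) = space nu"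
    by (auto simp: space_haar transporter_def orbit_in_def)
  then have "1 = measure nu (\<Union>c\<in>orb K a. transporter K a c)"
    using measure_space_haar by simp
  also have "\<dots> = (\<Sum>c\<in>orb K a. measure nu (transporter K a c))"
  proof (rule finite_measure_finite_Union)
    show "finite (orb K a)" by (rule finite_orb[OF K])
    show "transporter K a ` orb K a \<subseteq> sets nu" using transporter_sets by blast
    show "disjoint_family_on (transporter K a) (orb K a)"
      by (auto simp: disjoint_family_on_def transporter_def)
  qed
  also have "\<dots> = card (orb K a) * measure nu (transporter K a a)"
    using same by simp
  finally show ?thesis
    using same[OF b] card_orb_pos[OF K, of a] by (simp add: field_simps)
qed

text \<open>The integrand is a simple function, constant on each of the finitely many transporters
  of equal mass.\<close>

lemma haar_integral_orbit:
  fixes h :: "qbar \<Rightarrow> real"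
  shows "integrable nu (\<lambda>\<tau>. h (\<tau> a))" "(LINT \<tau>|nu. h (\<tau> a)) = (\<Sum>b\<in>orb K a. h b) / card (orb K a)"
proof -
  interpret finite_measure nu by (rule finite_measure_haar)
  have eq: "h (\<tau> a) = (\<Sum>b\<in>orb K a. h b * indicator (transporter K a b) \<tau>)" if "\<tau> \<in> space nu" for \<tau>
  proof -
    have \<tau>: "\<tau> \<in> abs_galois K" using that by (simp add: space_haar)
    then have "(\<Sum>b\<in>orb K a. h b * indicator (transporter K a b) \<tau>) = (\<Sum>b\<in>orb K a. if b = \<tau> a then h b else 0)"
      by (intro sum.cong) (auto simp: transporter_def indicator_def)
    also have "\<dots> = h (\<tau> a)"
      using \<tau> finite_orb[OF K, of a] by (auto simp: orbit_in_def)
    finally show ?thesis by simp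
  qed
  have int: "integrable nu (\<lambda>\<tau>. h b * indicator (transporter K a b) \<tau>)" for b
    by (intro integrable_mult_right integrable_real_indicator) (auto simp: transporter_sets emeasure_eq_measure)
  have "integrable nu (\<lambda>\<tau>. \<Sum>b\<in>orb K a. h b * indicator (transporter K a b) \<tau>)"
    using int by (rule Bochner_Integration.integrable_sum)
  then show "integrable nu (\<lambda>\<tau>. h (\<tau> a))"
    using eq by (simp cong: Bochner_Integration.integrable_cong)
  have "(LINT \<tau>|nu. h (\<tau> a)) = (LINT \<tau>|nu. (\<Sum>b\<in>orb K a. h b * indicator (transporter K a b) \<tau>))"
    using eq by (rule Bochner_Integration.integral_cong[OF refl])
  also have "\<dots> = (\<Sum>b\<in>orb K a. (LINT \<tau>|nu. h b * indicator (transporter K a b) \<tau>))"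
    using int by (rule Bochner_Integration.integral_sum)
  also have "\<dots> = (\<Sum>b\<in>orb K a. h b / card (orb K a))"
    by (intro sum.cong refl) (simp add: measure_transporter transporter_sets sets.Int_space_eq2)
  finally show "(LINT \<tau>|nu. h (\<tau> a)) = (\<Sum>b\<in>orb K a. h b) / card (orb K a)"
    by (simp add: sum_divide_distrib)
qed

lemma U_op_eq:
  assumes y: "y \<in> \<Y>"
  shows "U_op nu (lognorm a) y = (LINT \<tau>|nu. lognorm (\<tau> a) y)"
    and "integrable nu (\<lambda>\<tau>. lognorm a (act (inv_into UNIV \<tau>) y))"
proof -
  have "lognorm a (act (inv_into UNIV \<tau>) y) = lognorm (\<tau> a) y" if "\<tau> \<in> space nu" for \<tau>
    using that abs_galois_mono[OF Rats_subset_subfield[OF K]] y by (intro lognorm_act) (auto simp: space_haar)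
  then show "U_op nu (lognorm a) y = (LINT \<tau>|nu. lognorm (\<tau> a) y)"
    "integrable nu (\<lambda>\<tau>. lognorm a (act (inv_into UNIV \<tau>) y))"
    using y haar_integral_orbit(1)[of "\<lambda>b. lognorm b y" a]
    by (auto simp: U_op_def cong: Bochner_Integration.integral_cong Bochner_Integration.integrable_cong)
qed

lemma U_op_lognorm: "U_op nu (lognorm a) = (\<lambda>y. (\<Sum>b\<in>orb K a. lognorm b y) / card (orb K a))"
proof
  fix y show "U_op nu (lognorm a) y = (\<Sum>b\<in>orb K a. lognorm b y) / card (orb K a)"
    using U_op_eq(1)[of y a] haar_integral_orbit(2)[of "\<lambda>b. lognorm b y" a]
    by (cases "y \<in> \<Y>") (simp_all add: U_op_def lognorm_def)
qed

section \<open>Linearity, range and fixed space of the averaging operator\<close>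

lemma U_op_integrable: "F \<in> \<F> \<Longrightarrow> y \<in> \<Y> \<Longrightarrow> integrable nu (\<lambda>\<tau>. F (act (inv_into UNIV \<tau>) y))"
  using U_op_eq(2) by (auto elim: \<F>_cases)

lemma U_op_add:
  assumes "F \<in> \<F>" "H \<in> \<F>" shows "U_op nu (F + H) = U_op nu F + U_op nu H"
  using U_op_integrable[OF assms(1)] U_op_integrable[OF assms(2)] by (auto simp: U_op_def fun_eq_iff)

lemma U_op_scale: "U_op nu (\<lambda>y. r * F y) = (\<lambda>y. r * U_op nu F y)"
  by (auto simp: U_op_def fun_eq_iff)

lemma U_op_0: "U_op nu 0 = 0"
  by (auto simp: U_op_def fun_eq_iff)

lemma U_op_diff:
  assumes "F \<in> \<F>" "H \<in> \<F>" shows "U_op nu (F - H) = U_op nu F - U_op nu H"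
  using U_op_integrable[OF assms(1)] U_op_integrable[OF assms(2)] by (auto simp: U_op_def fun_eq_iff)

lemma U_op_sum:
  assumes "\<And>i. i \<in> I \<Longrightarrow> F i \<in> \<F>"
  shows "U_op nu (\<lambda>y. \<Sum>i\<in>I. F i y) = (\<lambda>y. \<Sum>i\<in>I. U_op nu (F i) y)"
  using U_op_integrable[OF assms] by (auto simp: U_op_def fun_eq_iff intro!: Bochner_Integration.integral_sum)

text \<open>The sum over the orbit is the function of the product of the conjugates, which is Galois
  invariant and so lies in \<open>K\<close>; division by the size of the orbit is a rational
  scaling.\<close>

lemma U_op_lognorm_mem:
  assumes a: "a \<noteq> 0"
  shows "U_op nu (lognorm a) \<in> \<F>" "U_op nu (lognorm a) \<in> \<D> K"
proof -
  interpret V: vector_space rat_scale by (rule vector_space_rat_scale)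
  define b where "b = (\<Prod>b\<in>orb K a. b)"
  have KQ: "\<tau> \<in> abs_galois K \<Longrightarrow> \<tau> a \<noteq> 0" for \<tau>
    using a abs_galois_eq_0_iff by blast
  then have b: "b \<noteq> 0" "b \<in> K"
    unfolding b_def using prod_orb_mem[OF K, of a] finite_orb[OF K, of a] by (auto simp: orbit_in_def)
  have "lognorm b = (\<Sum>c\<in>orb K a. lognorm c)"
    unfolding b_def using KQ by (intro lognorm_prod) (auto simp: orbit_in_def)
  then have sum: "lognorm b y = (\<Sum>c\<in>orb K a. lognorm c y)" for y by (simp add: sum_funs_apply)
  have eq: "U_op nu (lognorm a) = (\<lambda>y. lognorm b y / real (card (orb K a)))"
    by (simp add: U_op_lognorm sum)
  show "U_op nu (lognorm a) \<in> \<F>"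
    unfolding eq by (rule \<F>_divide[OF lognorm_in_\<F>[OF b(1)] card_orb_pos[OF K]])
  have "rat_scale (1 / of_nat (card (orb K a))) (lognorm b) \<in> \<D> K"
    unfolding \<D>_eq[OF K] using b by (intro V.span_scale V.span_base) auto
  also have "rat_scale (1 / of_nat (card (orb K a))) (lognorm b) = U_op nu (lognorm a)"
    by (simp add: eq rat_scale_def of_rat_divide)
  finally show "U_op nu (lognorm a) \<in> \<D> K" .
qed

lemma U_op_\<F>: "F \<in> \<F> \<Longrightarrow> U_op nu F \<in> \<F>" and U_op_\<D>: "F \<in> \<F> \<Longrightarrow> U_op nu F \<in> \<D> K"
  using U_op_lognorm_mem by (auto elim: \<F>_cases)

lemma orb_self: "a \<in> K \<Longrightarrow> orb K a = {a}"
  using mem_orb[OF K, of a] abs_galois_fix by (auto simp: orbit_in_def)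

text \<open>Elements of \<open>K\<close> have one-point orbits, so the generators are fixed, and
  linearity extends this to their span.\<close>

lemma \<D>_fixed:
  assumes "F \<in> \<D> K"
  shows "F \<in> \<F> \<and> U_op nu F = F"
proof -
  interpret V: vector_space rat_scale by (rule vector_space_rat_scale)
  have "F \<in> V.span (lognorm ` (K - {0}))" using assms by (simp add: \<D>_eq[OF K])
  then show ?thesis
  proof (induction rule: V.span_induct_alt)
    case base
    show ?case using \<F>_0 U_op_0 unfolding zero_fun_def by blast
  next
    case (step c x z)
    from step(1) obtain a where a: "a \<in> K" "a \<noteq> 0" "x = lognorm a" by blast
    have "U_op nu x = x" by (simp add: a(3) U_op_lognorm orb_self[OF a(1)])
    then have "U_op nu (rat_scale c x) = rat_scale c x"
      unfolding rat_scale_def U_op_scale by simp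
    moreover have cx: "rat_scale c x \<in> \<F>"
      unfolding a(3) by (rule rat_scale_\<F>[OF lognorm_in_\<F>[OF a(2)]])
    ultimately have "rat_scale c x + z \<in> \<F>" "U_op nu (rat_scale c x + z) = rat_scale c x + z"
      using step(2) U_op_add[OF cx, of z] \<F>_add[OF cx, of z] by simp_all
    then show ?case unfolding plus_fun_def by blast
  qed
qed

lemma \<D>_iff: "F \<in> \<D> K \<longleftrightarrow> F \<in> \<F> \<and> U_op nu F = F"
  using \<D>_fixed U_op_\<D> by metis

lemma U_op_idem: "F \<in> \<F> \<Longrightarrow> U_op nu (U_op nu F) = U_op nu F"
  using \<D>_fixed[OF U_op_\<D>] by blast

end

text \<open>For a group \<open>H\<close> normalising \<open>Aut(\<rat>-bar/K)\<close>, the average over \<open>Aut(\<rat>-bar/K)\<close> commutes with each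
  translation by an element of \<open>H\<close>, hence with averaging over \<open>H\<close>.\<close>

lemma U_op_commute:
  assumes K: "is_subfield K" "haar_probability K nu" and L: "is_subfield L" "haar_probability L mu"
    and gal: "galois_extension K (K \<inter> L)" and F: "F \<in> \<F>"
  shows "U_op nu (U_op mu F) = U_op mu (U_op nu F)"
proof -
  have shift: "orb K (\<tau> b) = \<tau> ` orb K b" if "\<tau> \<in> abs_galois L" for \<tau> b
  proof -
    have \<tau>: "\<tau> \<in> abs_galois (K \<inter> L)" using abs_galois_mono[of "K \<inter> L" L] that by blast
    show ?thesis by (rule orb_image_normaliser[OF \<tau> galois_extension_image[OF gal \<tau>]])
  qed
  obtain a where a: "a \<noteq> 0" "F = lognorm a" using F by (rule \<F>_cases)
  have nz: "lognorm b \<in> \<F>" if "b \<in> orb M a" for b M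
    using that a(1) abs_galois_eq_0_iff by (intro lognorm_in_\<F>) (auto simp: orbit_in_def)
  show ?thesis
  proof
    fix y
    show "U_op nu (U_op mu F) y = U_op mu (U_op nu F) y"
    proof (cases "y \<in> \<Y>")
      case y: True
      define n where "n = real (card (orb K a))"
      \<comment> \<open>The \<open>K\<close>-orbit of \<tau> a is the \<tau>-translate of the
        \<open>K\<close>-orbit of a, so the average may be taken before applying \<tau>. Integrating
        over \<tau> then only exchanges a finite sum with an integral.\<close>
      have avg: "U_op nu (lognorm (\<tau> a)) y = (\<Sum>c\<in>orb K a. lognorm (\<tau> c) y) / n" if \<tau>: "\<tau> \<in> abs_galois L" for \<tau>
      proof -
        have inj: "inj_on \<tau> (orb K a)" by (auto simp: inj_on_def abs_galois_inj[OF \<tau>])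
        show ?thesis
          by (simp add: U_op_lognorm[OF K] shift[OF \<tau>] card_image[OF inj] sum.reindex[OF inj] n_def)
      qed
      have "U_op nu (U_op mu F) y = (\<Sum>b\<in>orb L a. U_op nu (lognorm b) y) / real (card (orb L a))"
        unfolding a(2) U_op_lognorm[OF L]
        using U_op_scale[OF K, of "1 / real (card (orb L a))" "\<lambda>y. \<Sum>b\<in>orb L a. lognorm b y"] U_op_sum[OF K, of "orb L a" lognorm, OF nz]
        by simp
      also have "\<dots> = (LINT \<tau>|mu. U_op nu (lognorm (\<tau> a)) y)"
        by (simp add: haar_integral_orbit(2)[OF L, of "\<lambda>b. U_op nu (lognorm b) y"])
      also have "\<dots> = (LINT \<tau>|mu. (\<Sum>c\<in>orb K a. lognorm (\<tau> c) y) / n)"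
        using avg by (intro Bochner_Integration.integral_cong refl) (simp add: space_haar[OF L])
      also have "\<dots> = (\<Sum>c\<in>orb K a. (LINT \<tau>|mu. lognorm (\<tau> c) y)) / n"
        using haar_integral_orbit(1)[OF L, of "\<lambda>b. lognorm b y"] by simp
      also have "\<dots> = (\<Sum>c\<in>orb K a. U_op mu (lognorm c) y) / n"
        using U_op_eq(1)[OF L y] by simp
      also have "\<dots> = U_op mu (U_op nu F) y"
        unfolding a(2) U_op_lognorm[OF K]
        using U_op_scale[OF L, of "1 / real (card (orb K a))" "\<lambda>y. \<Sum>b\<in>orb K a. lognorm b y"] U_op_sum[OF L, of "orb K a" lognorm, OF nz]
        by (simp add: n_def)
      finally show ?thesis .
    qed (simp add: U_op_def)
  qed
qed

section \<open>Completions and the local degree over the rationals\<close>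

context
  fixes k v
  assumes k: "is_subfield k" and v: "v \<in> places k"
begin

lemmas completion_av = norm_at_absolute_value[OF k v]

lemma cauchy_ring_carrier:
  "s \<in> carrier (cauchy_ring k v) \<longleftrightarrow>
    (\<forall>n. s n \<in> k) \<and> (\<forall>e>0. \<exists>n0. \<forall>m\<ge>n0. \<forall>n\<ge>n0. norm_at v (s m - s n) < e)"
  by (auto simp: cauchy_ring_def)

lemma cauchy_ring_ops [simp]:
  "s \<otimes>\<^bsub>cauchy_ring k v\<^esub> t = (\<lambda>n. s n * t n)" "\<one>\<^bsub>cauchy_ring k v\<^esub> = (\<lambda>n. 1)"
  "\<zero>\<^bsub>cauchy_ring k v\<^esub> = (\<lambda>n. 0)" "s \<oplus>\<^bsub>cauchy_ring k v\<^esub> t = (\<lambda>n. s n + t n)"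
  by (simp_all add: cauchy_ring_def)

lemma cauchy_mem: "s \<in> carrier (cauchy_ring k v) \<Longrightarrow> s n \<in> k"
  and cauchy_cauchy: "s \<in> carrier (cauchy_ring k v) \<Longrightarrow> e > 0 \<Longrightarrow>
    \<exists>n0. \<forall>m\<ge>n0. \<forall>n\<ge>n0. norm_at v (s m - s n) < e"
  unfolding cauchy_ring_carrier by blast+

lemma cauchy_const: "c \<in> k \<Longrightarrow> (\<lambda>n. c) \<in> carrier (cauchy_ring k v)"
  by (simp add: cauchy_ring_carrier av_0[OF k completion_av])

lemma cauchy_add:
  assumes s: "s \<in> carrier (cauchy_ring k v)" and t: "t \<in> carrier (cauchy_ring k v)"
  shows "(\<lambda>n. s n + t n) \<in> carrier (cauchy_ring k v)"
  unfolding cauchy_ring_carrier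
proof (intro conjI allI impI)
  show "s n + t n \<in> k" for n using cauchy_mem[OF s] cauchy_mem[OF t] by (rule subfield_add[OF k])
  fix e :: real assume "e > 0"
  then have e2: "e / 2 > 0" by simp
  obtain n0 where n0: "\<And>m n. n0 \<le> m \<Longrightarrow> n0 \<le> n \<Longrightarrow> norm_at v (s m - s n) < e / 2" using cauchy_cauchy[OF s e2] by blast
  obtain n1 where n1: "\<And>m n. n1 \<le> m \<Longrightarrow> n1 \<le> n \<Longrightarrow> norm_at v (t m - t n) < e / 2" using cauchy_cauchy[OF t e2] by blast
  have "norm_at v (s m + t m - (s n + t n)) < e" if "max n0 n1 \<le> m" "max n0 n1 \<le> n" for m n
  proof -
    have "norm_at v (s m + t m - (s n + t n)) = norm_at v ((s m - s n) + (t m - t n))"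
      by (simp add: algebra_simps)
    also have "\<dots> \<le> norm_at v (s m - s n) + norm_at v (t m - t n)"
      using cauchy_mem[OF s] cauchy_mem[OF t] by (intro av_add[OF k completion_av] subfield_diff[OF k])
    finally show ?thesis using n0[of m n] n1[of m n] that by simp
  qed
  then show "\<exists>n0. \<forall>m\<ge>n0. \<forall>n\<ge>n0. norm_at v (s m + t m - (s n + t n)) < e" by blast
qed

lemma cauchy_bounded:
  assumes s: "s \<in> carrier (cauchy_ring k v)"
  obtains B where "B > 0" "\<And>n. norm_at v (s n) \<le> B"
proof -
  obtain n0 where n0: "\<And>m n. n0 \<le> m \<Longrightarrow> n0 \<le> n \<Longrightarrow> norm_at v (s m - s n) < 1"
    using cauchy_cauchy[OF s, of 1] by auto
  define B where "B = 1 + (\<Sum>i\<le>n0. norm_at v (s i))"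
  have nn: "0 \<le> norm_at v (s i)" for i using av_nonneg[OF k completion_av cauchy_mem[OF s]] .
  have le: "norm_at v (s i) \<le> (\<Sum>i\<le>n0. norm_at v (s i))" if "i \<le> n0" for i
    using nn that by (intro member_le_sum) auto
  have "norm_at v (s n) \<le> B" for n
  proof (cases "n \<le> n0")
    case False
    have "norm_at v (s n) = norm_at v ((s n - s n0) + s n0)" by simp
    also have "\<dots> \<le> norm_at v (s n - s n0) + norm_at v (s n0)"
      using cauchy_mem[OF s] by (intro av_add[OF k completion_av] subfield_diff[OF k])
    finally show ?thesis using n0[of n n0] le[of n0] False by (simp add: B_def)
  qed (use le[of n] in \<open>simp add: B_def\<close>)
  moreover have "B > 0" using sum_nonneg[of "{..n0}" "\<lambda>i. norm_at v (s i)"] nn by (simp add: B_def)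
  ultimately show thesis using that by blast
qed

lemma cauchy_mult:
  assumes s: "s \<in> carrier (cauchy_ring k v)" and t: "t \<in> carrier (cauchy_ring k v)"
  shows "(\<lambda>n. s n * t n) \<in> carrier (cauchy_ring k v)"
  unfolding cauchy_ring_carrier
proof (intro conjI allI impI)
  show "s n * t n \<in> k" for n using cauchy_mem[OF s] cauchy_mem[OF t] by (rule subfield_mult[OF k])
  obtain B where B: "B > 0" "\<And>n. norm_at v (s n) \<le> B" using cauchy_bounded[OF s] by blast
  obtain C where C: "C > 0" "\<And>n. norm_at v (t n) \<le> C" using cauchy_bounded[OF t] by blast
  fix e :: real assume "e > 0"
  then have e: "e / (2 * B) > 0" "e / (2 * C) > 0" using B C by auto
  obtain n0 where n0: "\<And>m n. n0 \<le> m \<Longrightarrow> n0 \<le> n \<Longrightarrow> norm_at v (s m - s n) < e / (2 * C)" using cauchy_cauchy[OF s e(2)] by blast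
  obtain n1 where n1: "\<And>m n. n1 \<le> m \<Longrightarrow> n1 \<le> n \<Longrightarrow> norm_at v (t m - t n) < e / (2 * B)" using cauchy_cauchy[OF t e(1)] by blast
  have "norm_at v (s m * t m - s n * t n) < e" if "max n0 n1 \<le> m" "max n0 n1 \<le> n" for m n
  proof -
    note mem = cauchy_mem[OF s] cauchy_mem[OF t] subfield_diff[OF k] subfield_mult[OF k]
    have "norm_at v (s m * t m - s n * t n) = norm_at v ((s m - s n) * t m + s n * (t m - t n))"
      by (simp add: algebra_simps)
    also have "\<dots> \<le> norm_at v ((s m - s n) * t m) + norm_at v (s n * (t m - t n))"
      by (intro av_add[OF k completion_av] mem)
    also have "\<dots> = norm_at v (s m - s n) * norm_at v (t m) + norm_at v (s n) * norm_at v (t m - t n)"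
      by (simp add: av_mult[OF k completion_av] mem)
    also have "\<dots> \<le> norm_at v (s m - s n) * C + B * norm_at v (t m - t n)"
      using B C by (intro add_mono mult_left_mono mult_right_mono av_nonneg[OF k completion_av] mem) auto
    also have "\<dots> < e / (2 * C) * C + B * (e / (2 * B))"
      using B C n0[of m n] n1[of m n] that by (intro add_strict_mono mult_strict_left_mono mult_strict_right_mono) auto
    also have "\<dots> = e" using B C by simp
    finally show ?thesis .
  qed
  then show "\<exists>n0. \<forall>m\<ge>n0. \<forall>n\<ge>n0. norm_at v (s m * t m - s n * t n) < e" by blast
qed

lemma cauchy_uminus: "s \<in> carrier (cauchy_ring k v) \<Longrightarrow> (\<lambda>n. - s n) \<in> carrier (cauchy_ring k v)"
  using cauchy_mult[OF cauchy_const[of "- 1"], of s] subfield_uminus[OF k subfield_1[OF k]] by simp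

lemma cring_cauchy_ring: "cring (cauchy_ring k v)"
proof (rule cringI)
  show "abelian_group (cauchy_ring k v)"
  proof (rule abelian_groupI)
    fix s assume s: "s \<in> carrier (cauchy_ring k v)"
    show "\<exists>t\<in>carrier (cauchy_ring k v). t \<oplus>\<^bsub>cauchy_ring k v\<^esub> s = \<zero>\<^bsub>cauchy_ring k v\<^esub>"
      by (rule bexI[OF _ cauchy_uminus[OF s]]) simp
  qed (auto simp: cauchy_add cauchy_const subfield_0[OF k] algebra_simps)
  show "comm_monoid (cauchy_ring k v)"
    by (rule comm_monoidI) (auto simp: cauchy_mult cauchy_const subfield_1[OF k] algebra_simps)
qed (simp add: algebra_simps)

interpretation C: cring "cauchy_ring k v"
  by (rule cring_cauchy_ring)

lemma cauchy_a_inv: "s \<in> carrier (cauchy_ring k v) \<Longrightarrow> \<ominus>\<^bsub>cauchy_ring k v\<^esub> s = (\<lambda>n. - s n)"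
  by (rule C.minus_equality) (auto simp: cauchy_uminus)

lemma null_iff: "s \<in> null_sequences k v \<longleftrightarrow> s \<in> carrier (cauchy_ring k v) \<and> (\<lambda>n. norm_at v (s n)) \<longlonglongrightarrow> 0"
  by (auto simp: null_sequences_def)

lemma null_mult:
  assumes s: "s \<in> null_sequences k v" and t: "t \<in> carrier (cauchy_ring k v)"
  shows "(\<lambda>n. s n * t n) \<in> null_sequences k v"
proof -
  have s': "s \<in> carrier (cauchy_ring k v)" "(\<lambda>n. norm_at v (s n)) \<longlonglongrightarrow> 0" using s by (auto simp: null_iff)
  obtain B where B: "B > 0" "\<And>n. norm_at v (t n) \<le> B" using cauchy_bounded[OF t] by blast
  have "(\<lambda>n. norm_at v (s n * t n)) \<longlonglongrightarrow> 0"
  proof (rule Lim_null_comparison)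
    show "(\<lambda>n. norm_at v (s n) * B) \<longlonglongrightarrow> 0" using tendsto_mult_right[OF s'(2), of B] by simp
    show "\<forall>\<^sub>F n in sequentially. norm (norm_at v (s n * t n)) \<le> norm_at v (s n) * B"
      using B by (intro always_eventually allI)
        (simp add: av_mult[OF k completion_av] cauchy_mem[OF s'(1)] cauchy_mem[OF t] av_nonneg[OF k completion_av] abs_mult mult_left_mono)
  qed
  then show ?thesis using cauchy_mult[OF s'(1) t] by (simp add: null_iff)
qed

lemma ideal_null_sequences: "ideal (null_sequences k v) (cauchy_ring k v)"
proof (rule idealI)
  show "ring (cauchy_ring k v)" by (rule C.ring_axioms)
  show "subgroup (null_sequences k v) (add_monoid (cauchy_ring k v))"
  proof (rule C.add.subgroupI)
    show "null_sequences k v \<subseteq> carrier (cauchy_ring k v)" by (auto simp: null_iff)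
    have "(\<lambda>n. 0) \<in> null_sequences k v"
      by (simp add: null_iff cauchy_const subfield_0[OF k] av_0[OF k completion_av])
    then show "null_sequences k v \<noteq> {}" by blast
    fix s assume s: "s \<in> null_sequences k v"
    then have s': "s \<in> carrier (cauchy_ring k v)" "(\<lambda>n. norm_at v (s n)) \<longlonglongrightarrow> 0" by (auto simp: null_iff)
    show "\<ominus>\<^bsub>cauchy_ring k v\<^esub> s \<in> null_sequences k v"
      using s' cauchy_uminus[OF s'(1)] by (simp add: cauchy_a_inv null_iff av_uminus[OF k completion_av cauchy_mem])
    fix t assume t: "t \<in> null_sequences k v"
    then have t': "t \<in> carrier (cauchy_ring k v)" "(\<lambda>n. norm_at v (t n)) \<longlonglongrightarrow> 0" by (auto simp: null_iff)
    have "(\<lambda>n. norm_at v (s n + t n)) \<longlonglongrightarrow> 0"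
    proof (rule Lim_null_comparison)
      show "(\<lambda>n. norm_at v (s n) + norm_at v (t n)) \<longlonglongrightarrow> 0" using tendsto_add[OF s'(2) t'(2)] by simp
      show "\<forall>\<^sub>F n in sequentially. norm (norm_at v (s n + t n)) \<le> norm_at v (s n) + norm_at v (t n)"
        by (intro always_eventually allI) (simp add: av_add[OF k completion_av] cauchy_mem[OF s'(1)] cauchy_mem[OF t'(1)]
          av_nonneg[OF k completion_av] subfield_add[OF k])
    qed
    then show "s \<oplus>\<^bsub>cauchy_ring k v\<^esub> t \<in> null_sequences k v"
      using cauchy_add[OF s'(1) t'(1)] by (simp add: null_iff)
  qed
qed (use null_mult in \<open>auto simp: mult.commute\<close>)

text \<open>A Cauchy sequence that does not tend to 0 eventually stays away from 0 by at least e/2,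
  so its termwise inverse is again Cauchy.\<close>

lemma non_null_invertible:
  assumes s: "s \<in> carrier (cauchy_ring k v)" and nn: "s \<notin> null_sequences k v"
  shows "\<exists>t\<in>carrier (cauchy_ring k v). (\<lambda>n. s n * t n - 1) \<in> null_sequences k v"
proof -
  note av = completion_av
  have nonneg: "0 \<le> norm_at v (s n)" for n using av_nonneg[OF k av cauchy_mem[OF s]] .
  have "\<not> (\<lambda>n. norm_at v (s n)) \<longlonglongrightarrow> 0" using s nn by (simp add: null_iff)
  then obtain e where e: "e > 0" "\<And>N. \<exists>n\<ge>N. norm_at v (s n) \<ge> e"
    unfolding LIMSEQ_iff using nonneg by (auto simp: not_less)
  have e2: "e / 2 > 0" using e by simp
  obtain n0 where n0: "\<And>m n. n0 \<le> m \<Longrightarrow> n0 \<le> n \<Longrightarrow> norm_at v (s m - s n) < e / 2"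
    using cauchy_cauchy[OF s e2] by blast
  obtain N where N: "N \<ge> n0" "norm_at v (s N) \<ge> e" using e(2) by blast
  have low: "e / 2 \<le> norm_at v (s n)" if "n \<ge> n0" for n
  proof -
    have "norm_at v (s N) = norm_at v ((s N - s n) + s n)" by simp
    also have "\<dots> \<le> norm_at v (s N - s n) + norm_at v (s n)"
      using cauchy_mem[OF s] by (intro av_add[OF k av] subfield_diff[OF k])
    finally show ?thesis using n0[of N n] N that by simp
  qed
  have s0: "s n \<noteq> 0" if "n \<ge> n0" for n
    using low[OF that] e2 av_0[OF k av] by auto
  \<comment> \<open>Finitely many terms of \<open>s\<close> may be 0. There \<open>t\<close> takes
    the default value inverse 0 = 0, which affects neither the Cauchy property nor the limit of s t
    - 1.\<close>
  define t where "t n = inverse (s n)" for n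
  have tk: "t n \<in> k" for n unfolding t_def using cauchy_mem[OF s] by (rule subfield_inverse[OF k])
  have t: "t \<in> carrier (cauchy_ring k v)"
    unfolding cauchy_ring_carrier
  proof (intro conjI allI impI tk)
    fix \<epsilon> :: real assume "\<epsilon> > 0"
    then have "\<epsilon> * (e / 2 * (e / 2)) > 0" using e by simp
    then obtain n1 where n1: "\<And>m n. n1 \<le> m \<Longrightarrow> n1 \<le> n \<Longrightarrow> norm_at v (s m - s n) < \<epsilon> * (e / 2 * (e / 2))"
      using cauchy_cauchy[OF s] by blast
    have "norm_at v (t m - t n) < \<epsilon>" if mn: "max n0 n1 \<le> m" "max n0 n1 \<le> n" for m n
    proof -
      have "t m - t n = (s n - s m) / (s m * s n)"
        using s0[of m] s0[of n] mn by (simp add: t_def field_simps)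
      then have "norm_at v (t m - t n) = norm_at v (s n - s m) / (norm_at v (s m) * norm_at v (s n))"
        by (simp add: av_divide[OF k av] av_mult[OF k av] cauchy_mem[OF s] subfield_diff[OF k] subfield_mult[OF k])
      also have "\<dots> \<le> norm_at v (s n - s m) / (e / 2 * (e / 2))"
        using low[of m] low[of n] mn e2
        by (intro divide_left_mono mult_mono av_nonneg[OF k av] subfield_diff[OF k] cauchy_mem[OF s] mult_pos_pos) auto
      also have "\<dots> < \<epsilon>"
        using n1[of n m] mn e2 by (subst pos_divide_less_eq) auto
      finally show ?thesis .
    qed
    then show "\<exists>n0. \<forall>m\<ge>n0. \<forall>n\<ge>n0. norm_at v (t m - t n) < \<epsilon>" by blast
  qed
  have "(\<lambda>n. s n * t n + - 1) \<in> carrier (cauchy_ring k v)"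
    by (intro cauchy_add cauchy_mult s t cauchy_const subfield_uminus[OF k subfield_1[OF k]])
  moreover have "(\<lambda>n. norm_at v (s n * t n - 1)) \<longlonglongrightarrow> 0"
  proof (rule tendsto_eventually, rule eventually_sequentiallyI[of n0])
    fix n assume "n0 \<le> n"
    then show "norm_at v (s n * t n - 1) = 0" using s0[of n] by (simp add: t_def av_0[OF k av])
  qed
  ultimately show ?thesis using t by (intro bexI[of _ t]) (auto simp: null_iff)
qed

text \<open>Invertibility modulo null sequences makes these a maximal ideal. The field structure is
  what allows the dimension in \<open>local_degree\<close> to be evaluated.\<close>

lemma field_completion: "Ring.field (completion k v)"
proof -
  have "maximalideal (null_sequences k v) (cauchy_ring k v)"
  proof (rule maximalidealI)
    show "ideal (null_sequences k v) (cauchy_ring k v)" by (rule ideal_null_sequences)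
    have "(\<lambda>n. 1) \<notin> null_sequences k v"
      by (simp add: null_iff av_1[OF k completion_av] LIMSEQ_const_iff)
    then show "carrier (cauchy_ring k v) \<noteq> null_sequences k v"
      using cauchy_const[OF subfield_1[OF k]] by blast
    fix J assume J: "ideal J (cauchy_ring k v)" "null_sequences k v \<subseteq> J" "J \<subseteq> carrier (cauchy_ring k v)"
    interpret J: ideal J "cauchy_ring k v" by (rule J(1))
    show "J = null_sequences k v \<or> J = carrier (cauchy_ring k v)"
    proof (cases "J = null_sequences k v")
      case False
      then obtain s where s: "s \<in> J" "s \<notin> null_sequences k v" using J(2) by blast
      then have sC: "s \<in> carrier (cauchy_ring k v)" using J(3) by blast
      obtain t where t: "t \<in> carrier (cauchy_ring k v)" "(\<lambda>n. s n * t n - 1) \<in> null_sequences k v"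
        using non_null_invertible[OF sC s(2)] by blast
      have "(\<lambda>n. s n * t n) \<in> J" using J.I_r_closed[OF s(1) t(1)] by simp
      moreover have "(\<lambda>n. s n * t n - 1) \<in> J" using t(2) J(2) by blast
      ultimately have "(\<lambda>n. s n * t n) \<oplus>\<^bsub>cauchy_ring k v\<^esub> (\<ominus>\<^bsub>cauchy_ring k v\<^esub> (\<lambda>n. s n * t n - 1)) \<in> J"
        by (intro J.a_closed J.a_inv_closed)
      also have "\<ominus>\<^bsub>cauchy_ring k v\<^esub> (\<lambda>n. s n * t n - 1) = (\<lambda>n. - (s n * t n - 1))"
        using t(2) by (intro cauchy_a_inv) (simp add: null_iff)
      finally have "\<one>\<^bsub>cauchy_ring k v\<^esub> \<in> J" by simp
      then show ?thesis using J.one_imp_carrier by blast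
    qed simp
  qed
  then show ?thesis
    unfolding completion_def by (rule maximalideal.quotient_is_field) (rule cring_cauchy_ring)
qed

end

text \<open>For the field \<rat> every Cauchy sequence is rational, so the base field in the
  definition is the entire completion, of dimension 1 over itself. Hence all the fibres over places
  of \<rat> have mass 1.\<close>

lemma local_degree_Rats:
  assumes v: "v \<in> places \<rat>"
  shows "local_degree \<rat> v = 1"
proof -
  interpret F: field "completion \<rat> v" by (rule field_completion[OF is_subfield_Rats v])
  have "{s \<in> carrier (cauchy_ring \<rat> v). range s \<subseteq> \<rat>} = carrier (cauchy_ring \<rat> v)"
    by (auto simp: cauchy_ring_def)
  then have "rat_completion \<rat> v = carrier (completion \<rat> v)"
    by (auto simp: rat_completion_def completion_def FactRing_def A_RCOSETS_def RCOSETS_def a_r_coset_def)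
  then show ?thesis
    unfolding local_degree_def
    using F.dimI[OF F.carrier_is_subfield F.dimension_one[OF F.carrier_is_subfield]]
    by (simp add: over_def)
qed

lemma global_degree_Rats: "global_degree \<rat> = 1"
  unfolding global_degree_def
  using QB.dimI[OF is_subfield_Rats QB.dimension_one[OF is_subfield_Rats]] by (simp add: over_def)

lemma number_field_Rats: "number_field \<rat>"
  by (simp add: number_field_def is_subfield_Rats finite_dimension_refl)


section \<open>Places of the rationals\<close>

text \<open>Carries a function on the type \<open>rat\<close> over to the copy of the rationals
  inside the algebraic closure, in the extensional form that \<open>absolute_values\<close>
  demands.\<close>

definition rat_av :: "(rat \<Rightarrow> real) \<Rightarrow> qbar \<Rightarrow> real"
  where "rat_av g = (\<lambda>x\<in>\<rat>. g (inv_into UNIV of_rat x))"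

lemma rat_av_of_rat: "rat_av g (of_rat r) = g r"
proof -
  have "inj (of_rat :: rat \<Rightarrow> qbar)" by (rule injI) simp
  then show ?thesis by (simp add: rat_av_def)
qed

definition archimedean_place :: place
  where "archimedean_place = place_rel \<rat> `` {rat_av (\<lambda>r. \<bar>of_rat r\<bar>)}"

definition padic_place :: "nat \<Rightarrow> place"
  where "padic_place p = place_rel \<rat> `` {rat_av (padic_abs p)}"

lemma rat_av_absolute_value:
  assumes "\<And>r. 0 \<le> g r" "\<And>r. g r = 0 \<longleftrightarrow> r = 0" "\<And>r s. g (r * s) = g r * g s" "\<And>r s. g (r + s) \<le> g r + g s"
    "c \<noteq> 0" "g c \<noteq> 1"
  shows "rat_av g \<in> absolute_values \<rat>"
proof -
  have "\<exists>x\<in>\<rat>. x \<noteq> 0 \<and> rat_av g x \<noteq> 1"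
    using assms(5,6) by (intro bexI[of _ "of_rat c"]) (auto simp: rat_av_of_rat)
  moreover have "rat_av g \<in> extensional \<rat>" by (simp add: rat_av_def)
  moreover have "0 \<le> rat_av g x \<and> (rat_av g x = 0 \<longleftrightarrow> x = 0)" if "x \<in> \<rat>" for x
  proof -
    from that obtain r where "x = of_rat r" by (rule Rats_cases)
    then show ?thesis using assms(1,2) by (simp add: rat_av_of_rat)
  qed
  moreover have "rat_av g (x * y) = rat_av g x * rat_av g y \<and> rat_av g (x + y) \<le> rat_av g x + rat_av g y"
    if "x \<in> \<rat>" "y \<in> \<rat>" for x y
    using that assms by (auto elim!: Rats_cases simp: rat_av_of_rat simp flip: of_rat_add of_rat_mult)
  ultimately show ?thesis by (simp add: absolute_values_def)
qed

lemma archimedean_normalised: "rat_av (\<lambda>r. \<bar>of_rat r\<bar>) \<in> normalised_avs \<rat>"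
  unfolding normalised_avs_def
proof (intro CollectI conjI)
  show "rat_av (\<lambda>r. \<bar>of_rat r\<bar>) \<in> absolute_values \<rat>"
  proof (rule rat_av_absolute_value[where c = 2])
    show "\<bar>real_of_rat (r + s)\<bar> \<le> \<bar>real_of_rat r\<bar> + \<bar>real_of_rat s\<bar>" for r s
      unfolding of_rat_add by (rule abs_triangle_ineq)
  qed (auto simp: of_rat_mult abs_mult)
  show "normalised (rat_av (\<lambda>r. \<bar>of_rat r\<bar>))" by (simp add: normalised_def rat_av_of_rat)
qed

lemma padic_normalised:
  assumes p: "Factorial_Ring.prime p"
  shows "rat_av (padic_abs p) \<in> normalised_avs \<rat>"
  unfolding normalised_avs_def
proof (intro CollectI conjI)
  have "padic_abs p (r + s) \<le> padic_abs p r + padic_abs p s" for r s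
    using padic_abs_add[OF p, of r s] padic_abs_nonneg[OF p, of r] padic_abs_nonneg[OF p, of s] by linarith
  then show "rat_av (padic_abs p) \<in> absolute_values \<rat>"
    using prime_gt_1_nat[OF p]
    by (intro rat_av_absolute_value[where c = "of_nat p"])
      (auto simp: padic_abs_mult[OF p] padic_abs_nonneg[OF p] padic_abs_eq_0_iff[OF p] padic_abs_self[OF p])
  show "normalised (rat_av (padic_abs p))" using p by (auto simp: normalised_def rat_av_of_rat)
qed

lemma archimedean_place: "archimedean_place \<in> places \<rat>" "norm_at archimedean_place (of_rat r) = \<bar>of_rat r\<bar>"
  unfolding archimedean_place_def
  using place_of_normalised[OF is_subfield_Rats archimedean_normalised] norm_at_eqI[OF is_subfield_Rats archimedean_normalised]
  by (simp_all add: rat_av_of_rat)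

lemma padic_place:
  assumes p: "Factorial_Ring.prime p"
  shows "padic_place p \<in> places \<rat>" "norm_at (padic_place p) (of_rat r) = padic_abs p r"
  unfolding padic_place_def
  using place_of_normalised[OF is_subfield_Rats padic_normalised[OF p]] norm_at_eqI[OF is_subfield_Rats padic_normalised[OF p]]
  by (simp_all add: rat_av_of_rat)

lemma place_Rats_eqI:
  assumes "v \<in> places \<rat>" "w \<in> places \<rat>" "\<And>r. norm_at v (of_rat r) = norm_at w (of_rat r)"
  shows "v = w"
proof (rule norm_at_inj[OF is_subfield_Rats assms(1,2)])
  show "norm_at v = norm_at w"
    by (rule extensionalityI[OF av_extensional[OF is_subfield_Rats norm_at_absolute_value[OF is_subfield_Rats assms(1)]]
      av_extensional[OF is_subfield_Rats norm_at_absolute_value[OF is_subfield_Rats assms(2)]]])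
      (use assms(3) in \<open>auto elim: Rats_cases\<close>)
qed

lemma places_Rats_cases:
  assumes v: "v \<in> places \<rat>"
  obtains "v = archimedean_place" | p where "Factorial_Ring.prime p" "v = padic_place p"
proof -
  have "normalised (norm_at v)"
    using place_of_norm_at(1)[OF is_subfield_Rats v] by (simp add: normalised_avs_def)
  then show thesis
  proof (cases rule: normalised_cases)
    case archimedean
    then show thesis using that(1) place_Rats_eqI[OF v archimedean_place(1)] archimedean_place(2) by simp
  next
    case (padic p)
    then show thesis using that(2) place_Rats_eqI[OF v padic_place(1)] padic_place(2) by simp
  qed
qed

text \<open>At a prime dividing neither numerator nor denominator the value is 1, which leaves
  finitely many primes and the archimedean place.\<close>

lemma finite_places_Rats:
  assumes r: "r \<noteq> 0"
  shows "finite {v \<in> places \<rat>. norm_at v (of_rat r) \<noteq> 1}"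
proof -
  obtain a b where ab: "r = of_int a / of_int b" "b \<noteq> 0" by (rule rat_int_quotient)
  have a: "a \<noteq> 0" using r ab by auto
  have "{v \<in> places \<rat>. norm_at v (of_rat r) \<noteq> 1} \<subseteq> insert archimedean_place (padic_place ` {p. p dvd nat \<bar>a * b\<bar>})"
  proof
    fix v assume "v \<in> {v \<in> places \<rat>. norm_at v (of_rat r) \<noteq> 1}"
    then have v: "v \<in> places \<rat>" "norm_at v (of_rat r) \<noteq> 1" by auto
    show "v \<in> insert archimedean_place (padic_place ` {p. p dvd nat \<bar>a * b\<bar>})"
      using v(1)
    proof (cases rule: places_Rats_cases)
      case (2 p)
      have "p dvd nat \<bar>a * b\<bar>"
      proof (rule ccontr)
        assume "\<not> p dvd nat \<bar>a * b\<bar>"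
        then have "\<not> int p dvd a * b" by (metis dvd_abs_iff int_dvd_int_iff nat_0_le abs_ge_zero)
        then have "\<not> int p dvd a" "\<not> int p dvd b" by auto
        then have "padic_abs p (of_int a) = 1" "padic_abs p (of_int b) = 1"
          using padic_abs_of_int_eq_1_iff[OF 2(1)] by auto
        moreover have "of_int b * r = of_int a" using ab by simp
        ultimately have "padic_abs p r = 1"
          using padic_abs_mult[OF 2(1), of "of_int b" r] by simp
        with v(2) 2 show False by (simp add: padic_place(2))
      qed
      then show ?thesis using 2 by blast
    qed simp
  qed
  then show ?thesis
  proof (rule finite_subset)
    have "nat \<bar>a * b\<bar> > 0" using a ab(2) by simp
    then show "finite (insert archimedean_place (padic_place ` {p. p dvd nat \<bar>a * b\<bar>}))"
      using finite_divisors_nat[of "nat \<bar>a * b\<bar>"] by blast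
  qed
qed

section \<open>Fibres over the places of the rationals\<close>

lemma place_below_Rats:
  assumes y: "y \<in> \<Y>"
  shows "place_below \<rat> y \<in> places \<rat>" "x \<in> \<rat> \<Longrightarrow> norm_at y x = norm_at (place_below \<rat> y) x"
  using place_below[OF is_subfield_Rats is_subfield_UNIV subset_UNIV y] by simp_all

text \<open>The absolute value of \<open>a\<close> at y depends only on the place below y of a
  finite Galois extension \<open>L\<close> containing \<open>a\<close>. The places of
  \<open>L\<close> above v form a discrete space, so over each v the set is the preimage of an open
  cylinder, whatever \<open>P\<close> and \<open>Q\<close> are.\<close>

lemma openin_Y_topology_level:
  "openin Y_topology {y \<in> \<Y>. Q (place_below \<rat> y) \<and> P (norm_at y a)}"
  (is "openin _ ?A")
  unfolding openin_Y_topology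
proof (intro conjI ballI)
  let ?m = "\<lambda>y. \<lambda>l\<in>finite_galois_above \<rat>. place_below l y"
  fix v assume v: "v \<in> places \<rat>"
  obtain L where L: "a \<in> L" "galois_extension L \<rat>" "ring.finite_dimension qbar_ring \<rat> L"
    using finite_galois_closure[OF is_subfield_Rats] by blast
  have sL: "is_subfield L" using L(2) by (simp add: galois_extension_def)
  have Lab: "L \<in> finite_galois_above \<rat>"
    using L sL by (simp add: finite_galois_above_def number_field_def galois_extension_def)
  have above: "place_below l y \<in> places_above l \<rat> v" if l: "l \<in> finite_galois_above \<rat>" and y: "y \<in> Y_fibre \<rat> v" for l y
  proof -
    have sl: "is_subfield l" "\<rat> \<subseteq> l" and yY: "y \<in> \<Y>" "place_below \<rat> y = v"
      using l y by (auto simp: finite_galois_above_def number_field_def places_above_def)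
    show ?thesis
      using place_below[OF sl(1) is_subfield_UNIV subset_UNIV yY(1)]
        place_below_trans[OF is_subfield_Rats sl(1) is_subfield_UNIV sl(2) subset_UNIV yY(1)] yY(2)
      by (simp add: places_above_def)
  qed
  define W where "W = {y \<in> Y_fibre \<rat> v. Q v \<and> P (norm_at y a)}"
  define T where "T = product_topology (\<lambda>l. discrete_topology (places_above l \<rat> v)) (finite_galois_above \<rat>)"
  define U where "U = {g \<in> topspace T. g L \<in> place_below L ` W}"
  have "continuous_map T (discrete_topology (places_above L \<rat> v)) (\<lambda>g. g L)"
    unfolding T_def using Lab by (rule continuous_map_product_projection)
  moreover have "openin (discrete_topology (places_above L \<rat> v)) (place_below L ` W)"
    using above[OF Lab] by (auto simp: W_def)
  ultimately have U: "openin T U"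
    unfolding U_def by (rule openin_continuous_map_preimage)
  have "?A \<inter> Y_fibre \<rat> v
    = ?m -` U \<inter> Y_fibre \<rat> v"
  proof (intro Set.set_eqI iffI)
    fix y assume y: "y \<in> ?A \<inter> Y_fibre \<rat> v"
    then have "y \<in> W" by (auto simp: W_def places_above_def)
    moreover have "(\<lambda>l\<in>finite_galois_above \<rat>. place_below l y) \<in> topspace T"
      using above y by (auto simp: T_def)
    ultimately show "y \<in> ?m -` U \<inter> Y_fibre \<rat> v"
      using y Lab by (auto simp: U_def)
  next
    fix y assume y: "y \<in> ?m -` U \<inter> Y_fibre \<rat> v"
    then obtain y' where y': "y' \<in> W" "place_below L y = place_below L y'"
      using Lab by (auto simp: U_def)
    have Y: "y \<in> \<Y>" "y' \<in> \<Y>" "place_below \<rat> y = v" using y y'(1) by (auto simp: W_def places_above_def)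
    have "norm_at y a = norm_at y' a"
      using place_below(2)[OF sL is_subfield_UNIV subset_UNIV Y(1)] place_below(2)[OF sL is_subfield_UNIV subset_UNIV Y(2)]
        y'(2) L(1) by (metis restrict_apply')
    then show "y \<in> ?A \<inter> Y_fibre \<rat> v"
      using y'(1) Y y by (auto simp: W_def)
  qed
  then show "openin (fibre_topology \<rat> v) (?A \<inter> Y_fibre \<rat> v)"
    unfolding fibre_topology_def openin_pullback_topology T_def[symmetric] using U by blast
qed blast

lemma openin_\<Y>: "openin Y_topology \<Y>"
  using openin_Y_topology_level[of "\<lambda>_. True" "\<lambda>_. True"] by simp

lemma topspace_Y_topology: "topspace Y_topology = \<Y>"
  using openin_\<Y> openin_Y_topology by (metis openin_subset openin_topspace subset_antisym)

section \<open>Bounds for minimal polynomials and for their roots\<close>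

lemma root_poly_monic:
  assumes "finite B"
  shows "degree (root_poly B) = card B \<and> lead_coeff (root_poly B) = 1"
  using assms
proof (induction B rule: finite_induct)
  case (insert b B)
  have eq: "root_poly (insert b B) = [:- b, 1:] * root_poly B"
    using insert.hyps by (simp add: root_poly_def)
  have nz: "root_poly B \<noteq> 0" using insert.IH by auto
  have "degree (root_poly (insert b B)) = Suc (card B)"
    unfolding eq using insert.IH nz by (subst degree_mult_eq) auto
  moreover have "lead_coeff (root_poly (insert b B)) = 1"
    unfolding eq lead_coeff_mult conjunct2[OF insert.IH] by simp
  ultimately show ?case using insert.hyps by simp
qed (simp add: root_poly_def)

text \<open>After multiplication by X - b each coefficient is the difference of an old one and b
  times its neighbour, so a factor with \<phi> b = 1 at most doubles the bound.\<close>

lemma root_poly_coeff_bound: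
  assumes \<phi>: "\<phi> \<in> absolute_values UNIV" and "finite B" "\<And>b. b \<in> B \<Longrightarrow> \<phi> b = 1"
  shows "\<phi> (coeff (root_poly B) i) \<le> 2 ^ card B"
  using assms(2,3)
proof (induction B arbitrary: i rule: finite_induct)
  case empty
  then show ?case
    using av_0[OF is_subfield_UNIV \<phi>] av_1[OF is_subfield_UNIV \<phi>] by (auto simp: root_poly_def coeff_pCons split: nat.splits)
next
  case (insert b B)
  have IH: "\<phi> (coeff (root_poly B) j) \<le> 2 ^ card B" for j
    using insert by auto
  have "coeff (root_poly (insert b B)) i =
    (if i = 0 then 0 else coeff (root_poly B) (i - 1)) - b * coeff (root_poly B) i"
    using insert.hyps by (simp add: root_poly_def coeff_pCons split: nat.splits)
  then have "\<phi> (coeff (root_poly (insert b B)) i) =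
    \<phi> ((if i = 0 then 0 else coeff (root_poly B) (i - 1)) + - (b * coeff (root_poly B) i))" by simp
  also have "\<dots> \<le> \<phi> (if i = 0 then 0 else coeff (root_poly B) (i - 1)) + \<phi> (- (b * coeff (root_poly B) i))"
    by (rule av_add[OF is_subfield_UNIV \<phi> UNIV_I UNIV_I])
  also have "\<phi> (- (b * coeff (root_poly B) i)) = \<phi> (coeff (root_poly B) i)"
    using insert.prems[of b] by (simp add: av_uminus[OF is_subfield_UNIV \<phi>] av_mult[OF is_subfield_UNIV \<phi>])
  also have "\<phi> (if i = 0 then 0 else coeff (root_poly B) (i - 1)) \<le> 2 ^ card B"
    using IH[of "i - 1"] by (simp add: av_0[OF is_subfield_UNIV \<phi>])
  finally show ?case using IH[of i] insert.hyps by simp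
qed

context
  fixes a :: qbar
begin

lemma orb_poly_root: "poly (root_poly (orb \<rat> a)) a = 0"
  by (simp add: poly_root_poly_eq_0_iff[OF finite_orb[OF is_subfield_Rats]] mem_orb[OF is_subfield_Rats])

lemma orb_poly_coeff: "coeff (root_poly (orb \<rat> a)) i \<in> \<rat>"
  using root_poly_orb[OF is_subfield_Rats, of a] by (simp add: polys_def)

text \<open>The coefficients of the minimal polynomial of \<open>a\<close> are rational, so their
  values at y depend only on \<open>v\<close>, and the root bound is uniform on the fibre.\<close>

lemma norm_at_bounded_on_fibre: "\<exists>B\<ge>1. \<forall>y\<in>Y_fibre \<rat> v. norm_at y a \<le> B"
proof -
  define p where "p = root_poly (orb \<rat> a)"
  define C where "C = Max (norm_at v ` range (coeff p))"
  have "norm_at y a \<le> max 1 (real (degree p) * C)" if "y \<in> Y_fibre \<rat> v" for y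
  proof (rule av_root_bound)
    have y: "y \<in> \<Y>" "place_below \<rat> y = v" using that by (auto simp: places_above_def)
    show "is_subfield UNIV" by (rule is_subfield_UNIV)
    show "norm_at y \<in> absolute_values UNIV" by (rule norm_at_UNIV[OF y(1)])
    show "p \<in> polys UNIV" by (simp add: polys_def)
    show "lead_coeff p = 1" unfolding p_def using root_poly_monic[OF finite_orb[OF is_subfield_Rats]] by blast
    show "poly p a = 0" unfolding p_def by (rule orb_poly_root)
    show "norm_at y (coeff p i) \<le> C" for i
    proof -
      have "norm_at y (coeff p i) = norm_at v (coeff p i)"
        using place_below_Rats(2)[OF y(1) orb_poly_coeff] y(2) by (simp add: p_def)
      also have "\<dots> \<le> C"
        unfolding C_def
      proof (rule Max_ge)
        show "finite (norm_at v ` range (coeff p))" by (simp add: range_coeff)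
      qed blast
      finally show ?thesis .
    qed
  qed simp
  then show ?thesis by (intro exI[of _ "max 1 (real (degree p) * C)"]) auto
qed

text \<open>Away from the archimedean place and from the finitely many places at which some nonzero
  coefficient of the minimal polynomial is not a unit, \<open>a\<close> is integral.\<close>

lemma finite_fibres_norm_gt_1: "finite {v \<in> places \<rat>. \<exists>y\<in>Y_fibre \<rat> v. norm_at y a > 1}"
proof -
  define p where "p = root_poly (orb \<rat> a)"
  define S where "S i = {v \<in> places \<rat>. norm_at v (coeff p i) \<noteq> 1}" for i
  define I where "I = {i. i \<le> degree p \<and> coeff p i \<noteq> 0}"
  have fin: "finite (S i)" if "i \<in> I" for i
  proof -
    obtain r where r: "coeff p i = of_rat r" using orb_poly_coeff[of i] unfolding p_def by (rule Rats_cases)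
    then have "r \<noteq> 0" using that by (auto simp: I_def)
    then show ?thesis unfolding S_def r by (rule finite_places_Rats)
  qed
  have "{v \<in> places \<rat>. \<exists>y\<in>Y_fibre \<rat> v. norm_at y a > 1} \<subseteq> insert archimedean_place (\<Union>i\<in>I. S i)"
  proof (rule subsetI, rule ccontr)
    fix v assume "v \<in> {v \<in> places \<rat>. \<exists>y\<in>Y_fibre \<rat> v. norm_at y a > 1}"
    then obtain y where v: "v \<in> places \<rat>" and y: "y \<in> \<Y>" "place_below \<rat> y = v" "norm_at y a > 1"
      by (auto simp: places_above_def)
    assume nv: "v \<notin> insert archimedean_place (\<Union>i\<in>I. S i)"
    then obtain q where q: "Factorial_Ring.prime q" "v = padic_place q"
      using v by (auto elim: places_Rats_cases)
    note av = norm_at_UNIV[OF y(1)]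
    have c: "norm_at y (coeff p i) = (if coeff p i = 0 then 0 else 1)" for i
    proof (cases "coeff p i = 0")
      case False
      then have "i \<in> I" using le_degree by (auto simp: I_def)
      then have "norm_at v (coeff p i) = 1" using nv v by (auto simp: S_def)
      then show ?thesis using place_below_Rats(2)[OF y(1) orb_poly_coeff[of i]] y(2) False by (simp add: p_def)
    qed (simp add: av_0[OF is_subfield_UNIV av])
    have "norm_at y a \<le> 1"
    proof (rule av_root_le_1[OF is_subfield_UNIV av])
      show "norm_at y (of_nat n) \<le> 1" for n
        using place_below_Rats(2)[OF y(1), of "of_nat n"] y(2) q padic_place(2)[OF q(1), of "of_nat n"]
          padic_abs_of_int_le_1[OF q(1), of "int n"] by simp
      show "poly p a = 0" unfolding p_def by (rule orb_poly_root)
      show p0: "p \<noteq> 0" using root_poly_monic[OF finite_orb[OF is_subfield_Rats, of a]] by (auto simp: p_def)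
      show "norm_at y (lead_coeff p) = 1" using p0 by (simp add: c)
      show "norm_at y (coeff p i) \<le> 1" for i by (simp add: c)
    qed (auto simp: polys_def)
    with y(3) show False by simp
  qed
  moreover have "finite I" by (simp add: I_def)
  then have "finite (insert archimedean_place (\<Union>i\<in>I. S i))" using fin by simp
  ultimately show ?thesis by (rule finite_subset)
qed

end


section \<open>Integration over the set of places\<close>

context
  fixes lam assumes weil: "weil_measure lam"
begin

lemma sets_weil: "sets lam = sets (sigma \<Y> {V. openin Y_topology V})"
  using weil by (simp add: weil_measure_def regular_borel_def topspace_Y_topology)

lemma space_weil: "space lam = \<Y>"
  using sets_eq_imp_space_eq[OF sets_weil] openin_subset[of Y_topology]
  by (simp add: space_measure_of_conv)

lemma openin_sets_weil:
  assumes "openin Y_topology V" shows "V \<in> sets lam"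
proof -
  have "{V. openin Y_topology V} \<subseteq> Pow \<Y>"
    using openin_subset[of Y_topology] by (auto simp: topspace_Y_topology)
  then show ?thesis unfolding sets_weil using assms by (simp add: sigma_sets.Basic)
qed

lemma Y_fibre_sets: "Y_fibre \<rat> v \<in> sets lam"
  using openin_sets_weil[OF openin_Y_topology_level[of "\<lambda>w. w = v" "\<lambda>_. True"]] by (simp add: places_above_def)

lemma emeasure_Y_fibre: "v \<in> places \<rat> \<Longrightarrow> emeasure lam (Y_fibre \<rat> v) = 1"
  using weil number_field_Rats local_degree_Rats[of v] global_degree_Rats by (simp add: weil_measure_def)

text \<open>The sets of places on which \<open>a\<close> has a prescribed range of absolute values
  are open, so preimages of arbitrary sets of reals are measurable.\<close>

lemma lognorm_measurable: "lognorm a \<in> borel_measurable lam"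
proof (rule measurableI)
  fix B :: "real set"
  have "lognorm a -` B \<inter> space lam = {y \<in> \<Y>. True \<and> ln (norm_at y a) \<in> B}"
    by (auto simp: lognorm_def space_weil)
  then show "lognorm a -` B \<inter> space lam \<in> sets lam"
    using openin_sets_weil[OF openin_Y_topology_level[of "\<lambda>_. True" "\<lambda>x. ln x \<in> B" a]] by simp
qed simp

text \<open>Upper bounds for \<open>a\<close> and for its inverse together bound the logarithm from
  both sides; outside the finitely many exceptional fibres both values are at most 1, hence equal to
  1.\<close>

lemma lognorm_support:
  assumes a: "a \<noteq> 0"
  obtains V C where "finite V" "V \<subseteq> places \<rat>" "\<And>y. y \<in> \<Y> \<Longrightarrow> place_below \<rat> y \<notin> V \<Longrightarrow> lognorm a y = 0"
    "\<And>y. \<bar>lognorm a y\<bar> \<le> C"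
proof -
  define V where "V = {v \<in> places \<rat>. \<exists>y\<in>Y_fibre \<rat> v. norm_at y a > 1} \<union> {v \<in> places \<rat>. \<exists>y\<in>Y_fibre \<rat> v. norm_at y (inverse a) > 1}"
  have V: "finite V" "V \<subseteq> places \<rat>" using finite_fibres_norm_gt_1 by (auto simp: V_def)
  have zero: "lognorm a y = 0" if y: "y \<in> \<Y>" "place_below \<rat> y \<notin> V" for y
  proof -
    have pos: "norm_at y a > 0" using norm_at_pos[OF y(1) a] .
    have "y \<in> Y_fibre \<rat> (place_below \<rat> y)" "place_below \<rat> y \<in> places \<rat>"
      using y place_below_Rats(1)[OF y(1)] by (auto simp: places_above_def)
    then have "norm_at y a \<le> 1" "norm_at y (inverse a) \<le> 1"
      using y(2) unfolding V_def by (auto simp: not_less[symmetric])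
    then have "norm_at y a = 1"
      using pos by (simp add: norm_at_inverse[OF y(1)] inverse_le_1_iff)
    then show ?thesis by (simp add: lognorm_def)
  qed
  have "\<exists>C\<ge>0. \<forall>y\<in>Y_fibre \<rat> v. \<bar>lognorm a y\<bar> \<le> C" for v
  proof -
    obtain B1 where B1: "B1 \<ge> 1" "\<And>y. y \<in> Y_fibre \<rat> v \<Longrightarrow> norm_at y a \<le> B1" using norm_at_bounded_on_fibre by blast
    obtain B2 where B2: "B2 \<ge> 1" "\<And>y. y \<in> Y_fibre \<rat> v \<Longrightarrow> norm_at y (inverse a) \<le> B2" using norm_at_bounded_on_fibre by blast
    have "\<bar>lognorm a y\<bar> \<le> ln B1 + ln B2" if "y \<in> Y_fibre \<rat> v" for y
    proof -
      have y: "y \<in> \<Y>" using that by (simp add: places_above_def)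
      have pos: "norm_at y a > 0" using norm_at_pos[OF y a] .
      have "ln (norm_at y a) \<le> ln B1" using pos B1 B1(2)[OF that] by simp
      moreover have "ln (inverse (norm_at y a)) \<le> ln B2"
        using pos B2 B2(2)[OF that] by (subst ln_le_cancel_iff) (auto simp: norm_at_inverse[OF y])
      moreover have "0 \<le> ln B1" "0 \<le> ln B2" using B1 B2 by auto
      ultimately show ?thesis using y pos by (simp add: lognorm_def ln_inverse)
    qed
    then show ?thesis using B1 B2 by (intro exI[of _ "ln B1 + ln B2"]) auto
  qed
  then obtain C where C: "\<And>v. C v \<ge> 0" "\<And>v y. y \<in> Y_fibre \<rat> v \<Longrightarrow> \<bar>lognorm a y\<bar> \<le> C v" by metis
  have nn: "0 \<le> (\<Sum>v\<in>V. C v)" using C(1) by (intro sum_nonneg) auto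
  have "\<bar>lognorm a y\<bar> \<le> (\<Sum>v\<in>V. C v)" for y
  proof (cases "y \<in> \<Y> \<and> place_below \<rat> y \<in> V")
    case True
    then have "\<bar>lognorm a y\<bar> \<le> C (place_below \<rat> y)" by (intro C(2)) (simp add: places_above_def)
    also have "\<dots> \<le> (\<Sum>v\<in>V. C v)" using True V C(1) by (intro member_le_sum) auto
    finally show ?thesis .
  next
    case False
    then have "lognorm a y = 0" using zero[of y] by (auto simp: lognorm_def)
    then show ?thesis using nn by simp
  qed
  with V zero show thesis by (rule that)
qed

lemma integrable_lognorm:
  assumes "a \<noteq> 0" shows "integrable lam (lognorm a)"
proof -
  obtain V C where V: "finite V" "V \<subseteq> places \<rat>" "\<And>y. y \<in> \<Y> \<Longrightarrow> place_below \<rat> y \<notin> V \<Longrightarrow> lognorm a y = 0"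
    and C: "\<And>y. \<bar>lognorm a y\<bar> \<le> C" using lognorm_support[OF assms] by blast
  define A where "A = (\<Union>v\<in>V. Y_fibre \<rat> v)"
  have A: "A \<in> sets lam" unfolding A_def using V(1) Y_fibre_sets by blast
  have "emeasure lam A \<le> (\<Sum>v\<in>V. emeasure lam (Y_fibre \<rat> v))"
    unfolding A_def using V(1) Y_fibre_sets by (intro emeasure_subadditive_finite) auto
  also have "\<dots> = (\<Sum>v\<in>V. 1)" using V(2) emeasure_Y_fibre by (intro sum.cong) auto
  also have "\<dots> < \<infinity>" using V(1) by (simp add: of_nat_less_top)
  finally have "emeasure lam A < \<infinity>" .
  then show ?thesis
  proof (rule integrableI_bounded_set[OF A lognorm_measurable])
    show "AE y in lam. y \<in> A \<longrightarrow> norm (lognorm a y) \<le> C" using C by simp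
    show "AE y in lam. y \<notin> A \<longrightarrow> lognorm a y = 0"
      using V(3) by (intro AE_I2) (auto simp: space_weil A_def places_above_def)
  qed
qed

lemma \<F>_integrable: "F \<in> \<F> \<Longrightarrow> integrable lam F"
  using integrable_lognorm by (auto elim: \<F>_cases)

text \<open>Level sets of \<open>lognorm (\<tau> a)\<close> are the \<tau>-translates of those of
  \<open>lognorm a\<close>, and the measure is Galois invariant. Equality of distributions covers
  the integral and the L1-norm at once.\<close>

lemma distr_lognorm_conj:
  assumes \<tau>: "\<tau> \<in> abs_galois \<rat>"
  shows "distr lam borel (lognorm (\<tau> a)) = distr lam borel (lognorm a)"
proof (rule measure_eqI)
  fix B assume "B \<in> sets (distr lam borel (lognorm (\<tau> a)))"
  then have B: "B \<in> sets borel" by simp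
  have "lognorm (\<tau> a) -` B \<inter> space lam = act \<tau> ` (lognorm a -` B \<inter> space lam)"
  proof (intro Set.set_eqI iffI)
    fix y assume "y \<in> lognorm (\<tau> a) -` B \<inter> space lam"
    then have y: "y \<in> \<Y>" "lognorm (\<tau> a) y \<in> B" by (auto simp: space_weil)
    have "act (inv_into UNIV \<tau>) y \<in> lognorm a -` B \<inter> space lam"
      using act_inv_place(1)[OF \<tau> y(1)] y(2) by (simp add: space_weil lognorm_act[OF \<tau> y(1)])
    then show "y \<in> act \<tau> ` (lognorm a -` B \<inter> space lam)"
      using act_inv_place(3)[OF \<tau> y(1)] by (metis image_eqI)
  next
    fix y assume "y \<in> act \<tau> ` (lognorm a -` B \<inter> space lam)"
    then obtain z where z: "y = act \<tau> z" "z \<in> \<Y>" "lognorm a z \<in> B" by (auto simp: space_weil)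
    note y = act_place[OF \<tau> z(2)]
    have "lognorm (\<tau> a) y = lognorm a z"
      using z y by (simp add: lognorm_def inv_abs_galois_left[OF \<tau>])
    then show "y \<in> lognorm (\<tau> a) -` B \<inter> space lam" using z y by (simp add: space_weil)
  qed
  moreover have "lognorm a -` B \<inter> space lam \<in> sets lam"
    using lognorm_measurable B by (rule measurable_sets)
  ultimately show "emeasure (distr lam borel (lognorm (\<tau> a))) B = emeasure (distr lam borel (lognorm a)) B"
    using weil \<tau> B by (simp add: emeasure_distr lognorm_measurable weil_measure_def)
qed simp

lemma integral_lognorm_conj:
  fixes h :: "real \<Rightarrow> real"
  assumes \<tau>: "\<tau> \<in> abs_galois \<rat>" and h: "h \<in> borel_measurable borel"
  shows "(LINT y|lam. h (lognorm (\<tau> a) y)) = (LINT y|lam. h (lognorm a y))"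
  using integral_distr[OF lognorm_measurable h, of "\<tau> a"] integral_distr[OF lognorm_measurable h, of a]
  by (simp add: distr_lognorm_conj[OF \<tau>])

text \<open>Only two fibres contribute: ln q over the archimedean place and - ln q over the place of
  q, and both fibres have mass 1.\<close>

lemma integral_lognorm_prime:
  assumes q: "Factorial_Ring.prime q"
  shows "(LINT y|lam. lognorm (of_nat q) y) = 0"
proof -
  have q1: "q > 1" using prime_gt_1_nat[OF q] .
  have padic: "norm_at (padic_place p) (of_nat q) = (if p = q then 1 / real q else 1)" if p: "Factorial_Ring.prime p" for p
  proof (cases "p = q")
    case False
    then have "\<not> int p dvd int q" using primes_dvd_imp_eq[OF p q] by auto
    then show ?thesis
      using padic_place(2)[OF p, of "of_nat q"] padic_abs_of_int_eq_1_iff[OF p, of "int q"] False by simp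
  qed (use padic_place(2)[OF p, of "of_nat q"] padic_abs_self[OF p] in simp)
  have arch: "norm_at archimedean_place (of_nat q) = real q"
    using archimedean_place(2)[of "of_nat q"] by simp
  have ne: "archimedean_place \<noteq> padic_place p" if p: "Factorial_Ring.prime p" for p
  proof
    assume "archimedean_place = padic_place p"
    then have "real q = (if p = q then 1 / real q else 1)" using padic[OF p] arch by simp
    moreover have "(if p = q then 1 / real q else 1) \<le> 1" using q1 by simp
    ultimately show False using q1 by linarith
  qed
  have eq: "lognorm (of_nat q) y = ln (real q) * indicator (Y_fibre \<rat> archimedean_place) y - ln (real q) * indicator (Y_fibre \<rat> (padic_place q)) y"
    if y: "y \<in> space lam" for y
  proof -
    have y: "y \<in> \<Y>" using y by (simp add: space_weil)
    have n: "norm_at y (of_nat q) = norm_at (place_below \<rat> y) (of_nat q)"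
      by (rule place_below_Rats(2)[OF y]) simp
    have ind: "indicator (Y_fibre \<rat> w) y = (if place_below \<rat> y = w then 1 else 0 :: real)" for w
      using y by (simp add: places_above_def indicator_def)
    have ln: "lognorm (of_nat q) y = ln (norm_at (place_below \<rat> y) (of_nat q))"
      using y n by (simp add: lognorm_def)
    show ?thesis
      using place_below_Rats(1)[OF y]
    proof (cases rule: places_Rats_cases)
      case 1
      then show ?thesis using ne[OF q] by (simp add: ln ind arch)
    next
      case (2 p)
      show ?thesis
      proof (cases "p = q")
        case True
        then show ?thesis using 2 ne[OF q] padic[OF q] q1 by (simp add: ln ind ln_div)
      next
        case False
        then have "padic_place p \<noteq> padic_place q"
          using padic[OF 2(1)] padic[OF q] q1 by auto
        then show ?thesis using 2 False padic[OF 2(1)] ne[OF 2(1)] by (simp add: ln ind)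
      qed
    qed
  qed
  have m: "measure lam (Y_fibre \<rat> v) = 1" if "v \<in> places \<rat>" for v
    using emeasure_Y_fibre[OF that] by (simp add: measure_def)
  have int: "integrable lam (\<lambda>y. ln (real q) * indicator (Y_fibre \<rat> v) y)" if "v \<in> places \<rat>" for v
    using emeasure_Y_fibre[OF that] Y_fibre_sets by (intro integrable_mult_right integrable_real_indicator) auto
  have "(LINT y|lam. lognorm (of_nat q) y) = (LINT y|lam. ln (real q) * indicator (Y_fibre \<rat> archimedean_place) y
      - ln (real q) * indicator (Y_fibre \<rat> (padic_place q)) y)"
    using eq by (rule Bochner_Integration.integral_cong[OF refl])
  also have "\<dots> = (LINT y|lam. ln (real q) * indicator (Y_fibre \<rat> archimedean_place) y)
      - (LINT y|lam. ln (real q) * indicator (Y_fibre \<rat> (padic_place q)) y)"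
    by (rule Bochner_Integration.integral_diff[OF int[OF archimedean_place(1)] int[OF padic_place(1)[OF q]]])
  also have "\<dots> = 0"
    by (simp add: Y_fibre_sets sets.Int_space_eq2 m[OF archimedean_place(1)] m[OF padic_place(1)[OF q]])
  finally show ?thesis .
qed

lemma integral_lognorm_mult:
  "a \<noteq> 0 \<Longrightarrow> b \<noteq> 0 \<Longrightarrow> (LINT y|lam. lognorm (a * b) y) = (LINT y|lam. lognorm a y) + (LINT y|lam. lognorm b y)"
  by (simp add: lognorm_mult integrable_lognorm)

lemma integral_lognorm_1: "(LINT y|lam. lognorm 1 y) = 0"
  by (simp add: lognorm_1)

lemma integral_lognorm_nat: "n > 0 \<Longrightarrow> (LINT y|lam. lognorm (of_nat n) y) = 0"
proof (induction n rule: less_induct)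
  case (less n)
  show ?case
  proof (cases "n = 1")
    case True
    then show ?thesis using integral_lognorm_1 by simp
  next
    case False
    then obtain q where q: "Factorial_Ring.prime q" "q dvd n" using prime_factor_nat by blast
    then obtain m where m: "n = q * m" by blast
    have "m > 0" "m < n" using less.prems m prime_gt_1_nat[OF q(1)] by (auto intro: Nat.gr0I)
    then show ?thesis
      using less.IH[of m] integral_lognorm_prime[OF q(1)] prime_gt_0_nat[OF q(1)] integral_lognorm_mult[of "of_nat q" "of_nat m"]
      by (simp add: m)
  qed
qed

lemma integral_lognorm_Rats:
  assumes "x \<in> \<rat>" "x \<noteq> 0"
  shows "(LINT y|lam. lognorm x y) = 0"
proof -
  have m1: "(LINT y|lam. lognorm (- 1) y) = 0"
    using integral_lognorm_mult[of "- 1" "- 1"] integral_lognorm_1 by simp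
  have int: "(LINT y|lam. lognorm (of_int i) y) = 0" if "i \<noteq> 0" for i
  proof (cases i rule: int_cases2)
    case (nonneg n)
    then show ?thesis using that integral_lognorm_nat[of n] by simp
  next
    case (nonpos n)
    then show ?thesis using that integral_lognorm_nat[of n] integral_lognorm_mult[of "- 1" "of_nat n"] m1 by simp
  qed
  obtain r where r: "x = of_rat r" using assms(1) by (rule Rats_cases)
  obtain i j where ij: "r = of_int i / of_int j" "j \<noteq> 0" by (rule rat_int_quotient)
  have x: "x = of_int i / of_int j" using r ij by (simp add: of_rat_divide)
  have i: "i \<noteq> 0" using x assms(2) by auto
  have "x * of_int j = of_int i" using x ij(2) by simp
  then show ?thesis
    using integral_lognorm_mult[of x "of_int j"] int[OF i] int[OF ij(2)] assms(2) ij(2) by simp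
qed

lemma product_formula:
  assumes a: "a \<noteq> 0"
  shows "(LINT y|lam. lognorm a y) = 0"
proof -
  have nz: "b \<noteq> 0" if "b \<in> orb \<rat> a" for b
    using that a abs_galois_eq_0_iff by (auto simp: orbit_in_def)
  have "real (card (orb \<rat> a)) * (LINT y|lam. lognorm a y) = (\<Sum>b\<in>orb \<rat> a. (LINT y|lam. lognorm b y))"
  proof -
    have "(LINT y|lam. lognorm b y) = (LINT y|lam. lognorm a y)" if "b \<in> orb \<rat> a" for b
      using that integral_lognorm_conj[of _ "\<lambda>x. x" a] by (auto simp: orbit_in_def)
    then show ?thesis by simp
  qed
  also have "\<dots> = (LINT y|lam. (\<Sum>b\<in>orb \<rat> a. lognorm b y))"
    using nz integrable_lognorm by (intro Bochner_Integration.integral_sum[symmetric]) auto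
  also have "\<dots> = (LINT y|lam. lognorm (\<Prod>b\<in>orb \<rat> a. b) y)"
  proof -
    have "(\<Sum>b\<in>orb \<rat> a. lognorm b y) = lognorm (\<Prod>b\<in>orb \<rat> a. b) y" for y
      using fun_cong[OF lognorm_prod[of "orb \<rat> a" "\<lambda>b. b", OF nz], of y] unfolding sum_funs_apply by simp
    then show ?thesis by simp
  qed
  also have "\<dots> = 0"
    using nz finite_orb[OF is_subfield_Rats] by (intro integral_lognorm_Rats prod_orb_mem[OF is_subfield_Rats]) auto
  finally show ?thesis using card_orb_pos[OF is_subfield_Rats, of a] by simp
qed

lemma \<F>_subset_\<X>: "\<F> \<subseteq> \<X> lam"
  using product_formula integrable_lognorm by (auto simp: \<X>_def elim!: \<F>_cases)

text \<open>Conjugates have the same L1-norm, and this norm is 0 exactly for functions vanishing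
  almost everywhere.\<close>

lemma lognorm_AE_0_conj:
  assumes a: "a \<noteq> 0" and \<tau>: "\<tau> \<in> abs_galois \<rat>" and ae: "AE y in lam. lognorm a y = 0"
  shows "AE y in lam. lognorm (\<tau> a) y = 0"
proof -
  have "(LINT y|lam. \<bar>lognorm (\<tau> a) y\<bar>) = (LINT y|lam. \<bar>lognorm a y\<bar>)"
    by (rule integral_lognorm_conj[OF \<tau>]) simp
  also have "\<dots> = 0" using ae by (intro integral_eq_zero_AE) auto
  finally have "(LINT y|lam. \<bar>lognorm (\<tau> a) y\<bar>) = 0" .
  moreover have "integrable lam (\<lambda>y. \<bar>lognorm (\<tau> a) y\<bar>)"
    using a by (intro integrable_abs integrable_lognorm) (simp add: abs_galois_eq_0_iff[OF \<tau>])
  ultimately show ?thesis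
    by (simp add: integral_nonneg_eq_0_iff_AE)
qed

text \<open>If all conjugates of \<open>a\<close> have absolute value \<open>1\<close> at one place above \<open>v\<close>, then the minimal
  polynomials of the powers of \<open>a\<close> have coefficients that are bounded at \<open>v\<close>; so the powers of \<open>a\<close>
  are bounded at every place above \<open>v\<close>.\<close>

lemma norm_at_le_1:
  assumes y0: "y0 \<in> \<Y>" and one: "\<And>b. b \<in> orb \<rat> a \<Longrightarrow> norm_at y0 b = 1"
    and y: "y \<in> \<Y>" and below: "place_below \<rat> y = place_below \<rat> y0"
  shows "norm_at y a \<le> 1"
proof (rule power_growth_le[where A = 0])
  \<comment> \<open>Every power of \<open>a\<close> has at most \<open>D\<close> conjugates, so the
    degrees and coefficients of the minimal polynomials of all the powers obey one bound independent
    of the exponent.\<close>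
  define D where "D = card (orb \<rat> a)"
  fix n
  let ?B = "orb \<rat> (a ^ n)"
  have pow: "\<tau> (a ^ n) = \<tau> a ^ n" if "\<tau> \<in> abs_galois \<rat>" for \<tau> and n :: nat
    by (induction n) (auto simp: abs_galois_1[OF that] abs_galois_mult[OF that])
  have B: "?B = (\<lambda>b. b ^ n) ` orb \<rat> a"
    by (auto simp: orbit_in_def pow image_image intro!: image_cong)
  have fin: "finite ?B" by (rule finite_orb[OF is_subfield_Rats])
  have card: "card ?B \<le> D" unfolding B D_def by (rule card_image_le[OF finite_orb[OF is_subfield_Rats]])
  have B1: "norm_at y0 b = 1" if "b \<in> ?B" for b
    using that one by (auto simp: B norm_at_power[OF y0])
  have C: "norm_at y (coeff (root_poly ?B) i) \<le> 2 ^ D" for i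
  proof -
    have "norm_at y (coeff (root_poly ?B) i) = norm_at y0 (coeff (root_poly ?B) i)"
      using place_below_Rats(2)[OF y orb_poly_coeff] place_below_Rats(2)[OF y0 orb_poly_coeff] below by simp
    also have "\<dots> \<le> 2 ^ card ?B"
      using B1 by (rule root_poly_coeff_bound[OF norm_at_UNIV[OF y0] fin])
    also have "\<dots> \<le> (2::real) ^ D" using card by (intro power_increasing) auto
    finally show ?thesis .
  qed
  have "norm_at y (a ^ n) \<le> max 1 (real (degree (root_poly ?B)) * 2 ^ D)"
    using C root_poly_monic[OF fin]
    by (intro av_root_bound[OF is_subfield_UNIV norm_at_UNIV[OF y]] orb_poly_root) (auto simp: polys_def)
  also have "\<dots> \<le> max 1 (real D * 2 ^ D)"
    using root_poly_monic[OF fin] card by (intro max.mono mult_right_mono) auto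
  finally show "norm_at y a ^ n \<le> (0 * real n + max 1 (real (card (orb \<rat> a)) * 2 ^ card (orb \<rat> a))) * 1 ^ n"
    by (simp add: norm_at_power[OF y] D_def)
qed simp

text \<open>The orbit being finite, one null set contains every place at which some conjugate has
  nonzero logarithm, and it cannot cover a fibre of mass 1. A place of the fibre outside it controls
  both \<open>a\<close> and its inverse on the entire fibre.\<close>

lemma lognorm_AE_0:
  assumes a: "a \<noteq> 0" and ae: "AE y in lam. lognorm a y = 0"
  shows "lognorm a = 0"
proof
  fix y
  show "lognorm a y = 0 y"
  proof (cases "y \<in> \<Y>")
    case y: True
    define v where "v = place_below \<rat> y"
    have v: "v \<in> places \<rat>" unfolding v_def by (rule place_below_Rats(1)[OF y])
    have "AE z in lam. \<forall>b\<in>orb \<rat> a. lognorm b z = 0"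
      using finite_orb[OF is_subfield_Rats] lognorm_AE_0_conj[OF a _ ae]
      by (subst AE_finite_all) (auto simp: orbit_in_def)
    then obtain N where N: "{z \<in> space lam. \<not> (\<forall>b\<in>orb \<rat> a. lognorm b z = 0)} \<subseteq> N" "emeasure lam N = 0" "N \<in> sets lam"
      by (rule AE_E)
    have "\<not> Y_fibre \<rat> v \<subseteq> N"
    proof
      assume "Y_fibre \<rat> v \<subseteq> N"
      then have "emeasure lam (Y_fibre \<rat> v) \<le> emeasure lam N" using N(3) by (rule emeasure_mono)
      then show False using emeasure_Y_fibre[OF v] N(2) by simp
    qed
    then obtain y0 where y0: "y0 \<in> \<Y>" "place_below \<rat> y0 = v" "\<And>b. b \<in> orb \<rat> a \<Longrightarrow> lognorm b y0 = 0"
      using N(1) by (auto simp: places_above_def space_weil)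
    have one: "norm_at y0 b = 1" if "b \<in> orb \<rat> a" for b
    proof -
      have "b \<noteq> 0" using that a abs_galois_eq_0_iff by (auto simp: orbit_in_def)
      then have "norm_at y0 b > 0" using norm_at_pos[OF y0(1)] by simp
      then show ?thesis using y0(3)[OF that] y0(1) by (simp add: lognorm_def)
    qed
    have one': "norm_at y0 b = 1" if "b \<in> orb \<rat> (inverse a)" for b
    proof -
      have "inverse b \<in> orb \<rat> a"
        using that by (auto simp: orbit_in_def abs_galois_inverse image_iff)
      from one[OF this] show ?thesis by (simp add: norm_at_inverse[OF y0(1)])
    qed
    have "norm_at y a \<le> 1" "norm_at y (inverse a) \<le> 1"
      using norm_at_le_1[OF y0(1) one y] norm_at_le_1[OF y0(1) one' y] y0(2) v_def by auto
    moreover have "norm_at y a > 0" using norm_at_pos[OF y a] .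
    ultimately have "norm_at y a = 1"
      by (simp add: norm_at_inverse[OF y] inverse_le_1_iff)
    then show ?thesis by (simp add: lognorm_def)
  qed (simp add: lognorm_def)
qed

lemma \<F>_AE_0: "F \<in> \<F> \<Longrightarrow> AE y in lam. F y = 0 \<Longrightarrow> F = 0"
  using lognorm_AE_0 by (auto elim!: \<F>_cases)

end

section \<open>Sums of ranges of commuting projections\<close>

context
  fixes lam assumes weil: "weil_measure lam"
begin

lemma U_op_contractive:
  assumes K: "is_subfield K" "haar_probability K nu" and F: "F \<in> \<F>"
  shows "(LINT y|lam. \<bar>U_op nu F y\<bar>) \<le> (LINT y|lam. \<bar>F y\<bar>)"
proof -
  obtain a where a: "a \<noteq> 0" "F = lognorm a" using F by (rule \<F>_cases)
  define n where "n = real (card (orb K a))"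
  have n: "n > 0" using card_orb_pos[OF K(1)] by (simp add: n_def)
  have int: "integrable lam (\<lambda>y. \<bar>lognorm b y\<bar>)"
    and conj: "(LINT y|lam. \<bar>lognorm b y\<bar>) = (LINT y|lam. \<bar>lognorm a y\<bar>)" if "b \<in> orb K a" for b
  proof -
    from that obtain \<tau> where \<tau>: "\<tau> \<in> abs_galois K" "b = \<tau> a" by (auto simp: orbit_in_def)
    then have \<tau>Q: "\<tau> \<in> abs_galois \<rat>" using abs_galois_mono[OF Rats_subset_subfield[OF K(1)]] by blast
    show "integrable lam (\<lambda>y. \<bar>lognorm b y\<bar>)"
      using a(1) \<tau> by (intro integrable_abs integrable_lognorm[OF weil]) (simp add: abs_galois_eq_0_iff)
    show "(LINT y|lam. \<bar>lognorm b y\<bar>) = (LINT y|lam. \<bar>lognorm a y\<bar>)"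
      unfolding \<tau>(2) by (rule integral_lognorm_conj[OF weil \<tau>Q]) simp
  qed
  have "(LINT y|lam. \<bar>U_op nu F y\<bar>) \<le> (LINT y|lam. (\<Sum>b\<in>orb K a. \<bar>lognorm b y\<bar>) / n)"
  proof (rule integral_mono)
    show "integrable lam (\<lambda>y. \<bar>U_op nu F y\<bar>)"
      by (intro integrable_abs \<F>_integrable[OF weil] U_op_\<F>[OF K F])
    show "integrable lam (\<lambda>y. (\<Sum>b\<in>orb K a. \<bar>lognorm b y\<bar>) / n)"
      using int by (intro Bochner_Integration.integrable_divide Bochner_Integration.integrable_sum)
    show "\<bar>U_op nu F y\<bar> \<le> (\<Sum>b\<in>orb K a. \<bar>lognorm b y\<bar>) / n" for y
      using n sum_abs[of "\<lambda>b. lognorm b y" "orb K a"]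
      by (simp add: a(2) U_op_lognorm[OF K] n_def[symmetric] abs_divide divide_right_mono)
  qed
  also have "\<dots> = (\<Sum>b\<in>orb K a. (LINT y|lam. \<bar>lognorm b y\<bar>)) / n"
    using int by (simp add: Bochner_Integration.integral_sum)
  also have "\<dots> = (LINT y|lam. \<bar>F y\<bar>)"
    using conj n by (simp add: a(2) n_def)
  finally show ?thesis .
qed

lemma L1_diff_le:
  assumes "F \<in> \<F>" "H \<in> \<F>"
  shows "(LINT y|lam. \<bar>F y - H y\<bar>) \<le> (LINT y|lam. \<bar>F y\<bar>) + (LINT y|lam. \<bar>H y\<bar>)"
proof -
  have int: "integrable lam F" "integrable lam H" using \<F>_integrable[OF weil] assms by auto
  have "(LINT y|lam. \<bar>F y - H y\<bar>) \<le> (LINT y|lam. \<bar>F y\<bar> + \<bar>H y\<bar>)"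
    using int by (intro integral_mono) auto
  also have "\<dots> = (LINT y|lam. \<bar>F y\<bar>) + (LINT y|lam. \<bar>H y\<bar>)"
    using int by simp
  finally show ?thesis .
qed

lemma L1_zero: "F \<in> \<F> \<Longrightarrow> (LINT y|lam. \<bar>F y\<bar>) \<le> 0 \<Longrightarrow> F = 0"
proof (rule \<F>_AE_0[OF weil])
  assume F: "F \<in> \<F>" and le: "(LINT y|lam. \<bar>F y\<bar>) \<le> 0"
  have "(LINT y|lam. \<bar>F y\<bar>) = 0"
    using le by (intro antisym integral_nonneg_AE) auto
  then show "AE y in lam. F y = 0"
    using integrable_abs[OF \<F>_integrable[OF weil F]] by (simp add: integral_nonneg_eq_0_iff_AE)
qed

section \<open>Commuting bounded projections on \<F>\<close>

context
  fixes Q :: "nat \<Rightarrow> (place \<Rightarrow> real) \<Rightarrow> place \<Rightarrow> real" and N :: nat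
  assumes Q_mem: "\<And>i F. i \<in> {1..N} \<Longrightarrow> F \<in> \<F> \<Longrightarrow> Q i F \<in> \<F>"
    and Q_diff: "\<And>i F H. i \<in> {1..N} \<Longrightarrow> F \<in> \<F> \<Longrightarrow> H \<in> \<F> \<Longrightarrow> Q i (F - H) = Q i F - Q i H"
    and Q_idem: "\<And>i F. i \<in> {1..N} \<Longrightarrow> F \<in> \<F> \<Longrightarrow> Q i (Q i F) = Q i F"
    and Q_comm: "\<And>i j F. i \<in> {1..N} \<Longrightarrow> j \<in> {1..N} \<Longrightarrow> F \<in> \<F> \<Longrightarrow> Q i (Q j F) = Q j (Q i F)"
    and Q_bound: "\<And>i F. i \<in> {1..N} \<Longrightarrow> F \<in> \<F> \<Longrightarrow> (LINT y|lam. \<bar>Q i F y\<bar>) \<le> 2 * (LINT y|lam. \<bar>F y\<bar>)"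
begin

text \<open>The product (1 - Q n) ... (1 - Q 1) applied to \<open>F\<close>, with the factors taken
  one at a time so that an induction step adds one range.\<close>

primrec residual :: "nat \<Rightarrow> (place \<Rightarrow> real) \<Rightarrow> place \<Rightarrow> real" where
  "residual 0 F = F"
| "residual (Suc n) F = residual n F - Q (Suc n) (residual n F)"

lemma residual_mem: "n \<le> N \<Longrightarrow> F \<in> \<F> \<Longrightarrow> residual n F \<in> \<F>"
  by (induction n) (auto intro!: \<F>_diff Q_mem)

lemma residual_diff:
  "n \<le> N \<Longrightarrow> F \<in> \<F> \<Longrightarrow> H \<in> \<F> \<Longrightarrow> residual n (F - H) = residual n F - residual n H"
  by (induction n) (auto simp: Q_diff residual_mem)

lemma residual_Q:
  "n \<le> N \<Longrightarrow> i \<in> {1..N} \<Longrightarrow> F \<in> \<F> \<Longrightarrow> residual n (Q i F) = Q i (residual n F)"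
proof (induction n)
  case (Suc n)
  then have "residual n (Q i F) = Q i (residual n F)" by simp
  moreover have "Q (Suc n) (Q i (residual n F)) = Q i (Q (Suc n) (residual n F))"
    using Suc.prems by (intro Q_comm residual_mem) auto
  moreover have "Q i (residual n F - Q (Suc n) (residual n F)) = Q i (residual n F) - Q i (Q (Suc n) (residual n F))"
    using Suc.prems by (intro Q_diff Q_mem residual_mem) auto
  ultimately show ?case by (simp add: fun_diff_def)
qed simp

text \<open>A product of commuting idempotents 1 - Q i is idempotent. This supplies the splitting
  used in \<open>sum_ranges_eq\<close>.\<close>

lemma residual_idem: "n \<le> N \<Longrightarrow> F \<in> \<F> \<Longrightarrow> residual n (residual n F) = residual n F"
proof (induction n)
  case (Suc n)
  let ?r = "residual n F" and ?q = "Q (Suc n)"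
  have r: "?r \<in> \<F>" "?q ?r \<in> \<F>" using Suc.prems by (auto intro!: residual_mem Q_mem)
  have "residual n (?r - ?q ?r) = residual n ?r - residual n (?q ?r)"
    using Suc.prems r by (intro residual_diff) auto
  also have "residual n (?q ?r) = ?q (residual n ?r)"
    using Suc.prems r by (intro residual_Q) auto
  also have "residual n ?r = ?r" using Suc by simp
  finally have 1: "residual n (?r - ?q ?r) = ?r - ?q ?r" .
  have "?q (?r - ?q ?r) = ?q ?r - ?q (?q ?r)"
    using Suc.prems r by (intro Q_diff) auto
  then have "?q (?r - ?q ?r) = 0" using Suc.prems r by (simp add: Q_idem)
  with 1 show ?case by (simp add: fun_diff_def zero_fun_def)
qed simp

text \<open>Each factor 1 - Q i has norm at most 1 + 2 = 3. The 2 in the bound on Q i comes from the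
  projections 1 - S with S a contraction.\<close>

lemma residual_bound:
  "n \<le> N \<Longrightarrow> F \<in> \<F> \<Longrightarrow> (LINT y|lam. \<bar>residual n F y\<bar>) \<le> 3 ^ n * (LINT y|lam. \<bar>F y\<bar>)"
proof (induction n)
  case (Suc n)
  let ?r = "residual n F" and ?q = "Q (Suc n)"
  have r: "?r \<in> \<F>" using Suc.prems by (intro residual_mem) auto
  have "(LINT y|lam. \<bar>residual (Suc n) F y\<bar>) \<le> (LINT y|lam. \<bar>?r y\<bar>) + (LINT y|lam. \<bar>?q ?r y\<bar>)"
    using L1_diff_le[OF r Q_mem[OF _ r, of "Suc n"]] Suc.prems by simp
  also have "\<dots> \<le> 3 * (LINT y|lam. \<bar>?r y\<bar>)"
    using Q_bound[OF _ r, of "Suc n"] Suc.prems by simp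
  also have "\<dots> \<le> 3 ^ Suc n * (LINT y|lam. \<bar>F y\<bar>)" using Suc by simp
  finally show ?case .
qed simp

text \<open>Let R be the product up to \<open>n\<close>. An F killed by the next product splits as
  (F - R F) + R F: idempotence of R puts the first part into the kernel of R, and that the new
  factor kills R F means that \<open>Q (Suc n)\<close> fixes it. The converse inclusion uses that R
  commutes with \<open>Q (Suc n)\<close>.\<close>

lemma sum_ranges_eq:
  "n \<le> N \<Longrightarrow> (\<Sum>i = 1..n. {F \<in> \<F>. Q i F = F}) = {F \<in> \<F>. residual n F = 0}"
proof (induction n)
  case 0
  \<comment> \<open>The empty sum of sets is {0}, in agreement with the empty product being the
    identity.\<close>
  have "{F \<in> \<F>. F = 0} = {0}" using \<F>_0 by auto
  then show ?case by (simp add: set_zero zero_fun_def)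
next
  case (Suc n)
  have i: "Suc n \<in> {1..N}" and n: "n \<le> N" using Suc.prems by auto
  have Q0: "Q (Suc n) 0 = 0" using Q_diff[OF i \<F>_0 \<F>_0] by simp
  have R0: "residual n 0 = 0" using residual_diff[OF n \<F>_0 \<F>_0] by simp
  have "(\<Sum>i = 1..Suc n. {F \<in> \<F>. Q i F = F}) = {F \<in> \<F>. residual n F = 0} + {F \<in> \<F>. Q (Suc n) F = F}"
  proof -
    have "(\<Sum>i = 1..n. {F \<in> \<F>. Q i F = F}) = {F \<in> \<F>. residual n F = 0}"
      using Suc.IH[OF n] by (simp add: zero_fun_def)
    then show ?thesis by simp
  qed
  also have "\<dots> = {F \<in> \<F>. residual (Suc n) F = 0}"
  proof (intro Set.set_eqI iffI)
    fix F assume "F \<in> {F \<in> \<F>. residual n F = 0} + {F \<in> \<F>. Q (Suc n) F = F}"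
    then obtain A B where AB: "F = A + B" "A \<in> \<F>" "residual n A = 0" "B \<in> \<F>" "Q (Suc n) B = B"
      by (auto elim!: set_plus_elim)
    have mB: "- B \<in> \<F>" using AB(4) by (rule \<F>_uminus)
    have "residual n (0 - B) = residual n 0 - residual n B" by (rule residual_diff[OF n \<F>_0 AB(4)])
    then have RmB: "residual n (- B) = - residual n B" by (simp add: R0)
    have "residual n F = residual n A - residual n (- B)"
      using residual_diff[OF n AB(2) mB] AB(1) by simp
    then have RF: "residual n F = residual n B" by (simp add: AB(3) RmB)
    have "Q (Suc n) (residual n B) = residual n B"
      using residual_Q[OF n i AB(4)] AB(5) by simp
    then have "residual (Suc n) F = 0" by (simp add: RF)
    then show "F \<in> {F \<in> \<F>. residual (Suc n) F = 0}" using AB \<F>_add by simp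
  next
    fix F assume "F \<in> {F \<in> \<F>. residual (Suc n) F = 0}"
    then have F: "F \<in> \<F>" "residual n F = Q (Suc n) (residual n F)" by auto
    have r: "residual n F \<in> \<F>" by (rule residual_mem[OF n F(1)])
    have "residual n (F - residual n F) = 0"
      using residual_diff[OF n F(1) r] residual_idem[OF n F(1)] by simp
    then have "(F - residual n F) + residual n F \<in> {F \<in> \<F>. residual n F = 0} + {F \<in> \<F>. Q (Suc n) F = F}"
      using F r \<F>_diff[OF F(1) r] by (intro set_plus_intro) auto
    then show "F \<in> {F \<in> \<F>. residual n F = 0} + {F \<in> \<F>. Q (Suc n) F = F}" by simp
  qed
  finally show ?case .
qed

text \<open>For H in the kernel of the product R, R F = R (F - H) has L1-norm at most 3^N times the
  distance from F to H. So R F has norm 0 for F in the closure, and an element of \<F> of norm 0 is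
  0.\<close>

lemma sum_ranges_closed: "\<F>_closed lam (\<Sum>i = 1..N. {F \<in> \<F>. Q i F = F})"
proof -
  define T where "T = {F \<in> \<F>. residual N F = 0}"
  have "T \<subseteq> \<F> \<inter> L1_closure lam T"
    using \<F>_subset_\<X>[OF weil] by (force simp: T_def L1_closure_def)
  moreover have "F \<in> T" if "F \<in> \<F>" "F \<in> L1_closure lam T" for F
  proof -
    let ?r = "residual N F"
    have r: "?r \<in> \<F>" using that(1) by (intro residual_mem) auto
    have "(LINT y|lam. \<bar>?r y\<bar>) \<le> 0 + e" if "e > 0" for e
    proof -
      have "e / 3 ^ N > 0" using that by simp
      then obtain H where H: "H \<in> T" "(LINT y|lam. \<bar>F y - H y\<bar>) < e / 3 ^ N"
        using \<open>F \<in> L1_closure lam T\<close> unfolding L1_closure_def by blast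
      have H': "H \<in> \<F>" "residual N H = 0" using H(1) by (auto simp: T_def)
      have "?r = residual N (F - H)" using residual_diff[OF _ \<open>F \<in> \<F>\<close> H'(1)] H'(2) by simp
      then have "(LINT y|lam. \<bar>?r y\<bar>) \<le> 3 ^ N * (LINT y|lam. \<bar>(F - H) y\<bar>)"
        using residual_bound[OF _ \<F>_diff[OF \<open>F \<in> \<F>\<close> H'(1)], of N] by simp
      also have "\<dots> \<le> 3 ^ N * (e / 3 ^ N)"
        using H(2) by (intro mult_left_mono) auto
      finally show ?thesis by simp
    qed
    then have "(LINT y|lam. \<bar>?r y\<bar>) \<le> 0" by (rule field_le_epsilon)
    then show ?thesis using L1_zero[OF r] that(1) by (simp add: T_def)
  qed
  ultimately have "\<F>_closed lam T" unfolding \<F>_closed_def by blast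
  then show ?thesis unfolding T_def sum_ranges_eq[OF order_refl] .
qed

end

text \<open>The average of an element of \<F> is again in \<F>, where vanishing almost everywhere is
  vanishing; so the definition of \<E> describes an exact kernel.\<close>

lemma \<E>_eq:
  assumes K: "is_subfield K" "haar_probability K nu"
  shows "\<E> lam nu = {F \<in> \<F>. U_op nu F = 0}"
proof -
  have "(AE y in lam. S_op nu F y = 0) \<longleftrightarrow> U_op nu F = 0" if F: "F \<in> \<F>" for F
    using \<F>_AE_0[OF weil U_op_\<F>[OF K F]] F by (auto simp: S_op_def)
  then show ?thesis by (auto simp: \<E>_def)
qed

end

theorem theorem8p1:
  fixes lam :: "place measure"
    and nu :: "qbar set \<Rightarrow> (qbar \<Rightarrow> qbar) measure"
    and K :: "nat \<Rightarrow> qbar set"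
    and M N :: nat
  assumes "weil_measure lam"
    and "\<And>L. is_subfield L \<Longrightarrow> haar_probability L (nu L)"
    and "1 \<le> N"
    and "\<And>n. n \<in> {1..N} \<Longrightarrow> is_subfield (K n)"
    and "\<And>m n. m \<in> {1..N} \<Longrightarrow> n \<in> {1..N} \<Longrightarrow> m \<noteq> n \<Longrightarrow>
      galois_extension (K m) (K m \<inter> K n) \<or> galois_extension (K n) (K m \<inter> K n)"
    and "M \<le> N"
  shows "\<F>_closed lam ((\<Sum>n = 1..M. \<D> (K n)) + (\<Sum>n = M + 1..N. \<E> lam (nu (K n))))"
proof -
  define U where "U i = U_op (nu (K i))" for i
  \<comment> \<open>One family of projections for both kinds of summands: F is fixed by 1 - U i
    exactly if U i kills F.\<close>
  define Q where "Q i F = (if i \<le> M then U i F else F - U i F)" for i F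
  have K: "is_subfield (K i)" "haar_probability (K i) (nu (K i))" if "i \<in> {1..N}" for i
    using assms(2,4) that by auto
  have U_mem: "U i F \<in> \<F>" and U_idem: "U i (U i F) = U i F"
    and U_bound: "(LINT y|lam. \<bar>U i F y\<bar>) \<le> (LINT y|lam. \<bar>F y\<bar>)" if "i \<in> {1..N}" "F \<in> \<F>" for i F
    using U_op_\<F>[OF K[OF that(1)] that(2)] U_op_idem[OF K[OF that(1)] that(2)]
      U_op_contractive[OF assms(1) K[OF that(1)] that(2)] by (simp_all add: U_def)
  have U_diff: "U i (F - H) = U i F - U i H" if "i \<in> {1..N}" "F \<in> \<F>" "H \<in> \<F>" for i F H
    using U_op_diff[OF K[OF that(1)] that(2,3)] by (simp add: U_def)
  have U_comm: "U i (U j F) = U j (U i F)" if ij: "i \<in> {1..N}" "j \<in> {1..N}" and F: "F \<in> \<F>" for i j F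
  proof (cases "i = j")
    case False
    from assms(5)[OF ij False] show ?thesis
    proof
      assume "galois_extension (K i) (K i \<inter> K j)"
      then show ?thesis
        unfolding U_def using U_op_commute[OF K[OF ij(1)] K[OF ij(2)] _ F] by blast
    next
      assume "galois_extension (K j) (K i \<inter> K j)"
      then show ?thesis
        unfolding U_def using U_op_commute[OF K[OF ij(2)] K[OF ij(1)] _ F] by (simp add: Int_commute)
    qed
  qed simp
  have closed: "\<F>_closed lam (\<Sum>i = 1..N. {F \<in> \<F>. Q i F = F})"
  proof (rule sum_ranges_closed[OF assms(1)])
    fix i F assume i: "i \<in> {1..N}" and F: "F \<in> \<F>"
    show "Q i F \<in> \<F>" using U_mem[OF i F] F by (simp add: Q_def \<F>_diff)
    show "Q i (Q i F) = Q i F"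
      using U_idem[OF i F] U_diff[OF i F U_mem[OF i F]] by (simp add: Q_def)
    show "(LINT y|lam. \<bar>Q i F y\<bar>) \<le> 2 * (LINT y|lam. \<bar>F y\<bar>)"
    proof (cases "i \<le> M")
      case True
      have "0 \<le> (LINT y|lam. \<bar>F y\<bar>)" by (rule integral_nonneg_AE) simp
      moreover have "Q i F = U i F" using True by (simp add: Q_def)
      moreover note U_bound[OF i F]
      ultimately show ?thesis by (simp only:)
    next
      case False
      then show ?thesis
        using L1_diff_le[OF assms(1) F U_mem[OF i F]] U_bound[OF i F] by (simp add: Q_def)
    qed
    show "Q i (F - H) = Q i F - Q i H" if H: "H \<in> \<F>" for H
      using U_diff[OF i F H] by (simp add: Q_def)
    show "Q i (Q j F) = Q j (Q i F)" if j: "j \<in> {1..N}" for j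
      using U_comm[OF i j F] U_diff[OF i F U_mem[OF j F]] U_diff[OF j F U_mem[OF i F]] by (simp add: Q_def)
  qed
  have D: "\<D> (K i) = {F \<in> \<F>. Q i F = F}" if "i \<in> {1..M}" for i
  proof -
    have i: "i \<in> {1..N}" using that assms(6) by auto
    show ?thesis using that \<D>_iff[OF K[OF i]] by (auto simp: Q_def U_def)
  qed
  have E: "\<E> lam (nu (K i)) = {F \<in> \<F>. Q i F = F}" if "i \<in> {M + 1..N}" for i
  proof -
    have i: "i \<in> {1..N}" using that by auto
    show ?thesis unfolding \<E>_eq[OF assms(1) K[OF i]] using that by (auto simp: Q_def U_def)
  qed
  \<comment> \<open>If M = 0 or M = N, one of the two ranges is empty and its sum of sets is {0},
    the neutral element.\<close>
  have "{1..N} = {1..M} \<union> {M + 1..N}" using assms(6) by auto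
  then have "(\<Sum>i = 1..N. {F \<in> \<F>. Q i F = F}) =
      (\<Sum>i = 1..M. {F \<in> \<F>. Q i F = F}) + (\<Sum>i = M + 1..N. {F \<in> \<F>. Q i F = F})"
    by (simp add: sum.union_disjoint)
  also have "\<dots> = (\<Sum>n = 1..M. \<D> (K n)) + (\<Sum>n = M + 1..N. \<E> lam (nu (K n)))"
    using D E by (intro arg_cong2[where f = "(+)"] sum.cong) auto
  finally show ?thesis using closed by simp
qed

end
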